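(* For any poset $P$ on $\{1,2,\dots,n\}$, one has $$\Psi_P(\mathbf{x}) := \sum_{w\in\mathcal{L}(P)} w\left(\frac{1}{(x_1-x_2)(x_2-x_3)\cdots(x_{n-1}-x_n)}\right) = s(K^{\mathrm{root}}_P;\mathbf{x}),$$ $$\Phi_P(\mathbf{x}) := \sum_{w\in\mathcal{L}(P)} w\left(\frac{1}{x_1(x_1+x_2)(x_1+x_2+x_3)\cdots(x_1+\cdots+x_n)}\right) = s(K^{\mathrm{wt}}_P;\mathbf{x}).$$
   Context: $\mathcal{L}(P)$ is the set of linear extensions of $P$: permutations $w=(w(1),\dots,w(n))\in\mathfrak{S}_n$ such that $i<_P j$ implies $i$ appears before $j$ in the list $w$. A permutation $w$ acts on rational functions by $x_i\mapsto x_{w(i)}$. The cones are $K^{\mathrm{wt}}_P=\{x\in\mathbb{R}_+^n : x_i\ge x_j \text{ for } i<_P j\}$ inside $\mathbb{R}^n$ with standard Lebesgue measure, and $K^{\mathrm{root}}_P=\mathbb{R}_+\{e_i-e_j : i<_P j\}$ inside the hyperplane $V^{\mathrm{root}}=\{v\in\mathbb{R}^n:v_1+\cdots+v_n=0\}$, with Lebesgue measure normalized so that the parallelepiped spanned by $e_1-e_2,\dots,e_{n-1}-e_n$ has volume $1$. Here $\mathbb{R}_+$ is the set of nonnegative reals, and $\langle\mathbf{x},v\rangle=\sum_i x_iv_i$. For a polyhedral cone $K$ in an ambient finite-dimensional real space $V$ with a fixed Lebesgue measure $dv$, $s(K;\mathbf{x})$ denotes the following rational function: $s(K;\mathbf{x})=0$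 if $K$ contains a line (is not pointed) or is not full-dimensional in $V$; if $K$ is pointed and full-dimensional, $s(K;\mathbf{x})$ is the rational function whose value is $\int_K e^{-\langle\mathbf{x},v\rangle}\,dv$ for all $\mathbf{x}$ in the interior of the dual cone $K^*$. It is a valuation: a linear relation $\sum_i c_i\chi_{K_i}=0$ among characteristic functions of cones implies $\sum_i c_i s(K_i;\mathbf{x})=0$. *)

theory Defs
  imports
    "HOL-Analysis.Analysis"
    "HOL-Combinatorics.Permutations"
    "HOL-Computational_Algebra.Fraction_Field"
    "HOL-Library.Poly_Mapping"
begin

section \<open>Rational functions\<close>

text \<open>Finitely supported exponent vectors are monomials, so the following type is the polynomial
  ring over the reals in variables indexed by the naturals. It is an integral domain.\<close>

type_synonym mpoly = "(nat \<Rightarrow>\<^sub>0 nat) \<Rightarrow>\<^sub>0 real"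
type_synonym ratfun = "mpoly fract"

definition xvar :: "nat \<Rightarrow> ratfun" where
  "xvar i = Fract (Poly_Mapping.single (Poly_Mapping.single i 1) 1) 1"

definition polys_in :: "nat \<Rightarrow> mpoly set" where
  "polys_in n = {p. \<forall>m\<in>Poly_Mapping.keys p. Poly_Mapping.keys m \<subseteq> {1..n}}"

definition ratfuns_in :: "nat \<Rightarrow> ratfun set" where
  "ratfuns_in n = {Fract p q | p q. p \<in> polys_in n \<and> q \<in> polys_in n \<and> q \<noteq> 0}"

definition mpoly_eval :: "(nat \<Rightarrow> real) \<Rightarrow> mpoly \<Rightarrow> real" where
  "mpoly_eval x p =
     (\<Sum>m\<in>Poly_Mapping.keys p.
        Poly_Mapping.lookup p m * (\<Prod>i\<in>Poly_Mapping.keys m. x i ^ Poly_Mapping.lookup m i))"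

text \<open>\<open>f\<close> is regular at \<open>x\<close> and takes the value \<open>c\<close> there. The fraction may be chosen freely, so a
  removable common factor of numerator and denominator is no obstruction.\<close>

definition ratfun_value :: "ratfun \<Rightarrow> (nat \<Rightarrow> real) \<Rightarrow> real \<Rightarrow> bool" where
  "ratfun_value f x c \<longleftrightarrow>
     (\<exists>p q. f = Fract p q \<and> mpoly_eval x q \<noteq> 0 \<and> c = mpoly_eval x p / mpoly_eval x q)"

definition mpoly_rename :: "(nat \<Rightarrow> nat) \<Rightarrow> mpoly \<Rightarrow> mpoly" where
  "mpoly_rename w p =
     (\<Sum>m\<in>Poly_Mapping.keys p.
        Poly_Mapping.single
          (\<Sum>i\<in>Poly_Mapping.keys m. Poly_Mapping.single (w i) (Poly_Mapping.lookup m i))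
          (Poly_Mapping.lookup p m))"

text \<open>The action of a permutation \<open>w\<close> on rational functions by \<open>x i \<mapsto> x (w i)\<close>. For bijective \<open>w\<close>
  renaming is an injective ring homomorphism, so the result does not depend on the fraction.\<close>

definition perm_act :: "(nat \<Rightarrow> nat) \<Rightarrow> ratfun \<Rightarrow> ratfun" where
  "perm_act w f =
     (THE g. \<exists>p q. q \<noteq> 0 \<and> f = Fract p q \<and> g = Fract (mpoly_rename w p) (mpoly_rename w q))"

section \<open>The space \<open>\<real>\<^sup>n\<close> and Lebesgue measures on its subspaces\<close>

text \<open>Vectors of \<open>\<real>\<^sup>n\<close> are functions on \<open>{1..n}\<close>, extensional outside, as in the product measure.\<close>

definition unitv :: "nat \<Rightarrow> nat \<Rightarrow> real" where
  "unitv i k = of_bool (k = i)"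

definition pairing :: "nat \<Rightarrow> (nat \<Rightarrow> real) \<Rightarrow> (nat \<Rightarrow> real) \<Rightarrow> real" where
  "pairing n x v = (\<Sum>i\<in>{1..n}. x i * v i)"

definition std_measure :: "nat \<Rightarrow> (nat \<Rightarrow> real) measure" where
  "std_measure n = (\<Pi>\<^sub>M i\<in>{1..n}. lborel)"

definition V_root :: "nat \<Rightarrow> (nat \<Rightarrow> real) set" where
  "V_root n = {v \<in> extensional {1..n}. (\<Sum>i\<in>{1..n}. v i) = 0}"

text \<open>Lebesgue measure on the root hyperplane in the coordinates \<open>c\<close> of the basis
  \<open>e\<^sub>i - e\<^sub>i\<^sub>+\<^sub>1\<close>, \<open>1 \<le> i < n\<close>; the parallelepiped spanned by this basis has measure 1.\<close>

definition root_measure :: "nat \<Rightarrow> (nat \<Rightarrow> real) measure" where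
  "root_measure n =
     distr (\<Pi>\<^sub>M i\<in>{1..<n}. lborel)
       (restrict_space (std_measure n) (V_root n))
       (\<lambda>c. \<lambda>k\<in>{1..n}. \<Sum>i\<in>{1..<n}. c i * (unitv i k - unitv (i + 1) k))"

section \<open>Cones and the rational function \<open>s\<close>\<close>

definition dual_cone :: "nat \<Rightarrow> (nat \<Rightarrow> real) set \<Rightarrow> (nat \<Rightarrow> real) set" where
  "dual_cone n K = {x \<in> extensional {1..n}. \<forall>v\<in>K. 0 \<le> pairing n x v}"

definition dual_interior :: "nat \<Rightarrow> (nat \<Rightarrow> real) set \<Rightarrow> (nat \<Rightarrow> real) set" where
  "dual_interior n K = powertop_real {1..n} interior_of dual_cone n K"

definition contains_line :: "nat \<Rightarrow> (nat \<Rightarrow> real) set \<Rightarrow> bool" where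
  "contains_line n K \<longleftrightarrow>
     (\<exists>a d. (\<exists>k\<in>{1..n}. d k \<noteq> 0) \<and> (\<forall>t::real. (\<lambda>k\<in>{1..n}. a k + t * d k) \<in> K))"

definition lin_span :: "nat \<Rightarrow> (nat \<Rightarrow> real) set \<Rightarrow> (nat \<Rightarrow> real) set" where
  "lin_span n K =
     {(\<lambda>k\<in>{1..n}. \<Sum>u\<in>F. c u * u k) | F c. finite F \<and> F \<subseteq> K}"

text \<open>\<open>K\<close> is a polyhedral cone in the subspace \<open>space M\<close> of \<open>\<real>\<^sup>n\<close>, with \<open>M\<close> the chosen Lebesgue
  measure on this subspace. A point \<open>x\<close> of \<open>\<real>\<^sup>n\<close> acts on the subspace through the pairing, and the
  dual cone is taken in \<open>\<real>\<^sup>n\<close>: it is the preimage of the dual cone in \<open>(space M)\<^sup>*\<close> under the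
  restriction map, and its interior is the preimage of the interior. The condition
  \<open>f \<in> ratfuns_in n\<close> is needed for uniqueness, since \<open>dual_interior\<close> lives in \<open>\<real>\<^sup>n\<close> only.\<close>

definition cone_s :: "nat \<Rightarrow> (nat \<Rightarrow> real) measure \<Rightarrow> (nat \<Rightarrow> real) set \<Rightarrow> ratfun" where
  "cone_s n M K =
     (if contains_line n K \<or> lin_span n K \<noteq> space M then 0
      else THE f. f \<in> ratfuns_in n \<and>
        (\<forall>x\<in>dual_interior n K. \<exists>c.
           has_bochner_integral M (\<lambda>v. indicator K v * exp (- pairing n x v)) c \<and>
           ratfun_value f x c))"

section \<open>Posets on \<open>{1..n}\<close>\<close>

text \<open>A poset is a reflexive relation \<open>P\<close> with \<open>partial_order_on {1..n} P\<close>, where \<open>(i, j) \<in> P\<close> means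
  \<open>i \<le>\<^sub>P j\<close>; the strict order is \<open>P - Id\<close>.\<close>

definition K_wt :: "nat \<Rightarrow> nat rel \<Rightarrow> (nat \<Rightarrow> real) set" where
  "K_wt n P =
     {v \<in> extensional {1..n}. (\<forall>i\<in>{1..n}. 0 \<le> v i) \<and> (\<forall>(i, j)\<in>P - Id. v i \<ge> v j)}"

definition K_root :: "nat \<Rightarrow> nat rel \<Rightarrow> (nat \<Rightarrow> real) set" where
  "K_root n P =
     {(\<lambda>k\<in>{1..n}. \<Sum>(i, j)\<in>P - Id. c (i, j) * (unitv i k - unitv j k)) | c.
        \<forall>a\<in>P - Id. (0::real) \<le> c a}"

definition linear_extensions :: "nat \<Rightarrow> nat rel \<Rightarrow> (nat \<Rightarrow> nat) set" where
  "linear_extensions n P =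
     {w. w permutes {1..n} \<and>
         (\<forall>a\<in>{1..n}. \<forall>b\<in>{1..n}. (w a, w b) \<in> P - Id \<longrightarrow> a < b)}"

definition Psi :: "nat \<Rightarrow> nat rel \<Rightarrow> ratfun" where
  "Psi n P =
     (\<Sum>w\<in>linear_extensions n P.
        perm_act w (1 / (\<Prod>i\<in>{1..<n}. xvar i - xvar (i + 1))))"

definition Phi :: "nat \<Rightarrow> nat rel \<Rightarrow> ratfun" where
  "Phi n P =
     (\<Sum>w\<in>linear_extensions n P.
        perm_act w (1 / (\<Prod>i\<in>{1..n}. \<Sum>j\<in>{1..i}. xvar j)))"

end

theory Submission
  imports Defs
begin

text \<open>
  Both rational functions are the integral of \<open>exp (- \<langle>x, v\<rangle>)\<close> over a cone that is cut into simplicial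
  pieces indexed by the linear extensions of \<open>P\<close>.

  \<^bold>\<open>Weight cone.\<close> Sorting the coordinates of \<open>v\<close> decreasingly, with ties broken by a labelling that
  decreases along \<open>P\<close>, assigns one permutation to \<open>v\<close>. For \<open>v\<close> in the cone it is a linear extension, so
  the cone is the disjoint union of half-open chambers (\<open>indicator_K_wt\<close>). The integral over a chamber
  is found by integrating out the largest coordinate first (\<open>nn_integral_chamber\<close>), which produces the
  partial sums of \<open>x\<close> one after the other. The prefixes of a linear extension are order ideals, and on
  the interior of the dual cone \<open>x\<close> has a positive sum over every nonempty ideal; hence each summand of
  \<open>Phi\<close> is regular there.

  \<^bold>\<open>Root cone.\<close> Here the cone is not a union of the pieces. Fix a point \<open>x\<close> that decreases along \<open>P\<close>
  and has distinct coordinates. For a linear extension \<open>w\<close> take the simplicial cone spanned by the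
  vectors \<open>unitv (w i) - unitv (w (i + 1))\<close>, and replace each generator on which \<open>x\<close> is negative by its opposite, at the cost of
  a sign. The signed sum of the indicators of these half-open cones is exactly the indicator of
  \<open>K_root\<close> (\<open>signed_sum_linear_extensions\<close> and \<open>K_root_iff\<close>): expanding the signs turns it into a sum
  over the chains of ideals on which \<open>v\<close> is negative, and this alternating sum detects whether there
  is such an ideal (\<open>chain_alternating_sum\<close>). The flips make all integrals converge, and since
  permuting coordinates preserves the measure of the hyperplane (\<open>distr_reorder\<close>), the piece of \<open>w\<close>
  contributes the summand of \<open>w\<close> in \<open>Psi\<close>.

  This proves the root identity at generic points. The summands of \<open>Psi\<close> have poles on the hyperplanes
  \<open>x\<^sub>a = x\<^sub>b\<close> for incomparable \<open>a\<close> and \<open>b\<close>, and these hyperplanes meet the interior of the dual cone. The integral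
  is finite there and is a limit of its generic values, so the numerator of \<open>Psi\<close> vanishes on such a
  hyperplane and the factor cancels (\<open>cancel_incomparable_factors\<close>). Finally, if the cone is not
  full-dimensional, the ground set splits into two complementary ideals, the cone is a null set, and
  the numerator of \<open>Psi\<close> vanishes everywhere.
\<close>

section \<open>Evaluation and renaming of polynomials\<close>

definition polyvar :: "nat \<Rightarrow> mpoly" where
  "polyvar i = Poly_Mapping.single (Poly_Mapping.single i 1) 1"

abbreviation polyconst :: "real \<Rightarrow> mpoly" where
  "polyconst c \<equiv> Poly_Mapping.single 0 c"

text \<open>Evaluation at a point and renaming of variables are both ring homomorphisms determined by their
  values on coefficients and on monomials; their laws are proved once, for this common form.\<close>
definition poly_extend :: "(real \<Rightarrow> 'a) \<Rightarrow> ((nat \<Rightarrow>\<^sub>0 nat) \<Rightarrow> 'a) \<Rightarrow> mpoly \<Rightarrow> 'a::comm_ring_1" where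
  "poly_extend \<iota> \<phi> p = (\<Sum>m\<in>Poly_Mapping.keys p. \<iota> (Poly_Mapping.lookup p m) * \<phi> m)"

abbreviation (input) monomial_sum :: "('a \<Rightarrow>\<^sub>0 'b::comm_monoid_add) \<Rightarrow> 'a \<Rightarrow>\<^sub>0 'b" where
  "monomial_sum p \<equiv> \<Sum>m\<in>Poly_Mapping.keys p. Poly_Mapping.single m (Poly_Mapping.lookup p m)"

lemma poly_mapping_sum_singles:
  fixes p :: "'a \<Rightarrow>\<^sub>0 'b::comm_monoid_add"
  shows "(\<Sum>m\<in>Poly_Mapping.keys p. Poly_Mapping.single m (Poly_Mapping.lookup p m)) = p"
proof (rule poly_mapping_eqI)
  fix k
  have "Poly_Mapping.lookup (\<Sum>m\<in>Poly_Mapping.keys p. Poly_Mapping.single m (Poly_Mapping.lookup p m)) k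
     = (\<Sum>m\<in>Poly_Mapping.keys p. if m = k then Poly_Mapping.lookup p m else 0)"
    unfolding lookup_sum by (intro sum.cong) (auto simp: lookup_single when_def)
  also have "\<dots> = Poly_Mapping.lookup p k"
    by (simp add: in_keys_iff)
  finally show "Poly_Mapping.lookup (\<Sum>m\<in>Poly_Mapping.keys p. Poly_Mapping.single m (Poly_Mapping.lookup p m)) k
     = Poly_Mapping.lookup p k" .
qed

locale monomial_hom =
  fixes \<iota> :: "real \<Rightarrow> 'a::comm_ring_1" and \<phi> :: "(nat \<Rightarrow>\<^sub>0 nat) \<Rightarrow> 'a"
  assumes coeff_0: "\<iota> 0 = 0" and coeff_1: "\<iota> 1 = 1"
    and coeff_add: "\<iota> (a + b) = \<iota> a + \<iota> b" and coeff_mult: "\<iota> (a * b) = \<iota> a * \<iota> b"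
    and mono_0: "\<phi> 0 = 1" and mono_add: "\<phi> (m + m') = \<phi> m * \<phi> m'"
begin

lemma ext_superset:
  assumes "finite S" "Poly_Mapping.keys p \<subseteq> S"
  shows "poly_extend \<iota> \<phi> p = (\<Sum>m\<in>S. \<iota> (Poly_Mapping.lookup p m) * \<phi> m)"
  unfolding poly_extend_def using assms
  by (intro sum.mono_neutral_left) (auto simp: in_keys_iff coeff_0)

lemma ext_0: "poly_extend \<iota> \<phi> 0 = 0"
  by (simp add: poly_extend_def)

lemma ext_single: "poly_extend \<iota> \<phi> (Poly_Mapping.single m c) = \<iota> c * \<phi> m"
  by (simp add: poly_extend_def coeff_0)

lemma ext_1: "poly_extend \<iota> \<phi> 1 = 1"
  by (simp add: poly_extend_def coeff_1 mono_0)

lemma ext_add: "poly_extend \<iota> \<phi> (p + q) = poly_extend \<iota> \<phi> p + poly_extend \<iota> \<phi> q"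
proof -
  let ?S = "Poly_Mapping.keys p \<union> Poly_Mapping.keys q"
  have "finite ?S" by simp
  moreover have "Poly_Mapping.keys (p + q) \<subseteq> ?S" by (rule keys_add)
  ultimately show ?thesis
    by (simp add: ext_superset[of ?S] lookup_add coeff_add algebra_simps sum.distrib)
qed

lemma ext_sum: "poly_extend \<iota> \<phi> (\<Sum>a\<in>A. f a) = (\<Sum>a\<in>A. poly_extend \<iota> \<phi> (f a))"
  by (induction A rule: infinite_finite_induct) (auto simp: ext_0 ext_add)

lemma ext_mult: "poly_extend \<iota> \<phi> (p * q) = poly_extend \<iota> \<phi> p * poly_extend \<iota> \<phi> q"
proof -
  let ?l = "Poly_Mapping.lookup" and ?k = "Poly_Mapping.keys" and ?s = "Poly_Mapping.single"
  have "p * q = (\<Sum>m\<in>?k p. ?s m (?l p m)) * (\<Sum>m\<in>?k q. ?s m (?l q m))"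
    by (simp add: poly_mapping_sum_singles)
  also have "\<dots> = (\<Sum>m\<in>?k p. \<Sum>m'\<in>?k q. ?s (m + m') (?l p m * ?l q m'))"
    by (simp add: sum_product mult_single)
  finally have "poly_extend \<iota> \<phi> (p * q)
      = (\<Sum>m\<in>?k p. \<Sum>m'\<in>?k q. \<iota> (?l p m * ?l q m') * \<phi> (m + m'))"
    by (simp add: ext_sum ext_single)
  also have "\<dots> = poly_extend \<iota> \<phi> p * poly_extend \<iota> \<phi> q"
    unfolding poly_extend_def sum_product
    by (simp add: coeff_mult mono_add algebra_simps)
  finally show ?thesis .
qed

lemma ext_uminus: "poly_extend \<iota> \<phi> (- p) = - poly_extend \<iota> \<phi> p"
  using ext_add[of p "-p"] by (simp add: ext_0 eq_neg_iff_add_eq_0 add.commute)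

lemma ext_diff: "poly_extend \<iota> \<phi> (p - q) = poly_extend \<iota> \<phi> p - poly_extend \<iota> \<phi> q"
  using ext_add[of p "-q"] by (simp add: ext_uminus)

lemma ext_prod: "poly_extend \<iota> \<phi> (\<Prod>a\<in>A. f a) = (\<Prod>a\<in>A. poly_extend \<iota> \<phi> (f a))"
  by (induction A rule: infinite_finite_induct) (auto simp: ext_1 ext_mult)

lemmas ext_hom = ext_0 ext_1 ext_add ext_uminus ext_diff ext_mult ext_sum ext_prod

end

definition monomial_value :: "(nat \<Rightarrow> 'a::comm_monoid_mult) \<Rightarrow> (nat \<Rightarrow>\<^sub>0 nat) \<Rightarrow> 'a" where
  "monomial_value x m = (\<Prod>i\<in>Poly_Mapping.keys m. x i ^ Poly_Mapping.lookup m i)"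

lemma monomial_value_superset:
  assumes "finite S" "Poly_Mapping.keys m \<subseteq> S"
  shows "monomial_value x m = (\<Prod>i\<in>S. x i ^ Poly_Mapping.lookup m i)"
  unfolding monomial_value_def using assms
  by (intro prod.mono_neutral_left) (auto simp: in_keys_iff)

lemma monomial_value_0: "monomial_value x 0 = 1"
  by (simp add: monomial_value_def)

lemma monomial_value_add:
  "monomial_value x (m + m') = monomial_value x m * monomial_value x m'"
proof -
  let ?S = "Poly_Mapping.keys m \<union> Poly_Mapping.keys m'"
  have "finite ?S" by simp
  moreover have "Poly_Mapping.keys (m + m') \<subseteq> ?S" by (rule keys_add)
  ultimately show ?thesis
    by (simp add: monomial_value_superset[of ?S] lookup_add power_add prod.distrib)
qed

lemma monomial_value_sum: "monomial_value x (\<Sum>a\<in>A. f a) = (\<Prod>a\<in>A. monomial_value x (f a))"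
  by (induction A rule: infinite_finite_induct) (auto simp: monomial_value_0 monomial_value_add)

lemma monomial_value_single: "monomial_value x (Poly_Mapping.single i k) = x i ^ k"
  by (simp add: monomial_value_def)

interpretation ev: monomial_hom "\<lambda>c. c" "monomial_value x" for x :: "nat \<Rightarrow> real"
  by unfold_locales (auto simp: monomial_value_0 monomial_value_add)

lemma mpoly_eval_ext: "mpoly_eval x = poly_extend (\<lambda>c. c) (monomial_value x)"
  by (auto simp: mpoly_eval_def poly_extend_def monomial_value_def)

lemma eval_polyvar [simp]: "mpoly_eval x (polyvar i) = x i"
  unfolding mpoly_eval_ext polyvar_def ev.ext_single by (simp add: monomial_value_single)

lemma eval_polyconst [simp]: "mpoly_eval x (polyconst c) = c"
  unfolding mpoly_eval_ext ev.ext_single by (simp add: monomial_value_0)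

lemmas eval_hom = ev.ext_hom[folded mpoly_eval_ext]

definition monomial_rename :: "(nat \<Rightarrow> nat) \<Rightarrow> (nat \<Rightarrow>\<^sub>0 nat) \<Rightarrow> nat \<Rightarrow>\<^sub>0 nat" where
  "monomial_rename w m =
     (\<Sum>i\<in>Poly_Mapping.keys m. Poly_Mapping.single (w i) (Poly_Mapping.lookup m i))"

lemma monomial_rename_superset:
  assumes "finite S" "Poly_Mapping.keys m \<subseteq> S"
  shows "monomial_rename w m = (\<Sum>i\<in>S. Poly_Mapping.single (w i) (Poly_Mapping.lookup m i))"
  unfolding monomial_rename_def using assms
  by (intro sum.mono_neutral_left) (auto simp: in_keys_iff)

lemma monomial_rename_0 [simp]: "monomial_rename w 0 = 0"
  by (simp add: monomial_rename_def)

lemma monomial_rename_add: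
  "monomial_rename w (m + m') = monomial_rename w m + monomial_rename w m'"
proof -
  let ?S = "Poly_Mapping.keys m \<union> Poly_Mapping.keys m'"
  have "finite ?S" by simp
  moreover have "Poly_Mapping.keys (m + m') \<subseteq> ?S" by (rule keys_add)
  ultimately show ?thesis
    by (simp add: monomial_rename_superset[of ?S] lookup_add single_add sum.distrib)
qed

lemma monomial_rename_sum: "monomial_rename w (\<Sum>a\<in>A. f a) = (\<Sum>a\<in>A. monomial_rename w (f a))"
  by (induction A rule: infinite_finite_induct) (auto simp: monomial_rename_add)

lemma monomial_rename_single [simp]:
  "monomial_rename w (Poly_Mapping.single i k) = Poly_Mapping.single (w i) k"
  by (simp add: monomial_rename_def)

lemma monomial_rename_rename:
  "monomial_rename u (monomial_rename w m) = monomial_rename (u \<circ> w) m"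
  unfolding monomial_rename_def[of w] monomial_rename_sum monomial_rename_single
  by (simp add: monomial_rename_def[of "u \<circ> w"])

lemma monomial_rename_id [simp]: "monomial_rename id m = m"
  by (simp add: monomial_rename_def poly_mapping_sum_singles)

interpretation rn: monomial_hom polyconst "\<lambda>m. Poly_Mapping.single (monomial_rename w m) 1"
  for w :: "nat \<Rightarrow> nat"
  by unfold_locales (auto simp: single_add mult_single monomial_rename_add)

lemma mpoly_rename_ext:
  "mpoly_rename w = poly_extend polyconst (\<lambda>m. Poly_Mapping.single (monomial_rename w m) 1)"
  by (auto simp: mpoly_rename_def poly_extend_def monomial_rename_def mult_single)

lemmas rename_hom = rn.ext_hom[folded mpoly_rename_ext]

lemma rename_single [simp]:
  "mpoly_rename w (Poly_Mapping.single m c) = Poly_Mapping.single (monomial_rename w m) c"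
  unfolding mpoly_rename_ext rn.ext_single by (simp add: mult_single)

lemma rename_polyvar [simp]: "mpoly_rename w (polyvar i) = polyvar (w i)"
  by (simp add: polyvar_def)

text \<open>Renaming is functorial, which makes renaming by a bijection injective.\<close>
lemma rename_rename: "mpoly_rename u (mpoly_rename w p) = mpoly_rename (u \<circ> w) p"
proof -
  have "mpoly_rename u (mpoly_rename w (monomial_sum p))
      = mpoly_rename (u \<circ> w) (monomial_sum p)"
    by (simp only: rename_hom rename_single monomial_rename_rename)
  then show ?thesis by (simp only: poly_mapping_sum_singles)
qed

lemma rename_id [simp]: "mpoly_rename id p = p"
proof -
  have "mpoly_rename id (monomial_sum p)
      = (monomial_sum p)"
    by (simp only: rename_hom rename_single monomial_rename_id)
  then show ?thesis by (simp only: poly_mapping_sum_singles)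
qed

lemma eval_rename: "mpoly_eval x (mpoly_rename w p) = mpoly_eval (x \<circ> w) p"
proof -
  have *: "monomial_value x (monomial_rename w m) = monomial_value (x \<circ> w) m" for m
    unfolding monomial_rename_def monomial_value_sum monomial_value_single
    by (simp add: monomial_value_def)
  have "mpoly_eval x (mpoly_rename w (monomial_sum p))
      = mpoly_eval (x \<circ> w) (monomial_sum p)"
    by (simp add: rename_hom eval_hom) (simp add: mpoly_eval_ext ev.ext_single *)
  then show ?thesis by (simp only: poly_mapping_sum_singles)
qed

lemma rename_eq_0_iff:
  assumes "bij w" shows "mpoly_rename w p = 0 \<longleftrightarrow> p = 0"
proof
  assume "mpoly_rename w p = 0"
  then have "mpoly_rename (inv w) (mpoly_rename w p) = 0"
    by (simp add: rename_hom)
  then show "p = 0"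
    using assms by (simp add: rename_rename bij_is_inj)
qed (simp add: rename_hom)

lemma perm_act_Fract:
  assumes "bij w" "q \<noteq> 0"
  shows "perm_act w (Fract p q) = Fract (mpoly_rename w p) (mpoly_rename w q)"
  unfolding perm_act_def
proof (rule the_equality)
  show "\<exists>p' q'. q' \<noteq> 0 \<and> Fract p q = Fract p' q' \<and>
      Fract (mpoly_rename w p) (mpoly_rename w q) = Fract (mpoly_rename w p') (mpoly_rename w q')"
    using assms by blast
next
  fix g assume "\<exists>p' q'. q' \<noteq> 0 \<and> Fract p q = Fract p' q' \<and>
      g = Fract (mpoly_rename w p') (mpoly_rename w q')"
  then obtain p' q' where *: "q' \<noteq> 0" "Fract p q = Fract p' q'"
      "g = Fract (mpoly_rename w p') (mpoly_rename w q')" by blast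
  then have "p * q' = p' * q" using assms by (simp add: eq_fract)
  then have "mpoly_rename w p * mpoly_rename w q' = mpoly_rename w p' * mpoly_rename w q"
    by (simp only: rename_hom [symmetric])
  then show "g = Fract (mpoly_rename w p) (mpoly_rename w q)"
    using * assms by (simp add: eq_fract rename_eq_0_iff)
qed

lemma polys_in_0 [simp]: "0 \<in> polys_in n" and polys_in_1 [simp]: "1 \<in> polys_in n"
  and polys_in_const [simp]: "polyconst c \<in> polys_in n"
  by (auto simp: polys_in_def)

lemma polys_in_var: "i \<in> {1..n} \<Longrightarrow> polyvar i \<in> polys_in n"
  by (auto simp: polys_in_def polyvar_def)

lemma polys_in_add: "p \<in> polys_in n \<Longrightarrow> q \<in> polys_in n \<Longrightarrow> p + q \<in> polys_in n"
  unfolding polys_in_def using keys_add[of p q] by blast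

lemma polys_in_mult: 
  assumes "p \<in> polys_in n" "q \<in> polys_in n" shows "p * q \<in> polys_in n"
  unfolding polys_in_def
proof safe
  fix m i assume "m \<in> Poly_Mapping.keys (p * q)" "i \<in> Poly_Mapping.keys m"
  then obtain a b where "m = a + b" "a \<in> Poly_Mapping.keys p" "b \<in> Poly_Mapping.keys q"
    using keys_mult[of p q] by blast
  with assms \<open>i \<in> Poly_Mapping.keys m\<close> keys_add[of a b] show "i \<in> {1..n}"
    unfolding polys_in_def by blast
qed

lemma polys_in_diff:
  assumes "p \<in> polys_in n" "q \<in> polys_in n" shows "p - q \<in> polys_in n"
proof -
  have "p - q = p + polyconst (-1) * q" by (simp add: single_uminus)
  then show ?thesis using assms by (simp only: polys_in_add polys_in_mult polys_in_const)
qed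

lemma polys_in_sum: "(\<And>a. a \<in> A \<Longrightarrow> f a \<in> polys_in n) \<Longrightarrow> sum f A \<in> polys_in n"
  by (induction A rule: infinite_finite_induct) (auto intro: polys_in_add)

lemma polys_in_prod: "(\<And>a. a \<in> A \<Longrightarrow> f a \<in> polys_in n) \<Longrightarrow> prod f A \<in> polys_in n"
  by (induction A rule: infinite_finite_induct) (auto intro: polys_in_mult)

lemma single_eq_prod_polyvar:
  "Poly_Mapping.single m c = polyconst c * (\<Prod>i\<in>Poly_Mapping.keys m. polyvar i ^ Poly_Mapping.lookup m i)"
proof -
  have pw: "polyvar i ^ k = Poly_Mapping.single (Poly_Mapping.single i k) 1" for i k
    by (induction k) (auto simp: polyvar_def mult_single single_add[symmetric])
  have "(\<Prod>i\<in>A. Poly_Mapping.single (f i) 1) = (Poly_Mapping.single (\<Sum>i\<in>A. f i) 1 :: mpoly)"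
    for A :: "nat set" and f
    by (induction A rule: infinite_finite_induct) (auto simp: mult_single)
  then show ?thesis
    by (simp add: pw poly_mapping_sum_singles mult_single)
qed

text \<open>Constants and variables generate the polynomial ring, so properties that are stable under sums and
  products propagate from them.\<close>
lemma polys_in_induct [consumes 1, case_names const var add mult]:
  assumes p: "p \<in> polys_in n"
    and const: "\<And>c. Q (polyconst c)" and var: "\<And>i. i \<in> {1..n} \<Longrightarrow> Q (polyvar i)"
    and add: "\<And>p q. Q p \<Longrightarrow> Q q \<Longrightarrow> Q (p + q)" and mult: "\<And>p q. Q p \<Longrightarrow> Q q \<Longrightarrow> Q (p * q)"
  shows "Q p"
proof -
  have pow: "Q (q ^ k)" if "Q q" for q k
    using that const[of 1] by (induction k) (auto intro: mult)
  have prod: "Q (prod f A)" if "\<And>a. a \<in> A \<Longrightarrow> Q (f a)" for f :: "nat \<Rightarrow> mpoly" and A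
    using that const[of 1] by (induction A rule: infinite_finite_induct) (auto intro: mult)
  have sum: "Q (sum f A)" if "\<And>a. a \<in> A \<Longrightarrow> Q (f a)" for f :: "(nat \<Rightarrow>\<^sub>0 nat) \<Rightarrow> mpoly" and A
    using that const[of 0] by (induction A rule: infinite_finite_induct) (auto intro: add)
  have "Q (monomial_sum p)"
  proof (rule sum)
    fix m assume "m \<in> Poly_Mapping.keys p"
    then have "Poly_Mapping.keys m \<subseteq> {1..n}" using p by (auto simp: polys_in_def)
    then show "Q (Poly_Mapping.single m (Poly_Mapping.lookup p m))"
      unfolding single_eq_prod_polyvar[of m] by (intro mult const prod pow var) auto
  qed
  then show ?thesis by (simp only: poly_mapping_sum_singles)
qed

lemma polys_in_rename:
  assumes "p \<in> polys_in n" "\<And>i. i \<in> {1..n} \<Longrightarrow> w i \<in> {1..n}"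
  shows "mpoly_rename w p \<in> polys_in n"
  using assms(1)
proof (induction rule: polys_in_induct)
  case (var i)
  then show ?case using polys_in_var[OF assms(2)] by simp
qed (simp_all add: rename_hom polys_in_add polys_in_mult)

section \<open>Polynomials vanishing on boxes and hyperplanes\<close>

text \<open>With all variables but the last fixed, the sum is a polynomial in the last variable with infinitely
  many roots, so each of its coefficients vanishes; a coefficient collects the monomials of one fixed
  degree in the last variable, to which the induction hypothesis applies.\<close>

lemma monomials_independent:
  fixes a :: "(nat \<Rightarrow>\<^sub>0 nat) \<Rightarrow> real"
  assumes "finite M" "\<And>i. i \<in> {1..n} \<Longrightarrow> infinite (S i)"
    and "\<And>m m'. m \<in> M \<Longrightarrow> m' \<in> M \<Longrightarrow>
           (\<And>i. i \<in> {1..n} \<Longrightarrow> Poly_Mapping.lookup m i = Poly_Mapping.lookup m' i) \<Longrightarrow> m = m'"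
    and "\<And>x. (\<And>i. i \<in> {1..n} \<Longrightarrow> x i \<in> S i) \<Longrightarrow>
           (\<Sum>m\<in>M. a m * (\<Prod>i\<in>{1..n}. x i ^ Poly_Mapping.lookup m i)) = 0"
    and "m0 \<in> M"
  shows "a m0 = 0"
  using assms
proof (induction n arbitrary: M)
  case 0
  then have "M = {m0}" by fastforce
  then show ?case using 0(4) by simp
next
  case (Suc n)
  let ?l = "Poly_Mapping.lookup"
  define M0 where "M0 = {m \<in> M. ?l m (Suc n) = ?l m0 (Suc n)}"
  show ?case
  proof (rule Suc.IH[of M0])
    fix x assume x: "\<And>i. i \<in> {1..n} \<Longrightarrow> x i \<in> S i"
    define c where "c m = a m * (\<Prod>i\<in>{1..n}. x i ^ ?l m i)" for m
    define q where "q = (\<Sum>m\<in>M. Polynomial.monom (c m) (?l m (Suc n)))"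
    have "poly q t = 0" if "t \<in> S (Suc n)" for t
    proof -
      let ?y = "x(Suc n := t)"
      have "(\<Sum>m\<in>M. a m * (\<Prod>i\<in>{1..Suc n}. ?y i ^ ?l m i)) = 0"
        by (rule Suc.prems(4)) (use x that in \<open>auto simp: le_Suc_eq\<close>)
      moreover have "(\<Prod>i\<in>{1..n}. ?y i ^ ?l m i) = (\<Prod>i\<in>{1..n}. x i ^ ?l m i)" for m
        by (rule prod.cong) auto
      ultimately show ?thesis
        by (simp add: q_def c_def poly_sum poly_monom mult_ac)
    qed
    then have "S (Suc n) \<subseteq> {t. poly q t = 0}" by auto
    then have "q = 0"
      using Suc.prems(2)[of "Suc n"] poly_roots_finite[of q] finite_subset by fastforce
    then have "0 = coeff q (?l m0 (Suc n))" by simp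
    also have "\<dots> = (\<Sum>m\<in>M. if ?l m (Suc n) = ?l m0 (Suc n) then c m else 0)"
      by (simp add: q_def coeff_sum)
    also have "\<dots> = (\<Sum>m\<in>M0. c m)"
      unfolding M0_def using Suc.prems(1) by (simp add: sum.inter_filter)
    finally show "(\<Sum>m\<in>M0. a m * (\<Prod>i\<in>{1..n}. x i ^ ?l m i)) = 0"
      by (simp add: c_def)
  next
    fix m m' assume m: "m \<in> M0" "m' \<in> M0" "\<And>i. i \<in> {1..n} \<Longrightarrow> ?l m i = ?l m' i"
    show "m = m'"
    proof (rule Suc.prems(3))
      fix i assume "i \<in> {1..Suc n}"
      then show "?l m i = ?l m' i"
        using m by (cases "i = Suc n") (auto simp: M0_def)
    qed (use m in \<open>auto simp: M0_def\<close>)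
  qed (use Suc.prems in \<open>auto simp: M0_def\<close>)
qed

lemma polynomial_vanishing_on_box:
  assumes p: "p \<in> polys_in n" and S: "\<And>i. i \<in> {1..n} \<Longrightarrow> infinite (S i)"
    and 0: "\<And>x. x \<in> (\<Pi>\<^sub>E i\<in>{1..n}. S i) \<Longrightarrow> mpoly_eval x p = 0"
  shows "p = 0"
proof -
  let ?l = "Poly_Mapping.lookup"
  have keys: "Poly_Mapping.keys m \<subseteq> {1..n}" if "m \<in> Poly_Mapping.keys p" for m
    using p that by (auto simp: polys_in_def)
  have "?l p m0 = 0" if m0: "m0 \<in> Poly_Mapping.keys p" for m0
  proof (rule monomials_independent[of "Poly_Mapping.keys p" n S "?l p" m0])
    fix m m' assume *: "m \<in> Poly_Mapping.keys p" "m' \<in> Poly_Mapping.keys p"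
       "\<And>i. i \<in> {1..n} \<Longrightarrow> ?l m i = ?l m' i"
    show "m = m'"
    proof (rule poly_mapping_eqI)
      fix k show "?l m k = ?l m' k"
      proof (cases "k \<in> {1..n}")
        case False
        then have "k \<notin> Poly_Mapping.keys m" "k \<notin> Poly_Mapping.keys m'"
          using keys[OF *(1)] keys[OF *(2)] by blast+
        then show ?thesis by (simp add: in_keys_iff)
      qed (rule *(3))
    qed
  next
    fix x :: "nat \<Rightarrow> real" assume "\<And>i. i \<in> {1..n} \<Longrightarrow> x i \<in> S i"
    then have "restrict x {1..n} \<in> (\<Pi>\<^sub>E i\<in>{1..n}. S i)" by simp
    then have "0 = (\<Sum>m\<in>Poly_Mapping.keys p. ?l p m * monomial_value (restrict x {1..n}) m)"
      using 0 by (simp add: mpoly_eval_ext poly_extend_def)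
    also have "\<dots> = (\<Sum>m\<in>Poly_Mapping.keys p. ?l p m * (\<Prod>i\<in>{1..n}. x i ^ ?l m i))"
      by (intro sum.cong refl) (simp add: monomial_value_superset[OF _ keys])
    finally show "(\<Sum>m\<in>Poly_Mapping.keys p. ?l p m * (\<Prod>i\<in>{1..n}. x i ^ ?l m i)) = 0" by simp
  qed (use S m0 in auto)
  then show ?thesis by (intro poly_mapping_eqI) (auto simp: in_keys_iff)
qed

text \<open>Renaming the variable \<open>a\<close> to \<open>b\<close> is reduction modulo the linear form \<open>x\<^sub>a - x\<^sub>b\<close>. Stability under
  products is the Leibniz rule \<open>p q - p' q' = p (q - q') + (p - p') q'\<close>.\<close>
lemma linear_form_dvd_diff_rename:
  assumes "p \<in> polys_in n" "a \<in> {1..n}" "b \<in> {1..n}"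
  shows "\<exists>q\<in>polys_in n. p - mpoly_rename (id(a := b)) p = (polyvar a - polyvar b) * q"
proof -
  define \<rho> where "\<rho> = mpoly_rename (id(a := b))"
  define d where "d = polyvar a - polyvar b"
  have "p \<in> polys_in n \<and> (\<exists>q\<in>polys_in n. p - \<rho> p = d * q)"
    using assms(1)
  proof (induction rule: polys_in_induct)
    case (const c)
    show ?case by (auto simp: \<rho>_def intro!: bexI[of _ 0])
  next
    case (var i)
    show ?case
    proof (cases "i = a")
      case True
      then show ?thesis using var by (auto simp: \<rho>_def d_def intro!: bexI[of _ 1] polys_in_var)
    next
      case False
      then show ?thesis using var by (auto simp: \<rho>_def intro!: bexI[of _ 0] polys_in_var)
    qed
  next
    case (add p q)
    then obtain r s where "r \<in> polys_in n" "s \<in> polys_in n" "p - \<rho> p = d * r" "q - \<rho> q = d * s"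
      by auto
    moreover have "p + q - \<rho> (p + q) = (p - \<rho> p) + (q - \<rho> q)"
      by (simp add: \<rho>_def rename_hom)
    ultimately have "r + s \<in> polys_in n" "p + q - \<rho> (p + q) = d * (r + s)"
      by (auto simp: distrib_left intro: polys_in_add)
    then show ?case using add polys_in_add by auto
  next
    case (mult p q)
    then obtain r s where *: "r \<in> polys_in n" "s \<in> polys_in n" "p - \<rho> p = d * r" "q - \<rho> q = d * s"
      by auto
    have "\<rho> q \<in> polys_in n"
      unfolding \<rho>_def using mult assms by (intro polys_in_rename) auto
    moreover have "p * q - \<rho> (p * q) = p * (q - \<rho> q) + (p - \<rho> p) * \<rho> q"
      by (simp add: \<rho>_def rename_hom algebra_simps)
    ultimately have "p * s + r * \<rho> q \<in> polys_in n" "p * q - \<rho> (p * q) = d * (p * s + r * \<rho> q)"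
      using * mult by (auto simp: algebra_simps intro: polys_in_add polys_in_mult)
    then show ?case using mult polys_in_mult by blast
  qed
  then show ?thesis by (simp add: \<rho>_def d_def)
qed

text \<open>The renamed polynomial vanishes on the whole box: setting the coordinate \<open>a\<close> equal to the coordinate
  \<open>b\<close> does not leave the box, as it has the same side in both directions.\<close>
lemma linear_form_dvd:
  assumes p: "p \<in> polys_in n" and ab: "a \<in> {1..n}" "b \<in> {1..n}"
    and S: "\<And>i. i \<in> {1..n} \<Longrightarrow> infinite (S i)" "S a = S b"
    and 0: "\<And>x. x \<in> (\<Pi>\<^sub>E i\<in>{1..n}. S i) \<Longrightarrow> x a = x b \<Longrightarrow> mpoly_eval x p = 0"
  shows "\<exists>q\<in>polys_in n. p = (polyvar a - polyvar b) * q"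
proof -
  have "mpoly_rename (id(a := b)) p = 0"
  proof (rule polynomial_vanishing_on_box[where S = S])
    fix x assume x: "x \<in> (\<Pi>\<^sub>E i\<in>{1..n}. S i)"
    have "x \<circ> id(a := b) = x(a := x b)" by auto
    moreover have "x(a := x b) \<in> (\<Pi>\<^sub>E i\<in>{1..n}. S i)"
      using x ab S(2) by (auto simp: PiE_iff extensional_def)
    ultimately show "mpoly_eval x (mpoly_rename (id(a := b)) p) = 0"
      using 0[of "x(a := x b)"] by (simp add: eval_rename)
  qed (use p ab S in \<open>auto intro: polys_in_rename\<close>)
  then show ?thesis using linear_form_dvd_diff_rename[OF p ab] by simp
qed

section \<open>Values of rational functions\<close>

lemma Fract_eval_eq:
  assumes "Fract p q = Fract p' q'" "mpoly_eval x q \<noteq> 0" "mpoly_eval x q' \<noteq> 0"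
  shows "mpoly_eval x p / mpoly_eval x q = mpoly_eval x p' / mpoly_eval x q'"
proof -
  have "q \<noteq> 0" "q' \<noteq> 0" using assms by (auto simp: eval_hom)
  then have "p * q' = p' * q" using assms by (simp add: eq_fract)
  then have "mpoly_eval x p * mpoly_eval x q' = mpoly_eval x p' * mpoly_eval x q"
    by (simp only: eval_hom [symmetric])
  then show ?thesis using assms by (simp add: field_simps)
qed

lemma ratfun_value_Fract:
  "mpoly_eval x q \<noteq> 0 \<Longrightarrow> ratfun_value (Fract p q) x c \<longleftrightarrow> c = mpoly_eval x p / mpoly_eval x q"
  unfolding ratfun_value_def by (metis Fract_eval_eq)

lemma ratfun_value_0: "ratfun_value 0 x 0"
  by (auto simp: Zero_fract_def ratfun_value_Fract eval_hom)

lemma ratfun_value_add: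
  assumes "ratfun_value f x c" "ratfun_value g x d"
  shows "ratfun_value (f + g) x (c + d)"
proof -
  obtain p q p' q' where *: "f = Fract p q" "mpoly_eval x q \<noteq> 0" "c = mpoly_eval x p / mpoly_eval x q"
    "g = Fract p' q'" "mpoly_eval x q' \<noteq> 0" "d = mpoly_eval x p' / mpoly_eval x q'"
    using assms by (auto simp: ratfun_value_def)
  then have "q \<noteq> 0" "q' \<noteq> 0" by (auto simp: eval_hom)
  with * show ?thesis
    by (auto simp: ratfun_value_Fract eval_hom field_simps)
qed

lemma ratfun_value_sum:
  "(\<And>a. a \<in> A \<Longrightarrow> ratfun_value (f a) x (c a)) \<Longrightarrow> ratfun_value (sum f A) x (sum c A)"
  by (induction A rule: infinite_finite_induct) (auto intro: ratfun_value_0 ratfun_value_add)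

lemma ratfuns_in_0: "0 \<in> ratfuns_in n"
  unfolding ratfuns_in_def Zero_fract_def
  by (rule CollectI, rule exI[of _ 0], rule exI[of _ 1]) simp

lemma ratfuns_in_add:
  assumes "f \<in> ratfuns_in n" "g \<in> ratfuns_in n" shows "f + g \<in> ratfuns_in n"
proof -
  obtain p q p' q' where *: "f = Fract p q" "p \<in> polys_in n" "q \<in> polys_in n" "q \<noteq> 0"
     "g = Fract p' q'" "p' \<in> polys_in n" "q' \<in> polys_in n" "q' \<noteq> 0"
    using assms by (auto simp: ratfuns_in_def)
  then have "f + g = Fract (p * q' + p' * q) (q * q')" by simp
  moreover have "p * q' + p' * q \<in> polys_in n" "q * q' \<in> polys_in n" "q * q' \<noteq> 0"
    using * by (auto intro: polys_in_add polys_in_mult)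
  ultimately show ?thesis unfolding ratfuns_in_def by blast
qed

lemma ratfuns_in_sum: "(\<And>a. a \<in> A \<Longrightarrow> f a \<in> ratfuns_in n) \<Longrightarrow> sum f A \<in> ratfuns_in n"
  by (induction A rule: infinite_finite_induct) (auto intro: ratfuns_in_0 ratfuns_in_add)

text \<open>A rational function is determined by its values on a box. Multiplying the cross difference by both
  denominators makes it vanish also at the points where a denominator does.\<close>
lemma ratfun_eqI:
  assumes f: "f \<in> ratfuns_in n" and g: "g \<in> ratfuns_in n"
    and S: "\<And>i. i \<in> {1..n} \<Longrightarrow> infinite (S i)"
    and val: "\<And>x. x \<in> (\<Pi>\<^sub>E i\<in>{1..n}. S i) \<Longrightarrow> \<exists>c. ratfun_value f x c \<and> ratfun_value g x c"
  shows "f = g"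
proof -
  obtain p q p' q' where *: "f = Fract p q" "p \<in> polys_in n" "q \<in> polys_in n" "q \<noteq> 0"
     "g = Fract p' q'" "p' \<in> polys_in n" "q' \<in> polys_in n" "q' \<noteq> 0"
    using f g by (auto simp: ratfuns_in_def)
  define r where "r = (p * q' - p' * q) * (q * q')"
  have "r = 0"
  proof (rule polynomial_vanishing_on_box[where S = S])
    show "r \<in> polys_in n" using * by (auto simp: r_def intro!: polys_in_mult polys_in_diff)
    fix x assume "x \<in> (\<Pi>\<^sub>E i\<in>{1..n}. S i)"
    then obtain c where c: "ratfun_value f x c" "ratfun_value g x c" using val by blast
    show "mpoly_eval x r = 0"
    proof (cases "mpoly_eval x q = 0 \<or> mpoly_eval x q' = 0")
      case False
      then have "mpoly_eval x p / mpoly_eval x q = mpoly_eval x p' / mpoly_eval x q'"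
        using c * by (simp add: ratfun_value_Fract)
      then show ?thesis using False by (simp add: r_def eval_hom field_simps)
    qed (auto simp: r_def eval_hom)
  qed (use S in auto)
  then show ?thesis using * by (auto simp: r_def eq_fract)
qed

lemma tendsto_mpoly_eval:
  assumes "p \<in> polys_in n" "\<And>i. i \<in> {1..n} \<Longrightarrow> ((\<lambda>t. x t i) \<longlongrightarrow> y i) F"
  shows "((\<lambda>t. mpoly_eval (x t) p) \<longlongrightarrow> mpoly_eval y p) F"
  using assms(1)
proof (induction rule: polys_in_induct)
  case (var i)
  then show ?case using assms(2) by simp
qed (simp_all add: eval_hom tendsto_add tendsto_mult)

section \<open>Linear extensions and chains of ideals\<close>

definition sorts :: "nat \<Rightarrow> (nat \<Rightarrow> nat \<Rightarrow> bool) \<Rightarrow> (nat \<Rightarrow> nat) \<Rightarrow> bool" where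
  "sorts n lt w \<longleftrightarrow> w permutes {1..n} \<and> (\<forall>i\<in>{1..n}. \<forall>j\<in>{1..n}. i < j \<longrightarrow> lt (w i) (w j))"

text \<open>The sorting permutation is the inverse of the rank function of the strict linear order.\<close>
lemma ex1_sorts:
  assumes irrefl: "\<And>a. a \<in> {1..n} \<Longrightarrow> \<not> lt a a"
    and trans: "\<And>a b c. a \<in> {1..n} \<Longrightarrow> b \<in> {1..n} \<Longrightarrow> c \<in> {1..n} \<Longrightarrow> lt a b \<Longrightarrow> lt b c \<Longrightarrow> lt a c"
    and total: "\<And>a b. a \<in> {1..n} \<Longrightarrow> b \<in> {1..n} \<Longrightarrow> a \<noteq> b \<Longrightarrow> lt a b \<or> lt b a"
  shows "\<exists>!w. sorts n lt w"
proof -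
  let ?A = "{1..n}"
  define r where "r a = (if a \<in> ?A then Suc (card {b\<in>?A. lt b a}) else a)" for a
  have r_mono: "r a < r b" if "a \<in> ?A" "b \<in> ?A" "lt a b" for a b
  proof -
    have "{c\<in>?A. lt c a} \<subset> {c\<in>?A. lt c b}"
      using that irrefl[of a] trans[of _ a b] by blast
    then have "card {c\<in>?A. lt c a} < card {c\<in>?A. lt c b}"
      by (intro psubset_card_mono) auto
    with that show ?thesis by (simp add: r_def)
  qed
  have r_inj: "inj_on r ?A"
    by (rule inj_onI) (metis r_mono total less_irrefl)
  have r_le: "r a \<in> ?A" if "a \<in> ?A" for a
  proof -
    have "{b\<in>?A. lt b a} \<subset> ?A" using that irrefl[of a] by blast
    then have "card {b\<in>?A. lt b a} < card ?A" by (intro psubset_card_mono) auto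
    with that show ?thesis by (simp add: r_def)
  qed
  have "r ` ?A = ?A"
    using r_le r_inj by (intro card_subset_eq) (auto simp: card_image)
  with r_inj have r_perm: "r permutes ?A"
    by (intro bij_imp_permutes) (auto simp: bij_betw_def r_def)
  have sorts_rank: "r (w i) = i" if w: "sorts n lt w" and i: "i \<in> ?A" for w i
  proof -
    have p: "w permutes ?A" using w by (simp add: sorts_def)
    have "{b\<in>?A. lt b (w i)} = w ` {1..<i}"
    proof (intro set_eqI iffI)
      fix b assume "b \<in> {b\<in>?A. lt b (w i)}"
      then obtain j where j: "j \<in> ?A" "b = w j" "lt (w j) (w i)"
        using permutes_image[OF p] by (metis (mono_tags, lifting) imageE mem_Collect_eq)
      then have "\<not> i \<le> j"
        using w i irrefl[of "w i"] trans[of "w i" "w j" "w i"] permutes_in_image[OF p]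
        by (metis le_neq_implies_less sorts_def)
      with j show "b \<in> w ` {1..<i}" by auto
    next
      fix b assume "b \<in> w ` {1..<i}"
      then obtain j where j: "b = w j" "j \<in> ?A" "j < i" using i by auto
      then have "w j \<in> ?A" "lt (w j) (w i)"
        using w i permutes_in_image[OF p, of j] by (simp_all add: sorts_def)
      then show "b \<in> {b\<in>?A. lt b (w i)}" using j by simp
    qed
    moreover have "inj_on w {1..<i}" using permutes_inj[OF p] by (rule inj_on_subset) auto
    ultimately show ?thesis
      using i permutes_in_image[OF p, of i] by (simp add: r_def card_image)
  qed
  show ?thesis
  proof (rule ex1I)
    show "sorts n lt (inv r)"
      unfolding sorts_def
    proof (intro conjI ballI impI)
      show p: "inv r permutes ?A" by (rule permutes_inv[OF r_perm])
      fix i j assume ij: "i \<in> ?A" "j \<in> ?A" "i < j"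
      then have "inv r i \<in> ?A" "inv r j \<in> ?A" "r (inv r i) = i" "r (inv r j) = j"
        using permutes_in_image[OF p] permutes_inverses[OF r_perm] by auto
      then show "lt (inv r i) (inv r j)"
        using total r_mono ij by (metis less_irrefl not_less_iff_gr_or_eq)
    qed
  next
    fix w assume w: "sorts n lt w"
    then have p: "w permutes ?A" by (simp add: sorts_def)
    have "r (w i) = i" for i
      using sorts_rank[OF w] permutes_not_in[OF p, of i] by (cases "i \<in> ?A") (auto simp: r_def)
    then show "w = inv r"
      using permutes_inverses[OF r_perm] by (metis ext)
  qed
qed

definition ideals :: "nat \<Rightarrow> nat rel \<Rightarrow> nat set set" where
  "ideals n P = {I. I \<subseteq> {1..n} \<and> (\<forall>(a, b)\<in>P - Id. b \<in> I \<longrightarrow> a \<in> I)}"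

lemma finite_ideals [simp]: "finite (ideals n P)"
  by (rule finite_subset[of _ "Pow {1..n}"]) (auto simp: ideals_def)

definition nested :: "'a set set \<Rightarrow> bool" where
  "nested C \<longleftrightarrow> (\<forall>I\<in>C. \<forall>J\<in>C. I \<subseteq> J \<or> J \<subseteq> I)"

lemma sum_Pow_alternating:
  assumes "finite N" shows "(\<Sum>C\<in>Pow N. (-1) ^ card C) = (of_bool (N = {}) :: real)"
proof -
  have "(\<Sum>C\<in>Pow N. (-1) ^ card C) = (\<Prod>x\<in>N. (-1) + (1::real))"
    by (subst prod_add) (use assms in auto)
  then show ?thesis using assms by (auto simp: prod_zero_iff)
qed

text \<open>The order complex of the sets with negative value is either empty or has reduced Euler
  characteristic \<open>0\<close>. If \<open>L\<close> is itself a chain, this is the binomial theorem. Otherwise pick \<open>i\<close> and \<open>j\<close>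
  such that some member of \<open>L\<close> contains only \<open>i\<close> and another one only \<open>j\<close>. No chain contains sets of
  both kinds, so the chains of \<open>L\<close> are those of the sublattice without sets of the one kind together
  with those of the sublattice without sets of the other kind, and inclusion-exclusion applies. The
  right-hand side obeys the same rule because \<open>v\<close> is modular: if two negative sets are of different kinds,
  their meet or their join is negative, and both are of neither kind.\<close>
lemma chain_alternating_sum:
  fixes v :: "'a set \<Rightarrow> real"
  assumes "finite L"
    and "\<And>I J. I \<in> L \<Longrightarrow> J \<in> L \<Longrightarrow> I \<inter> J \<in> L \<and> I \<union> J \<in> L"
    and "\<And>I J. I \<in> L \<Longrightarrow> J \<in> L \<Longrightarrow> v (I \<inter> J) + v (I \<union> J) = v I + v J"
  shows "(\<Sum>C | C \<subseteq> {I \<in> L. v I < 0} \<and> nested C. (-1) ^ card C) = (of_bool (\<forall>I\<in>L. v I \<ge> 0) :: real)"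
  using assms
proof (induction L rule: finite_psubset_induct)
  case (psubset L)
  define ch where "ch L = {C. C \<subseteq> {I \<in> L. v I < 0} \<and> nested C}" for L
  define f where "f L = (\<Sum>C\<in>ch L. (-1) ^ card C :: real)" for L
  define g where "g L = (of_bool (\<forall>I\<in>L. v I \<ge> 0) :: real)" for L
  have "f L = g L"
  proof (cases "nested L")
    case True
    then have "ch L = Pow {I \<in> L. v I < 0}" by (auto simp: ch_def nested_def)
    moreover have "finite {I \<in> L. v I < 0}" using \<open>finite L\<close> by simp
    ultimately show ?thesis by (auto simp: f_def g_def sum_Pow_alternating)
  next
    case False
    then obtain I J where IJ: "I \<in> L" "J \<in> L" "\<not> I \<subseteq> J" "\<not> J \<subseteq> I" by (auto simp: nested_def)
    then obtain i j where ij: "i \<in> I" "i \<notin> J" "j \<in> J" "j \<notin> I" by auto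
    define L1 where "L1 = {K \<in> L. j \<in> K \<longrightarrow> i \<in> K}"
    define L2 where "L2 = {K \<in> L. i \<in> K \<longrightarrow> j \<in> K}"
    have IH: "f L' = g L'" if "L' \<subset> L" "\<And>I J. I \<in> L' \<Longrightarrow> J \<in> L' \<Longrightarrow> I \<inter> J \<in> L' \<and> I \<union> J \<in> L'" for L'
      using psubset.IH[OF that(1) that(2)] psubset.prems(2) that(1)
      unfolding f_def g_def ch_def by (meson psubset_imp_subset subset_iff)
    have 1: "f L1 = g L1"
      by (rule IH) (use IJ ij psubset.prems(1) in \<open>auto simp: L1_def\<close>)
    have 2: "f L2 = g L2"
      by (rule IH) (use IJ ij psubset.prems(1) in \<open>auto simp: L2_def\<close>)
    have 3: "f (L1 \<inter> L2) = g (L1 \<inter> L2)"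
      by (rule IH) (use IJ ij psubset.prems(1) in \<open>auto simp: L1_def L2_def\<close>)
    have fin: "finite (ch K)" if "finite K" for K
      by (rule finite_subset[of _ "Pow K"]) (use that in \<open>auto simp: ch_def\<close>)
    have "finite L1" "finite L2" using \<open>finite L\<close> by (auto simp: L1_def L2_def)
    have "ch L = ch L1 \<union> ch L2"
    proof (intro equalityI subsetI)
      fix C assume C: "C \<in> ch L"
      show "C \<in> ch L1 \<union> ch L2"
      proof (rule ccontr)
        assume "C \<notin> ch L1 \<union> ch L2"
        then have no: "C \<notin> ch L1" "C \<notin> ch L2" by auto
        have C': "\<And>K. K \<in> C \<Longrightarrow> K \<in> L \<and> v K < 0" "nested C"
          using C by (auto simp: ch_def)
        obtain K where K: "K \<in> C" "K \<notin> L1"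
          using no(1) C' unfolding ch_def by blast
        obtain K' where K': "K' \<in> C" "K' \<notin> L2"
          using no(2) C' unfolding ch_def by blast
        have "j \<in> K" "i \<notin> K" using K C' by (auto simp: L1_def)
        moreover have "i \<in> K'" "j \<notin> K'" using K' C' by (auto simp: L2_def)
        moreover have "K \<subseteq> K' \<or> K' \<subseteq> K" using C'(2) K K' by (auto simp: nested_def)
        ultimately show False by blast
      qed
    qed (auto simp: ch_def L1_def L2_def)
    moreover have "ch (L1 \<inter> L2) = ch L1 \<inter> ch L2"
      by (auto simp: ch_def)
    ultimately have f_rec: "f L + f (L1 \<inter> L2) = f L1 + f L2"
      unfolding f_def by (simp add: sum.union_inter fin \<open>finite L1\<close> \<open>finite L2\<close>)
    have "g L + g (L1 \<inter> L2) = g L1 + g L2"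
    proof (cases "\<forall>K\<in>L1 \<inter> L2. v K \<ge> 0")
      case True
      have "(\<forall>K\<in>L1. v K \<ge> 0) \<or> (\<forall>K\<in>L2. v K \<ge> 0)"
      proof (rule ccontr)
        assume "\<not> ?thesis"
        then obtain K1 K2 where K: "K1 \<in> L1" "v K1 < 0" "K2 \<in> L2" "v K2 < 0"
          by (auto simp: not_le)
        then have KL: "K1 \<in> L" "K2 \<in> L" by (auto simp: L1_def L2_def)
        have "K1 \<notin> L2" "K2 \<notin> L1" using K True by force+
        then have "i \<in> K1" "j \<notin> K1" "j \<in> K2" "i \<notin> K2" using KL by (auto simp: L1_def L2_def)
        then have "K1 \<inter> K2 \<in> L1 \<inter> L2" "K1 \<union> K2 \<in> L1 \<inter> L2"
          using psubset.prems(1)[OF KL] by (auto simp: L1_def L2_def)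
        then have "v (K1 \<inter> K2) \<ge> 0" "v (K1 \<union> K2) \<ge> 0" using True by auto
        then show False using K psubset.prems(2)[of K1 K2] by (auto simp: L1_def L2_def)
      qed
      moreover have "L = L1 \<union> L2" by (auto simp: L1_def L2_def)
      ultimately show ?thesis using True by (auto simp: g_def)
    qed (auto simp: g_def L1_def L2_def)
    then show ?thesis using f_rec 1 2 3 by linarith
  qed
  then show ?case by (simp add: f_def g_def ch_def)
qed

text \<open>The indicator of the half-line on which \<open>exp (- t d)\<close> is integrable, for \<open>d\<close> positive or negative
  according to the flag; the half-line of the second case is open and counted with a minus sign.\<close>
definition signed_ind :: "bool \<Rightarrow> real \<Rightarrow> real" where
  "signed_ind b t = (if b then of_bool (t \<ge> 0) else - of_bool (t < 0))"

lemma down_closed_interval: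
  fixes J :: "nat set"
  assumes "J \<subseteq> {1..n}" "\<And>k l. k \<in> J \<Longrightarrow> 1 \<le> l \<Longrightarrow> l < k \<Longrightarrow> l \<in> J"
  shows "J = {1..card J}"
proof (cases "J = {}")
  case False
  have fin: "finite J" using assms(1) finite_subset by blast
  have "J = {1..Max J}"
  proof (intro equalityI subsetI)
    fix l assume "l \<in> {1..Max J}"
    then show "l \<in> J"
      using assms(2)[of "Max J" l] Max_in[OF fin False] by (cases "l = Max J") auto
  qed (use assms(1) fin in auto)
  then show ?thesis by (metis card_atLeastAtMost diff_Suc_1)
qed auto

text \<open>For a chain \<open>C\<close> this order lists the successive differences of the members of \<open>C\<close> one after the other,
  and inside each difference it lists the elements by decreasing \<open>x\<close>.\<close>
definition blockwise :: "nat set set \<Rightarrow> (nat \<Rightarrow> real) \<Rightarrow> nat \<Rightarrow> nat \<Rightarrow> bool" where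
  "blockwise C x a b \<longleftrightarrow>
     (\<exists>I\<in>C. a \<in> I \<and> b \<notin> I) \<or> (\<forall>I\<in>C. a \<in> I \<longleftrightarrow> b \<in> I) \<and> x a > x b"

lemma ex1_sorts_blockwise:
  assumes "nested C" "inj_on x {1..n}"
  shows "\<exists>!w. sorts n (blockwise C x) w"
proof (rule ex1_sorts)
  fix a b c assume *: "blockwise C x a b" "blockwise C x b c"
  show "blockwise C x a c"
  proof (cases "\<exists>I\<in>C. a \<in> I \<and> c \<notin> I")
    case False
    have "\<not> (\<exists>I\<in>C. a \<in> I \<and> b \<notin> I)"
    proof
      assume "\<exists>I\<in>C. a \<in> I \<and> b \<notin> I"
      then obtain I where I: "I \<in> C" "a \<in> I" "b \<notin> I" "c \<in> I" using False by blast
      then obtain J where J: "J \<in> C" "b \<in> J" "c \<notin> J"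
        using *(2) by (auto simp: blockwise_def)
      then show False using I assms(1) by (fastforce simp: nested_def)
    qed
    then have 1: "\<forall>I\<in>C. a \<in> I \<longleftrightarrow> b \<in> I" "x a > x b" using *(1) by (auto simp: blockwise_def)
    moreover from 1 have "\<not> (\<exists>I\<in>C. b \<in> I \<and> c \<notin> I)" using False by blast
    then have "\<forall>I\<in>C. b \<in> I \<longleftrightarrow> c \<in> I" "x b > x c" using *(2) by (auto simp: blockwise_def)
    ultimately show ?thesis by (auto simp: blockwise_def)
  qed (auto simp: blockwise_def)
next
  fix a b assume ab: "a \<in> {1..n}" "b \<in> {1..n}" "a \<noteq> b"
  then have "x a \<noteq> x b" using assms(2) by (auto dest: inj_onD)
  then show "blockwise C x a b \<or> blockwise C x b a"
    unfolding blockwise_def by (meson linorder_neqE)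
qed (auto simp: blockwise_def)

text \<open>Since \<open>signed_ind b t\<close> is \<open>of_bool b - of_bool (t < 0)\<close>, expanding the products yields a sum over
  pairs of a linear extension \<open>w\<close> and a set \<open>D\<close> of positions such that the prefixes of \<open>w\<close> at positions in \<open>D\<close> are
  negative for \<open>v\<close> and \<open>w\<close> descends along \<open>x\<close> at all positions outside \<open>D\<close>. Sending \<open>(w, D)\<close> to the prefixes of
  \<open>w\<close> at \<open>D\<close> is a bijection to the chains of ideals that are negative for \<open>v\<close>: the permutation is
  recovered by sorting each block of the chain by decreasing \<open>x\<close>, which extends \<open>P\<close> because \<open>x\<close> decreases
  along \<open>P\<close>.\<close>
theorem signed_sum_linear_extensions:
  fixes v x :: "nat \<Rightarrow> real"
  assumes P: "P \<subseteq> {1..n} \<times> {1..n}"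
    and inj: "inj_on x {1..n}"
    and dec: "\<And>a b. (a, b) \<in> P - Id \<Longrightarrow> x a > x b"
    and v: "(\<Sum>k\<in>{1..n}. v k) = 0"
  shows "(\<Sum>w\<in>linear_extensions n P. \<Prod>i\<in>{1..<n}.
            signed_ind (x (w i) > x (w (i + 1))) (\<Sum>k\<in>{1..i}. v (w k)))
       = of_bool (\<forall>I\<in>ideals n P. (\<Sum>k\<in>I. v k) \<ge> 0)"
proof -
  let ?A = "{1..n}" and ?L = "linear_extensions n P"
  define V where "V I = (\<Sum>k\<in>I. v k)" for I
  define S where "S = {(w, D). w \<in> ?L \<and> D \<subseteq> {1..<n} \<and>
      (\<forall>i\<in>D. V (w ` {1..i}) < 0) \<and> (\<forall>i\<in>{1..<n} - D. x (w i) > x (w (i + 1)))}"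
  define T where "T = {C. C \<subseteq> {I \<in> ideals n P. V I < 0} \<and> nested C}"
  define pre where "pre w D = (\<lambda>i. w ` {1..i}) ` D" for w :: "nat \<Rightarrow> nat" and D :: "nat set"
  define sort where "sort C = (THE w. sorts n (blockwise C x) w)" for C
  have finL: "finite ?L"
    by (rule finite_subset[OF _ finite_permutations[of ?A]]) (auto simp: linear_extensions_def)
  have perm: "w permutes ?A" if "w \<in> ?L" for w using that by (simp add: linear_extensions_def)
  have perm_inj: "inj_on w B" if "w permutes ?A" for w and B :: "nat set"
    using permutes_inj[OF that] by (rule inj_on_subset) auto
  have sort: "sorts n (blockwise C x) (sort C)" if "nested C" for C
    unfolding sort_def by (rule theI'[OF ex1_sorts_blockwise[OF that inj]])

  have expand: "(\<Prod>i\<in>{1..<n}. signed_ind (x (w i) > x (w (i + 1))) (\<Sum>k\<in>{1..i}. v (w k)))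
      = (\<Sum>D\<in>{D. (w, D) \<in> S}. (-1) ^ card D)" if w: "w \<in> ?L" for w
  proof -
    have V_eq: "(\<Sum>k\<in>{1..i}. v (w k)) = V (w ` {1..i})" for i
      using perm_inj[OF perm[OF w]] by (simp add: V_def sum.reindex o_def)
    have "(\<Prod>i\<in>{1..<n}. signed_ind (x (w i) > x (w (i + 1))) (\<Sum>k\<in>{1..i}. v (w k)))
        = (\<Prod>i\<in>{1..<n}. - of_bool (V (w ` {1..i}) < 0) + of_bool (x (w i) > x (w (i + 1))))"
      unfolding V_eq by (intro prod.cong) (auto simp: signed_ind_def)
    also have "\<dots> = (\<Sum>D\<in>Pow {1..<n}. (\<Prod>i\<in>D. - of_bool (V (w ` {1..i}) < 0)) *
                        (\<Prod>i\<in>{1..<n} - D. of_bool (x (w i) > x (w (i + 1)))))"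
      by (rule prod_add) simp
    also have "\<dots> = (\<Sum>D\<in>Pow {1..<n}. if (w, D) \<in> S then (-1) ^ card D else 0)"
    proof (rule sum.cong)
      fix D assume D: "D \<in> Pow {1..<n}"
      then have fD: "finite D" using finite_subset by auto
      have bool: "(\<Prod>i\<in>B. of_bool (Q i)) = (of_bool (\<forall>i\<in>B. Q i) :: real)" if "finite B" for B :: "nat set" and Q
        using that by (induction B) auto
      have "(\<Prod>i\<in>D. - of_bool (V (w ` {1..i}) < 0)) = (-1) ^ card D * (of_bool (\<forall>i\<in>D. V (w ` {1..i}) < 0) :: real)"
        by (simp only: prod_uminus bool[OF fD])
      moreover have "(\<Prod>i\<in>{1..<n} - D. of_bool (x (w i) > x (w (i + 1))))
          = (of_bool (\<forall>i\<in>{1..<n} - D. x (w i) > x (w (i + 1))) :: real)"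
        by (rule bool) simp
      ultimately show "(\<Prod>i\<in>D. - of_bool (V (w ` {1..i}) < 0)) *
           (\<Prod>i\<in>{1..<n} - D. of_bool (x (w i) > x (w (i + 1))))
         = (if (w, D) \<in> S then (-1) ^ card D else (0::real))"
        using D w by (simp add: S_def)
    qed simp
    also have "\<dots> = (\<Sum>D\<in>{D \<in> Pow {1..<n}. (w, D) \<in> S}. (-1) ^ card D)"
      by (rule sum.inter_filter[symmetric]) simp
    also have "{D \<in> Pow {1..<n}. (w, D) \<in> S} = {D. (w, D) \<in> S}" by (auto simp: S_def)
    finally show ?thesis .
  qed

  have card_pre: "card (w ` {1..i}) = i" if "w permutes ?A" for w i
    using perm_inj[OF that] by (simp add: card_image)

  have to_chain: "pre w D \<in> T" "card ` pre w D = D" "sort (pre w D) = w" "card (pre w D) = card D"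
    if "(w, D) \<in> S" for w D
  proof -
    have w: "w \<in> ?L" and D: "D \<subseteq> {1..<n}" and neg: "\<And>i. i \<in> D \<Longrightarrow> V (w ` {1..i}) < 0"
      and asc: "\<And>i. i \<in> {1..<n} - D \<Longrightarrow> x (w i) > x (w (i + 1))"
      using that by (auto simp: S_def)
    note p = perm[OF w]
    have in_pre: "w k \<in> w ` {1..i} \<longleftrightarrow> k \<in> {1..i}" for i k
      using permutes_inj[OF p] by (simp add: inj_image_mem_iff)
    have ideal: "w ` {1..i} \<in> ideals n P" if "i \<in> D" for i
      unfolding ideals_def
    proof safe
      fix k assume "k \<in> {1..i}"
      then show "w k \<in> ?A" using that D permutes_in_image[OF p] by fastforce
    next
      fix a b k assume ab: "(a, w k) \<in> P" "a \<noteq> w k" and k: "k \<in> {1..i}"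
      from ab P have "a \<in> ?A" by auto
      then obtain l where l: "a = w l" "l \<in> ?A" using permutes_image[OF p] by (metis imageE)
      have "k \<in> ?A" using k that D by auto
      then have "l < k" using ab l w by (auto simp: linear_extensions_def)
      then show "a \<in> w ` {1..i}" using l k by auto
    qed
    have nested: "nested (pre w D)"
      unfolding nested_def pre_def
    proof safe
      fix i j k assume "w k \<notin> w ` {1..j}" "k \<in> {1..i}"
      then have "j < k" by auto
      fix l assume "l \<in> {1..j}"
      then show "w l \<in> w ` {1..i}" using \<open>j < k\<close> \<open>k \<in> {1..i}\<close> by auto
    qed
    show "pre w D \<in> T" using ideal neg nested by (auto simp: T_def pre_def)
    show cp: "card ` pre w D = D" unfolding pre_def image_image card_pre[OF p] by simp
    have "inj_on (\<lambda>i. w ` {1..i}) D" by (rule inj_on_inverseI[of _ card]) (rule card_pre[OF p])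
    then show "card (pre w D) = card D" by (simp add: pre_def card_image)
    have "sorts n (blockwise (pre w D) x) w"
      unfolding sorts_def
    proof (intro conjI ballI impI p)
      fix i j assume ij: "i \<in> ?A" "j \<in> ?A" "i < j"
      show "blockwise (pre w D) x (w i) (w j)"
      proof (cases "\<exists>d\<in>D. i \<le> d \<and> d < j")
        case True
        then obtain d where d: "d \<in> D" "i \<le> d" "d < j" by blast
        then have "w i \<in> w ` {1..d}" "w j \<notin> w ` {1..d}" using ij by (auto simp only: in_pre) auto
        then show ?thesis unfolding blockwise_def pre_def using d(1) by blast
      next
        case False
        have "x (w i) > x (w (Suc i + k))" if "Suc i + k \<le> j" for k
          using that
        proof (induction k)
          case 0
          then show ?case using asc[of i] False ij by auto
        next
          case (Suc k)
          moreover have "Suc i + k \<notin> D" using Suc.prems False by auto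
          ultimately show ?case using asc[of "Suc i + k"] ij by auto
        qed
        from this[of "j - Suc i"] have "x (w i) > x (w j)" using ij by simp
        moreover have "w i \<in> w ` {1..d} \<longleftrightarrow> w j \<in> w ` {1..d}" if "d \<in> D" for d
          unfolding in_pre using False that ij by auto
        ultimately show ?thesis by (auto simp: blockwise_def pre_def)
      qed
    qed
    then show "sort (pre w D) = w"
      unfolding sort_def by (rule the1_equality[OF ex1_sorts_blockwise[OF nested inj]])
  qed

  have from_chain: "(sort C, card ` C) \<in> S" "pre (sort C) (card ` C) = C" if C: "C \<in> T" for C
  proof -
    define w where "w = sort C"
    have nest: "nested C" and CI: "\<And>I. I \<in> C \<Longrightarrow> I \<in> ideals n P" and neg: "\<And>I. I \<in> C \<Longrightarrow> V I < 0"
      using C by (auto simp: T_def)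
    have srt: "\<And>i j. i \<in> ?A \<Longrightarrow> j \<in> ?A \<Longrightarrow> i < j \<Longrightarrow> blockwise C x (w i) (w j)"
      and p: "w permutes ?A"
      using sort[OF nest] by (auto simp: w_def sorts_def)
    have CA: "I \<subseteq> ?A" if "I \<in> C" for I using CI[OF that] by (auto simp: ideals_def)
    have prefix: "I = w ` {1..card I}" if I: "I \<in> C" for I
    proof -
      define J where "J = {k \<in> ?A. w k \<in> I}"
      have IJ: "I = w ` J"
      proof (intro equalityI subsetI)
        fix a assume a: "a \<in> I"
        with CA[OF I] obtain k where "k \<in> ?A" "a = w k" using permutes_image[OF p] by blast
        with a show "a \<in> w ` J" by (auto simp: J_def)
      qed (auto simp: J_def)
      have "J = {1..card J}"
      proof (rule down_closed_interval)
        fix k l assume kl: "k \<in> J" "1 \<le> l" "l < k"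
        then have b: "blockwise C x (w l) (w k)" by (intro srt) (auto simp: J_def)
        have "w l \<in> I"
        proof (rule ccontr)
          assume no: "w l \<notin> I"
          then obtain K where "K \<in> C" "w l \<in> K" "w k \<notin> K"
            using b I kl by (auto simp: blockwise_def J_def)
          then show False using nest I no kl by (fastforce simp: nested_def J_def)
        qed
        then show "l \<in> J" using kl by (auto simp: J_def)
      qed (auto simp: J_def)
      moreover have "card I = card J" unfolding IJ using perm_inj[OF p] by (simp add: card_image)
      ultimately show ?thesis using IJ by simp
    qed
    have cardC: "card ` C \<subseteq> {1..<n}"
    proof
      fix d assume "d \<in> card ` C"
      then obtain I where I: "I \<in> C" "d = card I" by auto
      have "I \<noteq> {}" "I \<noteq> ?A" using neg[OF I(1)] v by (auto simp: V_def)
      then have "I \<subset> ?A" "finite I" using CA[OF I(1)] finite_subset by auto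
      then have "card I < card ?A" "card I \<noteq> 0" using \<open>I \<noteq> {}\<close> by (auto intro!: psubset_card_mono simp del: card_atLeastAtMost)
      then show "d \<in> {1..<n}" using I by simp
    qed
    have wL: "w \<in> ?L"
      unfolding linear_extensions_def
    proof (intro CollectI conjI ballI impI p)
      fix a b assume ab: "a \<in> ?A" "b \<in> ?A" "(w a, w b) \<in> P - Id"
      show "a < b"
      proof (rule ccontr)
        assume "\<not> a < b"
        with ab have "b < a" by (metis DiffD2 IdI linorder_neqE_nat)
        then have "blockwise C x (w b) (w a)" using srt ab by blast
        then show False
          using CI ab(3) dec[OF ab(3)] by (fastforce simp: blockwise_def ideals_def)
      qed
    qed
    moreover have "V (w ` {1..i}) < 0" if "i \<in> card ` C" for i
      using that neg prefix by (metis imageE)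
    moreover have "x (w i) > x (w (i + 1))" if i: "i \<in> {1..<n} - card ` C" for i
    proof -
      have "blockwise C x (w i) (w (i + 1))" using i by (intro srt) auto
      moreover have "\<not> (\<exists>I\<in>C. w i \<in> I \<and> w (i + 1) \<notin> I)"
      proof
        assume "\<exists>I\<in>C. w i \<in> I \<and> w (i + 1) \<notin> I"
        then obtain I where I: "I \<in> C" "w i \<in> I" "w (i + 1) \<notin> I" by blast
        have "w k \<in> I \<longleftrightarrow> k \<in> {1..card I}" for k
          using permutes_inj[OF p] prefix[OF I(1)] by (metis inj_image_mem_iff)
        then have "card I = i" using I(2,3) i by auto
        then show False using i I by auto
      qed
      ultimately show ?thesis by (auto simp: blockwise_def)
    qed
    ultimately show "(sort C, card ` C) \<in> S" using cardC by (auto simp: S_def w_def)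
    have "(\<lambda>I. w ` {1..card I}) ` C = C" using prefix by (metis (no_types, lifting) image_cong image_ident)
    then show "pre (sort C) (card ` C) = C"
      by (simp add: pre_def w_def image_image)
  qed

  have "(\<Sum>w\<in>?L. \<Prod>i\<in>{1..<n}. signed_ind (x (w i) > x (w (i + 1))) (\<Sum>k\<in>{1..i}. v (w k)))
      = (\<Sum>w\<in>?L. \<Sum>D\<in>{D. (w, D) \<in> S}. (-1) ^ card D)"
    using expand by simp
  also have "\<dots> = (\<Sum>(w, D)\<in>Sigma ?L (\<lambda>w. {D. (w, D) \<in> S}). (-1) ^ card D)"
  proof (rule sum.Sigma[OF finL ballI])
    fix w show "finite {D. (w, D) \<in> S}"
      by (rule finite_subset[of _ "Pow {1..<n}"]) (auto simp: S_def)
  qed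
  also have "Sigma ?L (\<lambda>w. {D. (w, D) \<in> S}) = S" by (auto simp: S_def)
  also have "(\<Sum>(w, D)\<in>S. (-1) ^ card D) = (\<Sum>C\<in>T. (-1) ^ card C :: real)"
    by (rule sum.reindex_bij_witness[where j = "\<lambda>(w, D). pre w D" and i = "\<lambda>C. (sort C, card ` C)"])
       (clarsimp simp only: to_chain from_chain split: prod.splits; blast intro: to_chain from_chain)+
  also have "\<dots> = of_bool (\<forall>I\<in>ideals n P. V I \<ge> 0)"
    unfolding T_def
  proof (rule chain_alternating_sum)
    fix I J assume IJ: "I \<in> ideals n P" "J \<in> ideals n P"
    then show "I \<inter> J \<in> ideals n P \<and> I \<union> J \<in> ideals n P" by (auto simp: ideals_def)
    have "finite I" "finite J" using IJ finite_subset by (auto simp: ideals_def)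
    then show "V (I \<inter> J) + V (I \<union> J) = V I + V J"
      unfolding V_def using sum.union_inter[of I J v] by simp
  qed simp
  finally show ?thesis by (simp add: V_def)
qed

section \<open>Inequalities of the root cone\<close>

text \<open>This is the max-flow min-cut argument. An element \<open>j\<close> with \<open>v j < 0\<close> has some \<open>i\<close> below it with
  \<open>v i > 0\<close>, by the inequality for the principal ideal of \<open>j\<close>. Subtract the largest multiple of
  \<open>e\<^sub>i - e\<^sub>j\<close> that keeps all inequalities and does not change the signs at \<open>i\<close> and \<open>j\<close>. Either \<open>i\<close> or \<open>j\<close> leaves the support, or some ideal becomes
  tight, and then the vector splits into its restrictions to the ideal and to the complement, which
  are treated separately.\<close>

lemma cone_of_ideal_inequalities:
  fixes v :: "nat \<Rightarrow> real"
  assumes "finite A" "finite R" "trans R"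
    and "\<And>k. k \<notin> A \<Longrightarrow> v k = 0"
    and "(\<Sum>k\<in>A. v k) = 0"
    and "\<And>I. I \<subseteq> A \<Longrightarrow> (\<forall>(a, b)\<in>R. a \<in> A \<longrightarrow> b \<in> I \<longrightarrow> a \<in> I) \<Longrightarrow> (\<Sum>k\<in>I. v k) \<ge> 0"
  shows "\<exists>c. (\<forall>e. 0 \<le> c e) \<and> (\<forall>k. v k = (\<Sum>(i, j)\<in>R. c (i, j) * (unitv i k - unitv j k)))"
  using assms
proof (induction "card A + card {k \<in> A. v k \<noteq> 0}" arbitrary: A v rule: less_induct)
  case less
  define ideal where "ideal I \<longleftrightarrow> I \<subseteq> A \<and> (\<forall>(a, b)\<in>R. a \<in> A \<longrightarrow> b \<in> I \<longrightarrow> a \<in> I)" for I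
  have pos: "(\<Sum>k\<in>I. v k) \<ge> 0" if "ideal I" for I using less.prems(6) that by (auto simp: ideal_def)
  note fA = \<open>finite A\<close>
  have fI: "finite I" if "ideal I" for I using that fA finite_subset by (auto simp: ideal_def)
  show ?case
  proof (cases "\<forall>k\<in>A. v k = 0")
    case True
    then have "v k = 0" for k using less.prems(4) by blast
    then show ?thesis by (intro exI[of _ "\<lambda>_. 0"]) auto
  next
    case False
    have "\<exists>j\<in>A. v j < 0"
    proof (rule ccontr)
      assume "\<not> ?thesis"
      then have "\<And>k. k \<in> A \<Longrightarrow> v k \<ge> 0" by (auto simp: not_less)
      then show False using False less.prems(5) fA by (simp add: sum_nonneg_eq_0_iff)
    qed
    then obtain j where j: "j \<in> A" "v j < 0" by blast
    define D where "D = {k \<in> A. k = j \<or> (k, j) \<in> R}"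
    have "ideal D" unfolding ideal_def D_def using \<open>trans R\<close> by (auto dest: transD)
    have "\<exists>i\<in>D. v i > 0"
    proof (rule ccontr)
      assume "\<not> ?thesis"
      then have "(\<Sum>k\<in>D - {j}. v k) \<le> 0" by (intro sum_nonpos) (auto simp: not_less)
      moreover have "(\<Sum>k\<in>D. v k) = v j + (\<Sum>k\<in>D - {j}. v k)"
        using fI[OF \<open>ideal D\<close>] j by (intro sum.remove) (auto simp: D_def)
      ultimately show False using pos[OF \<open>ideal D\<close>] j by linarith
    qed
    then obtain i where i: "i \<in> A" "v i > 0" "(i, j) \<in> R" using j by (auto simp: D_def)
    \<comment> \<open>The ideals whose inequality is affected by moving mass from \<open>i\<close> to \<open>j\<close>.\<close>
    define F where "F = {I. ideal I \<and> i \<in> I \<and> j \<notin> I}"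
    define Z where "Z = {v i, - v j} \<union> (\<lambda>I. \<Sum>k\<in>I. v k) ` F"
    have "finite F" by (rule finite_subset[of _ "Pow A"]) (use fA in \<open>auto simp: F_def ideal_def\<close>)
    then have fZ: "finite Z" "Z \<noteq> {}" by (auto simp: Z_def)
    define t where "t = Min Z"
    have tZ: "t \<in> Z" unfolding t_def by (rule Min_in[OF fZ])
    have t_le: "t \<le> z" if "z \<in> Z" for z unfolding t_def using Min_le[OF fZ(1) that] .
    have t0: "t \<ge> 0" using tZ i j pos by (auto simp: Z_def F_def)
    define u where "u k = v k - t * (unitv i k - unitv j k)" for k
    have ij: "i \<noteq> j" using i j by auto
    have sum_u: "(\<Sum>k\<in>I. u k) = (\<Sum>k\<in>I. v k) - t * (of_bool (i \<in> I) - of_bool (j \<in> I))"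
      if "finite I" for I
    proof -
      have "(\<Sum>k\<in>I. unitv l k) = of_bool (l \<in> I)" for l
        unfolding unitv_def of_bool_def using that by simp
      then show ?thesis by (simp add: u_def sum_subtractf flip: sum_distrib_left)
    qed
    have u_pos: "(\<Sum>k\<in>I. u k) \<ge> 0" if I: "ideal I" for I
    proof (cases "I \<in> F")
      case True
      then show ?thesis using t_le[of "\<Sum>k\<in>I. v k"] sum_u[OF fI[OF I]] by (auto simp: Z_def F_def)
    next
      case False
      then have "j \<in> I \<longleftrightarrow> i \<in> I" using I i unfolding F_def ideal_def by auto
      then show ?thesis using pos[OF I] sum_u[OF fI[OF I]] by auto
    qed
    have u_supp: "u k = 0" if "k \<notin> A" for k using that i j less.prems(4) by (auto simp: u_def unitv_def)
    have u_sum: "(\<Sum>k\<in>A. u k) = 0" using sum_u[OF fA] i j less.prems(5) by simp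
    have supp_le: "{k \<in> A. u k \<noteq> 0} \<subseteq> {k \<in> A. v k \<noteq> 0}"
    proof (intro Collect_mono impI conjI)
      fix k assume k: "k \<in> A \<and> u k \<noteq> 0"
      then show "k \<in> A" by simp
      show "v k \<noteq> 0"
      proof (cases "k = i \<or> k = j")
        case True
        then show ?thesis using i j by auto
      next
        case False
        then have "u k = v k" by (simp add: u_def unitv_def)
        then show ?thesis using k by simp
      qed
    qed
    have "\<exists>c. (\<forall>e. 0 \<le> c e) \<and> (\<forall>k. u k = (\<Sum>(i, j)\<in>R. c (i, j) * (unitv i k - unitv j k)))"
    proof (cases "u i = 0 \<or> u j = 0")
      case True
      moreover have "i \<in> {k \<in> A. v k \<noteq> 0}" "j \<in> {k \<in> A. v k \<noteq> 0}" using i j by simp_all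
      ultimately have "{k \<in> A. u k \<noteq> 0} \<noteq> {k \<in> A. v k \<noteq> 0}" by blast
      then have "card {k \<in> A. u k \<noteq> 0} < card {k \<in> A. v k \<noteq> 0}"
        using supp_le fA by (intro psubset_card_mono) auto
      then show ?thesis
        using u_pos u_supp u_sum fA less.prems(2,3) unfolding ideal_def
        by (intro less.hyps[of A u]) auto
    next
      case False
      then have "t \<noteq> v i" "t \<noteq> - v j" using ij by (auto simp: u_def unitv_def)
      then obtain I where I: "I \<in> F" "t = (\<Sum>k\<in>I. v k)" using tZ by (auto simp: Z_def)
      then have idI: "ideal I" "i \<in> I" "j \<notin> I" by (auto simp: F_def)
      have IA: "I \<subseteq> A" "finite I" using idI fI by (auto simp: ideal_def)
      have uI: "(\<Sum>k\<in>I. u k) = 0" using sum_u[OF IA(2)] I idI by simp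
      have part: "\<exists>c. (\<forall>e. 0 \<le> c e) \<and>
          (\<forall>k. (if k \<in> B then u k else 0) = (\<Sum>(i, j)\<in>R. c (i, j) * (unitv i k - unitv j k)))"
        if B: "B \<subset> A" "(\<Sum>k\<in>B. u k) = 0"
          and posB: "\<And>K. K \<subseteq> B \<Longrightarrow> (\<forall>(a, b)\<in>R. a \<in> B \<longrightarrow> b \<in> K \<longrightarrow> a \<in> K) \<Longrightarrow> (\<Sum>k\<in>K. u k) \<ge> 0" for B
      proof -
        let ?u = "\<lambda>k. if k \<in> B then u k else 0"
        have fB: "finite B" using B fA finite_subset by auto
        have "card B < card A" using B fA by (intro psubset_card_mono)
        moreover have "card {k \<in> B. ?u k \<noteq> 0} \<le> card {k \<in> A. v k \<noteq> 0}"
          using B supp_le fA by (intro card_mono) auto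
        moreover have "(\<Sum>k\<in>K. ?u k) = (\<Sum>k\<in>K. u k)" if "K \<subseteq> B" for K
          using that by (intro sum.cong) auto
        ultimately show ?thesis
          using B posB fB less.prems(2,3) by (intro less.hyps[of B ?u]) auto
      qed
      obtain c1 where c1: "\<forall>e. 0 \<le> c1 e"
        "\<forall>k. (if k \<in> I then u k else 0) = (\<Sum>(i, j)\<in>R. c1 (i, j) * (unitv i k - unitv j k))"
      proof (rule exE[OF part[of I]])
        show "I \<subset> A" using IA idI j by auto
        fix K assume "K \<subseteq> I" "\<forall>(a, b)\<in>R. a \<in> I \<longrightarrow> b \<in> K \<longrightarrow> a \<in> K"
        then have "ideal K" using idI(1) unfolding ideal_def by blast
        then show "(\<Sum>k\<in>K. u k) \<ge> 0" by (rule u_pos)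
      qed (use uI in auto)
      obtain c2 where c2: "\<forall>e. 0 \<le> c2 e"
        "\<forall>k. (if k \<in> A - I then u k else 0) = (\<Sum>(i, j)\<in>R. c2 (i, j) * (unitv i k - unitv j k))"
      proof (rule exE[OF part[of "A - I"]])
        show "A - I \<subset> A" using idI i by auto
        show "(\<Sum>k\<in>A - I. u k) = 0" using u_sum uI IA fA by (simp add: sum_diff)
        fix K assume K: "K \<subseteq> A - I" "\<forall>(a, b)\<in>R. a \<in> A - I \<longrightarrow> b \<in> K \<longrightarrow> a \<in> K"
        then have "ideal (I \<union> K)" using idI(1) unfolding ideal_def by blast
        then have "0 \<le> (\<Sum>k\<in>I \<union> K. u k)" by (rule u_pos)
        also have "\<dots> = (\<Sum>k\<in>I. u k) + (\<Sum>k\<in>K. u k)"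
          using K IA fA by (intro sum.union_disjoint) (auto intro: finite_subset)
        finally show "(\<Sum>k\<in>K. u k) \<ge> 0" using uI by simp
      qed auto
      show ?thesis
      proof (intro exI[of _ "\<lambda>e. c1 e + c2 e"] conjI allI)
        show "0 \<le> c1 e + c2 e" for e using c1(1)[rule_format, of e] c2(1)[rule_format, of e] by simp
        fix k
        have "u k = (if k \<in> I then u k else 0) + (if k \<in> A - I then u k else 0)"
          using u_supp IA by auto
        also have "\<dots> = (\<Sum>(i, j)\<in>R. (c1 (i, j) + c2 (i, j)) * (unitv i k - unitv j k))"
          using c1 c2 by (simp add: sum.distrib distrib_right case_prod_beta)
        finally show "u k = (\<Sum>(i, j)\<in>R. (c1 (i, j) + c2 (i, j)) * (unitv i k - unitv j k))" .
      qed
    qed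
    then obtain c where c: "\<forall>e. 0 \<le> c e"
       "\<forall>k. u k = (\<Sum>(i, j)\<in>R. c (i, j) * (unitv i k - unitv j k))" by blast
    show ?thesis
    proof (intro exI[of _ "\<lambda>e. c e + (if e = (i, j) then t else 0)"] conjI allI)
      show "0 \<le> c e + (if e = (i, j) then t else 0)" for e using c(1)[rule_format, of e] t0 by simp
      fix k
      have "(\<Sum>(a, b)\<in>R. (c (a, b) + (if (a, b) = (i, j) then t else 0)) * (unitv a k - unitv b k))
          = (\<Sum>(a, b)\<in>R. c (a, b) * (unitv a k - unitv b k)) +
            (\<Sum>e\<in>R. if e = (i, j) then t * (unitv i k - unitv j k) else 0)"
        by (subst sum.distrib[symmetric], intro sum.cong) (auto simp: distrib_right split: if_splits)
      also have "\<dots> = u k + t * (unitv i k - unitv j k)"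
        using c i \<open>finite R\<close> by simp
      finally show "v k = (\<Sum>(a, b)\<in>R. (c (a, b) + (if (a, b) = (i, j) then t else 0)) * (unitv a k - unitv b k))"
        by (simp add: u_def)
    qed
  qed
qed

lemma K_root_iff:
  assumes P: "P \<subseteq> {1..n} \<times> {1..n}" and tr: "trans (P - Id)"
  shows "v \<in> K_root n P \<longleftrightarrow> v \<in> V_root n \<and> (\<forall>I\<in>ideals n P. (\<Sum>k\<in>I. v k) \<ge> 0)"
proof -
  let ?A = "{1..n}"
  have fin: "finite (P - Id)" using P finite_subset by blast
  have unit_sum: "(\<Sum>k\<in>I. unitv i k) = of_bool (i \<in> I)" if "finite I" for I i
    unfolding unitv_def of_bool_def using that by simp
  have sum_eq: "(\<Sum>k\<in>I. v k) = (\<Sum>(i, j)\<in>P - Id. c (i, j) * (of_bool (i \<in> I) - of_bool (j \<in> I)))"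
    if v: "v = (\<lambda>k\<in>?A. \<Sum>(i, j)\<in>P - Id. c (i, j) * (unitv i k - unitv j k))" and "I \<subseteq> ?A" for I c
  proof -
    have "finite I" using that finite_subset by auto
    have "(\<Sum>k\<in>I. v k) = (\<Sum>k\<in>I. \<Sum>(i, j)\<in>P - Id. c (i, j) * (unitv i k - unitv j k))"
      using that by (intro sum.cong) auto
    also have "\<dots> = (\<Sum>e\<in>P - Id. \<Sum>k\<in>I. c e * (unitv (fst e) k - unitv (snd e) k))"
      by (subst sum.swap) (simp add: case_prod_beta)
    also have "\<dots> = (\<Sum>(i, j)\<in>P - Id. c (i, j) * (of_bool (i \<in> I) - of_bool (j \<in> I)))"
      using \<open>finite I\<close> by (simp add: case_prod_beta sum_subtractf unit_sum flip: sum_distrib_left)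
    finally show ?thesis .
  qed
  show ?thesis
  proof
    assume "v \<in> K_root n P"
    then obtain c where v: "v = (\<lambda>k\<in>?A. \<Sum>(i, j)\<in>P - Id. c (i, j) * (unitv i k - unitv j k))"
       and c: "\<forall>a\<in>P - Id. 0 \<le> c a" by (auto simp: K_root_def)
    have "(\<Sum>k\<in>?A. v k) = 0"
      unfolding sum_eq[OF v subset_refl] using P by (intro sum.neutral) auto
    moreover have "(\<Sum>k\<in>I. v k) \<ge> 0" if "I \<in> ideals n P" for I
    proof -
      have "I \<subseteq> ?A" using that by (simp add: ideals_def)
      show ?thesis
        unfolding sum_eq[OF v \<open>I \<subseteq> ?A\<close>]
      proof (rule sum_nonneg)
        fix e assume "e \<in> P - Id"
        then obtain i j where ij: "e = (i, j)" "(i, j) \<in> P" "(i, j) \<notin> Id" by (cases e) auto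
        then have "j \<in> I \<longrightarrow> i \<in> I" using that unfolding ideals_def by blast
        then have "(of_bool (i \<in> I) - of_bool (j \<in> I) :: real) \<ge> 0" by auto
        then show "0 \<le> (case e of (i, j) \<Rightarrow> c (i, j) * (of_bool (i \<in> I) - of_bool (j \<in> I)))"
          using c ij by (auto intro!: mult_nonneg_nonneg)
      qed
    qed
    ultimately show "v \<in> V_root n \<and> (\<forall>I\<in>ideals n P. (\<Sum>k\<in>I. v k) \<ge> 0)"
      using v by (auto simp: V_root_def)
  next
    assume v: "v \<in> V_root n \<and> (\<forall>I\<in>ideals n P. (\<Sum>k\<in>I. v k) \<ge> 0)"
    define u where "u k = (if k \<in> ?A then v k else 0)" for k
    have uv: "(\<Sum>k\<in>I. u k) = (\<Sum>k\<in>I. v k)" if "I \<subseteq> ?A" for I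
      using that by (intro sum.cong) (auto simp: u_def)
    have "\<exists>c. (\<forall>e. 0 \<le> c e) \<and> (\<forall>k. u k = (\<Sum>(i, j)\<in>P - Id. c (i, j) * (unitv i k - unitv j k)))"
    proof (rule cone_of_ideal_inequalities[OF _ fin tr])
      show "(\<Sum>k\<in>?A. u k) = 0" using v uv[of ?A] by (simp add: V_root_def)
      fix I assume "I \<subseteq> ?A" "\<forall>(a, b)\<in>P - Id. a \<in> ?A \<longrightarrow> b \<in> I \<longrightarrow> a \<in> I"
      then have "I \<in> ideals n P" using P by (fastforce simp: ideals_def)
      then show "(\<Sum>k\<in>I. u k) \<ge> 0" using v uv[OF \<open>I \<subseteq> ?A\<close>] by simp
    qed (auto simp: u_def)
    then obtain c where c: "\<forall>e. (0::real) \<le> c e"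
      "\<forall>k. u k = (\<Sum>(i, j)\<in>P - Id. c (i, j) * (unitv i k - unitv j k))" by blast
    have "v = (\<lambda>k\<in>?A. \<Sum>(i, j)\<in>P - Id. c (i, j) * (unitv i k - unitv j k))"
    proof
      fix k
      show "v k = (\<lambda>k\<in>?A. \<Sum>(i, j)\<in>P - Id. c (i, j) * (unitv i k - unitv j k)) k"
      proof (cases "k \<in> ?A")
        case True
        then have "v k = u k" by (simp add: u_def)
        then show ?thesis using c(2) True by simp
      next
        case False
        then show ?thesis using v by (auto simp: V_root_def extensional_def)
      qed
    qed
    then show "v \<in> K_root n P" using c(1) unfolding K_root_def by blast
  qed
qed

section \<open>Lebesgue measure on the root hyperplane\<close>

interpretation lb: product_sigma_finite "\<lambda>_::nat. lborel :: real measure"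
  by unfold_locales

abbreviation coord_measure :: "nat \<Rightarrow> (nat \<Rightarrow> real) measure" where
  "coord_measure n \<equiv> PiM {1..<n} (\<lambda>_. lborel)"

definition root_vec :: "nat \<Rightarrow> (nat \<Rightarrow> real) \<Rightarrow> nat \<Rightarrow> real" where
  "root_vec n c = (\<lambda>k\<in>{1..n}. \<Sum>i\<in>{1..<n}. c i * (unitv i k - unitv (i + 1) k))"

text \<open>The coordinates in the basis of simple roots, continued by \<open>c\<^sub>0 = c\<^sub>n = 0\<close>; with this convention the
  partial sums of a vector of the hyperplane are its coordinates at every position.\<close>
definition inner_coord :: "nat \<Rightarrow> (nat \<Rightarrow> real) \<Rightarrow> nat \<Rightarrow> real" where
  "inner_coord n c i = (if i \<in> {1..<n} then c i else 0)"

lemma root_vec_eq: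
  assumes "k \<in> {1..n}"
  shows "root_vec n c k = inner_coord n c k - inner_coord n c (k - 1)"
proof -
  have "(\<Sum>i\<in>{1..<n}. c i * unitv i k) = (\<Sum>i\<in>{1..<n}. if i = k then c i else 0)"
    by (intro sum.cong) (auto simp: unitv_def)
  moreover have "(\<Sum>i\<in>{1..<n}. c i * unitv (i + 1) k) = (\<Sum>i\<in>{1..<n}. if i = k - 1 then c i else 0)"
    using assms by (intro sum.cong) (auto simp: unitv_def)
  ultimately show ?thesis
    using assms by (simp add: root_vec_def inner_coord_def right_diff_distrib sum_subtractf)
qed

lemma root_vec_prefix_sum:
  assumes "i \<le> n"
  shows "(\<Sum>k\<in>{1..i}. root_vec n c k) = inner_coord n c i"
  using assms by (induction i) (auto simp: root_vec_eq, auto simp: inner_coord_def)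

lemma root_vec_sum_0: "(\<Sum>k\<in>{1..n}. root_vec n c k) = 0"
  unfolding root_vec_prefix_sum[OF order_refl] by (simp add: inner_coord_def)

text \<open>The simple root coordinates of the vector whose entries are permuted by \<open>w\<close>.\<close>
definition reorder :: "nat \<Rightarrow> (nat \<Rightarrow> nat) \<Rightarrow> (nat \<Rightarrow> real) \<Rightarrow> nat \<Rightarrow> real" where
  "reorder n w c = (\<lambda>i\<in>{1..<n}. \<Sum>k\<in>{1..i}. root_vec n c (w k))"

lemma root_vec_reorder:
  assumes w: "w permutes {1..n}" and k: "k \<in> {1..n}"
  shows "root_vec n (reorder n w c) k = root_vec n c (w k)"
proof -
  have *: "inner_coord n (reorder n w c) i = (\<Sum>k\<in>{1..i}. root_vec n c (w k))" if "i \<le> n" for i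
  proof (cases "i \<in> {1..<n}")
    case False
    then have "i = 0 \<or> i = n" using that by auto
    then consider "i = 0" | "i = n" by blast
    then show ?thesis
    proof cases
      case 2
      then show ?thesis
        using sum.permute[OF w, of "root_vec n c"] root_vec_sum_0[of n c] by (simp add: inner_coord_def o_def)
    qed (simp add: inner_coord_def)
  qed (simp add: inner_coord_def reorder_def)
  obtain j where j: "k = Suc j" using k by (cases k) auto
  show ?thesis
    using k by (subst root_vec_eq) (auto simp: j *)
qed

lemma reorder_comp:
  assumes w: "w permutes {1..n}" and w': "w' permutes {1..n}"
  shows "reorder n (w \<circ> w') c = reorder n w' (reorder n w c)"
proof
  fix i
  have "(\<Sum>k\<in>{1..i}. root_vec n c (w (w' k))) = (\<Sum>k\<in>{1..i}. root_vec n (reorder n w c) (w' k))"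
    if "i \<in> {1..<n}"
    using that permutes_in_image[OF w'] by (intro sum.cong refl root_vec_reorder[OF w, symmetric]) auto
  then show "reorder n (w \<circ> w') c i = reorder n w' (reorder n w c) i"
    by (auto simp: reorder_def)
qed

lemma measurable_root_vec_component [measurable]:
  "(\<lambda>c. root_vec n c k) \<in> borel_measurable (coord_measure n)"
  unfolding root_vec_def restrict_def by measurable

lemma measurable_reorder [measurable]: "reorder n w \<in> measurable (coord_measure n) (coord_measure n)"
  unfolding reorder_def by measurable

lemma reorder_adjacent:
  assumes i: "i \<in> {1..<n}" and c: "c \<in> space (coord_measure n)"
  shows "reorder n (Transposition.transpose i (Suc i)) c =
    c(i := inner_coord n c (i - 1) + inner_coord n c (i + 1) - c i)"
proof
  fix l
  let ?w = "Transposition.transpose i (Suc i)"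
  have pre: "(\<Sum>k\<in>{1..l}. root_vec n c (?w k)) = inner_coord n c l" if "l < n" "l \<noteq> i" for l
  proof -
    have "?w permutes {1..l} \<or> (\<forall>k\<in>{1..l}. ?w k = k)"
    proof (cases "l < i")
      case True
      then show ?thesis by (auto simp: Transposition.transpose_def)
    next
      case False
      then show ?thesis using i that by (intro disjI1 permutes_swap_id) auto
    qed
    then have "(\<Sum>k\<in>{1..l}. root_vec n c (?w k)) = (\<Sum>k\<in>{1..l}. root_vec n c k)"
      using sum.permute[of ?w "{1..l}" "root_vec n c"] by (auto simp: o_def)
    then show ?thesis using that root_vec_prefix_sum[of l n c] by simp
  qed
  show "reorder n ?w c l = (c(i := inner_coord n c (i - 1) + inner_coord n c (i + 1) - c i)) l"
  proof (cases "l \<in> {1..<n}")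
    case False
    then show ?thesis using i c by (auto simp: reorder_def space_PiM PiE_iff extensional_def)
  next
    case True
    show ?thesis
    proof (cases "l = i")
      case False
      then show ?thesis using True pre[of l] by (simp add: reorder_def inner_coord_def)
    next
      case li: True
      obtain j where j: "i = Suc j" using i by (cases i) auto
      have "(\<Sum>k\<in>{1..i}. root_vec n c (?w k)) = inner_coord n c j + root_vec n c (Suc i)"
        using pre[of j] i by (simp add: j)
      also have "root_vec n c (Suc i) = inner_coord n c (i + 1) - c i"
        using i by (simp add: root_vec_eq) (simp add: inner_coord_def)
      finally show ?thesis using True li by (simp add: reorder_def j)
    qed
  qed
qed

text \<open>Exchanging two neighbouring entries changes one simple root coordinate only, by the reflection
  \<open>c\<^sub>i \<mapsto> c\<^sub>i\<^sub>-\<^sub>1 + c\<^sub>i\<^sub>+\<^sub>1 - c\<^sub>i\<close>; by Fubini it suffices that reflections of the real line preserve its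
  Lebesgue measure.\<close>
lemma distr_reorder_adjacent:
  assumes i: "i \<in> {1..<n}"
  shows "distr (coord_measure n) (coord_measure n) (reorder n (Transposition.transpose i (Suc i)))
       = coord_measure n"
proof (rule measure_eqI)
  let ?M = "coord_measure n" and ?T = "reorder n (Transposition.transpose i (Suc i))"
  fix A assume "A \<in> sets (distr ?M ?M ?T)"
  then have A [measurable]: "A \<in> sets ?M" by simp
  define I where "I = {1..<n} - {i}"
  have I: "finite I" "i \<notin> I" "insert i I = {1..<n}" using i by (auto simp: I_def)
  define h where "h c = inner_coord n c (i - 1) + inner_coord n c (i + 1)" for c
  have h_upd: "h (c(i := y)) = h c" for c y
    using i by (auto simp: h_def inner_coord_def)
  have ind: "(\<lambda>c. indicator A c :: ennreal) \<in> borel_measurable (PiM (insert i I) (\<lambda>_. lborel))"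
    unfolding I(3) by measurable
  have "emeasure (distr ?M ?M ?T) A = (\<integral>\<^sup>+c. indicator A (?T c) \<partial>?M)"
  proof -
    have "emeasure (distr ?M ?M ?T) A = (\<integral>\<^sup>+c. indicator A c \<partial>distr ?M ?M ?T)" using A by simp
    also have "\<dots> = (\<integral>\<^sup>+c. indicator A (?T c) \<partial>?M)" by (rule nn_integral_distr) measurable
    finally show ?thesis .
  qed
  also have "\<dots> = (\<integral>\<^sup>+c. indicator A (?T c) \<partial>PiM (insert i I) (\<lambda>_. lborel))"
    unfolding I(3) ..
  also have "\<dots> = (\<integral>\<^sup>+c. \<integral>\<^sup>+y. indicator A (?T (c(i := y))) \<partial>lborel \<partial>PiM I (\<lambda>_. lborel))"
    by (rule lb.product_nn_integral_insert[OF I(1,2)]) (unfold I(3), measurable)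
  also have "\<dots> = (\<integral>\<^sup>+c. \<integral>\<^sup>+y. indicator A (c(i := y)) \<partial>lborel \<partial>PiM I (\<lambda>_. lborel))"
  proof (rule nn_integral_cong)
    fix c assume c: "c \<in> space (PiM I (\<lambda>_. lborel :: real measure))"
    have sp: "c(i := y) \<in> space ?M" for y
      using c I by (auto simp: space_PiM PiE_iff extensional_def I_def)
    have [measurable]: "(\<lambda>y. c(i := y)) \<in> measurable lborel ?M"
      using measurable_fun_upd[of "{1..<n}" I i "\<lambda>_. c" lborel "\<lambda>_. lborel" "\<lambda>y. y"] c I by auto
    have "(\<integral>\<^sup>+y. indicator A (c(i := y)) \<partial>lborel)
        = ennreal \<bar>-1\<bar> * (\<integral>\<^sup>+y. indicator A (c(i := h c + (-1) * y)) \<partial>lborel)"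
      by (rule nn_integral_real_affine) (simp_all, measurable)
    also have "\<dots> = (\<integral>\<^sup>+y. indicator A (?T (c(i := y))) \<partial>lborel)"
      using h_upd[of c] by (simp add: reorder_adjacent[OF i sp] h_def)
    finally show "(\<integral>\<^sup>+y. indicator A (?T (c(i := y))) \<partial>lborel) = (\<integral>\<^sup>+y. indicator A (c(i := y)) \<partial>lborel)"
      by simp
  qed
  also have "\<dots> = (\<integral>\<^sup>+c. indicator A c \<partial>PiM (insert i I) (\<lambda>_. lborel))"
    by (rule lb.product_nn_integral_insert[OF I(1,2) ind, symmetric])
  also have "\<dots> = emeasure ?M A" unfolding I(3) using A by (rule nn_integral_indicator)
  finally show "emeasure (distr ?M ?M ?T) A = emeasure ?M A" .
qed simp

text \<open>Adjacent transpositions generate all permutations.\<close>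
theorem distr_reorder:
  assumes "w permutes {1..n}"
  shows "distr (coord_measure n) (coord_measure n) (reorder n w) = coord_measure n"
proof -
  let ?M = "coord_measure n"
  define inv where "inv w \<longleftrightarrow> w permutes {1..n} \<and> distr ?M ?M (reorder n w) = ?M" for w
  have comp: "inv (w \<circ> w')" if "inv w" "inv w'" for w w'
  proof -
    have "distr ?M ?M (reorder n (w \<circ> w')) = distr ?M ?M (reorder n w' \<circ> reorder n w)"
      using that by (intro distr_cong) (auto simp: inv_def reorder_comp)
    also have "\<dots> = distr (distr ?M ?M (reorder n w)) ?M (reorder n w')"
      by (rule distr_distr[symmetric]) measurable
    finally show ?thesis using that by (auto simp: inv_def permutes_compose)
  qed
  have inv_id: "inv id"
  proof -
    have "reorder n id c = c" if c: "c \<in> space ?M" for c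
    proof
      fix i
      show "reorder n id c i = c i"
      proof (cases "i \<in> {1..<n}")
        case True
        then show ?thesis using root_vec_prefix_sum[of i n c] by (simp add: reorder_def inner_coord_def)
      next
        case False
        then show ?thesis using c by (auto simp: reorder_def space_PiM PiE_iff extensional_def)
      qed
    qed
    then have "distr ?M ?M (reorder n id) = distr ?M ?M (\<lambda>c. c)" by (intro distr_cong) auto
    then show ?thesis by (simp add: inv_def permutes_id distr_id)
  qed
  have adj: "inv (Transposition.transpose i (Suc i))" if "i \<in> {1..<n}" for i
    unfolding inv_def using that distr_reorder_adjacent[OF that] by (auto intro!: permutes_swap_id)
  have lt: "inv (Transposition.transpose a (Suc a + d))" if "a \<ge> 1" "Suc a + d \<le> n" for a d
    using that
  proof (induction d)
    case 0
    then show ?case using adj[of a] by simp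
  next
    case (Suc d)
    let ?b = "Suc a + d"
    have "Transposition.transpose a (Suc a + Suc d)
        = Transposition.transpose ?b (Suc ?b) \<circ> (Transposition.transpose a ?b \<circ> Transposition.transpose ?b (Suc ?b))"
      by (auto simp: fun_eq_iff Transposition.transpose_def)
    moreover have "inv (Transposition.transpose ?b (Suc ?b))" using Suc.prems by (intro adj) auto
    moreover have "inv (Transposition.transpose a ?b)" using Suc by simp
    ultimately show ?case by (simp only: comp)
  qed
  have transp: "inv (Transposition.transpose a b)" if "a \<in> {1..n}" "b \<in> {1..n}" for a b
  proof (cases a b rule: linorder_cases)
    case less
    then obtain d where "b = Suc a + d" using less_iff_Suc_add by auto
    then show ?thesis using lt[of a d] that by auto
  next
    case greater
    then obtain d where "a = Suc b + d" using less_iff_Suc_add by auto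
    then show ?thesis using lt[of b d] that by (auto simp: transpose_commute)
  qed (use inv_id in simp)
  have "inv w"
    using assms finite_atLeastAtMost
  proof (induction rule: permutes_induct)
    case id
    show ?case by (rule inv_id)
  next
    case (swap a b p)
    then show ?case by (intro comp transp)
  qed
  then show ?thesis by (simp add: inv_def)
qed

lemma root_measure_eq:
  "root_measure n = distr (coord_measure n) (restrict_space (std_measure n) (V_root n)) (root_vec n)"
  by (simp add: root_measure_def root_vec_def[abs_def])

lemma space_root_measure: "space (root_measure n) = V_root n"
  by (auto simp: root_measure_def space_restrict_space std_measure_def space_PiM V_root_def PiE_def)

lemma measurable_root_vec [measurable]:
  "root_vec n \<in> measurable (coord_measure n) (restrict_space (std_measure n) (V_root n))"
proof (rule measurable_restrict_space2)
  show "root_vec n \<in> space (coord_measure n) \<rightarrow> V_root n"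
    using root_vec_sum_0[of n] by (auto simp: V_root_def root_vec_def)
  show "root_vec n \<in> measurable (coord_measure n) (std_measure n)"
    unfolding std_measure_def root_vec_def by measurable
qed

lemma measurable_root_component:
  "k \<in> {1..n} \<Longrightarrow> (\<lambda>v. v k) \<in> borel_measurable (restrict_space (std_measure n) (V_root n))"
  unfolding std_measure_def by (intro measurable_restrict_space1) measurable

lemma has_bochner_integral_distr_iff:
  fixes g :: "'a \<Rightarrow> real"
  assumes "f \<in> measurable M N" "g \<in> borel_measurable N"
  shows "has_bochner_integral (distr M N f) g x \<longleftrightarrow> has_bochner_integral M (\<lambda>c. g (f c)) x"
  using assms by (simp add: has_bochner_integral_iff integrable_distr_eq integral_distr)

text \<open>The measure of the hyperplane is the product measure in the partial sums along any order \<open>w\<close> of the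
  entries, not only along the natural order that defines it.\<close>
lemma has_bochner_integral_root_product:
  fixes F :: "nat \<Rightarrow> real \<Rightarrow> real"
  assumes w: "w permutes {1..n}"
    and F: "\<And>i. i \<in> {1..<n} \<Longrightarrow> has_bochner_integral lborel (F i) (a i)"
  shows "has_bochner_integral (root_measure n)
    (\<lambda>v. \<Prod>i\<in>{1..<n}. F i (\<Sum>k\<in>{1..i}. v (w k))) (\<Prod>i\<in>{1..<n}. a i)"
proof -
  let ?M = "coord_measure n"
  have Fm [measurable]: "F i \<in> borel_measurable borel" if "i \<in> {1..<n}" for i
    using F[OF that] by (auto simp: has_bochner_integral_iff dest: borel_measurable_integrable)
  have pm: "(\<lambda>c. \<Prod>i\<in>{1..<n}. F i (c i)) \<in> borel_measurable ?M"
    by (intro borel_measurable_prod measurable_compose[OF measurable_component_singleton])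
       (auto intro: Fm)
  have prod: "has_bochner_integral ?M (\<lambda>c. \<Prod>i\<in>{1..<n}. F i (c i)) (\<Prod>i\<in>{1..<n}. a i)"
  proof -
    have int: "\<And>i. i \<in> {1..<n} \<Longrightarrow> integrable lborel (F i)" "\<And>i. i \<in> {1..<n} \<Longrightarrow> integral\<^sup>L lborel (F i) = a i"
      using F by (auto simp: has_bochner_integral_iff)
    show ?thesis
      using lb.product_integrable_prod[of "{1..<n}" F] lb.product_integral_prod[of "{1..<n}" F] int
      by (simp add: has_bochner_integral_iff)
  qed
  then have "has_bochner_integral (distr ?M ?M (reorder n w)) (\<lambda>c. \<Prod>i\<in>{1..<n}. F i (c i)) (\<Prod>i\<in>{1..<n}. a i)"
    unfolding distr_reorder[OF w] .
  then have "has_bochner_integral ?M (\<lambda>c. \<Prod>i\<in>{1..<n}. F i (reorder n w c i)) (\<Prod>i\<in>{1..<n}. a i)"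
    by (subst (asm) has_bochner_integral_distr_iff[OF measurable_reorder pm])
  also have "(\<lambda>c. \<Prod>i\<in>{1..<n}. F i (reorder n w c i))
      = (\<lambda>c. \<Prod>i\<in>{1..<n}. F i (\<Sum>k\<in>{1..i}. root_vec n c (w k)))"
    by (auto simp: reorder_def intro!: prod.cong)
  finally have *: "has_bochner_integral ?M
      (\<lambda>c. \<Prod>i\<in>{1..<n}. F i (\<Sum>k\<in>{1..i}. root_vec n c (w k))) (\<Prod>i\<in>{1..<n}. a i)" .
  have m: "(\<lambda>v. \<Prod>i\<in>{1..<n}. F i (\<Sum>k\<in>{1..i}. v (w k)))
      \<in> borel_measurable (restrict_space (std_measure n) (V_root n))"
  proof (rule borel_measurable_prod)
    fix i assume i: "i \<in> {1..<n}"
    then have [measurable]: "(\<lambda>v. \<Sum>k\<in>{1..i}. v (w k)) \<in> borel_measurable (restrict_space (std_measure n) (V_root n))"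
      using permutes_in_image[OF w] by (intro borel_measurable_sum measurable_root_component) auto
    show "(\<lambda>v. F i (\<Sum>k\<in>{1..i}. v (w k))) \<in> borel_measurable (restrict_space (std_measure n) (V_root n))"
      by (rule measurable_compose[OF _ Fm[OF i]]) measurable
  qed
  show ?thesis
    unfolding root_measure_eq has_bochner_integral_distr_iff[OF measurable_root_vec m] by (rule *)
qed

section \<open>Exponential integrals over rays and chambers\<close>

lemma nn_integral_exp_atLeast:
  assumes "d > 0"
  shows "(\<integral>\<^sup>+y. ennreal (exp (- (d * y))) * indicator {a..} y \<partial>lborel) = ennreal (exp (- (d * a)) / d)"
proof -
  have "(\<integral>\<^sup>+y. ennreal (exp (- (d * y))) * indicator {a..} y \<partial>lborel)
      = ennreal (0 - (- exp (- (d * a)) / d))"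
  proof (rule nn_integral_FTC_atLeast)
    show "((\<lambda>y. - exp (- (d * y)) / d) has_real_derivative exp (- (d * y))) (at y)" for y
      using assms by (auto intro!: derivative_eq_intros)
    have "LIM y at_top. - (d * y) :> at_bot"
      using assms by (simp add: filterlim_uminus_at_bot filterlim_tendsto_pos_mult_at_top[OF tendsto_const _ filterlim_ident])
    then have "((\<lambda>y. exp (- (d * y))) \<longlongrightarrow> 0) at_top"
      by (rule filterlim_compose[OF exp_at_bot])
    then have "((\<lambda>y. - exp (- (d * y)) / d) \<longlongrightarrow> - 0 / d) at_top"
      using assms by (intro tendsto_intros) auto
    then show "((\<lambda>y. - exp (- (d * y)) / d) \<longlongrightarrow> 0) at_top" by simp
  qed auto
  then show ?thesis by simp
qed

lemma nn_integral_exp_ray: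
  assumes "d > 0"
  shows "(\<integral>\<^sup>+y. ennreal (exp (- (d * y))) * of_bool (if b then a < y else a \<le> y) \<partial>lborel)
       = ennreal (exp (- (d * a)) / d)"
proof -
  have "AE y in lborel. y \<noteq> a" by (rule AE_lborel_singleton)
  then have "(\<integral>\<^sup>+y. ennreal (exp (- (d * y))) * of_bool (if b then a < y else a \<le> y) \<partial>lborel)
      = (\<integral>\<^sup>+y. ennreal (exp (- (d * y))) * indicator {a..} y \<partial>lborel)"
    by (intro nn_integral_cong_AE) (auto elim!: eventually_mono simp: indicator_def)
  then show ?thesis using nn_integral_exp_atLeast[OF assms] by simp
qed

text \<open>With the sign attached to the negative half-line the integral is \<open>1 / d\<close> for either sign of \<open>d\<close>.\<close>
lemma has_bochner_integral_signed_exp: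
  fixes d :: real
  assumes "d \<noteq> 0"
  shows "has_bochner_integral lborel
    (\<lambda>t. (if d > 0 then of_bool (t \<ge> 0) else - of_bool (t < 0)) * exp (- (t * d))) (1 / d)"
proof -
  have ray: "has_bochner_integral lborel (\<lambda>t. of_bool (if b then 0 < t else 0 \<le> t) * exp (- (t * d))) (1 / d)"
    if "d > 0" for b and d :: real
  proof (rule has_bochner_integral_nn_integral)
    have "(\<integral>\<^sup>+t. ennreal (of_bool (if b then 0 < t else 0 \<le> t) * exp (- (t * d))) \<partial>lborel)
        = (\<integral>\<^sup>+y. ennreal (exp (- (d * y))) * of_bool (if b then 0 < y else 0 \<le> y) \<partial>lborel)"
      by (intro nn_integral_cong) (auto simp: mult.commute)
    then show "(\<integral>\<^sup>+t. ennreal (of_bool (if b then 0 < t else 0 \<le> t) * exp (- (t * d))) \<partial>lborel) = ennreal (1 / d)"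
      using nn_integral_exp_ray[OF that, of b 0] by simp
  qed (use that in auto)
  show ?thesis
  proof (cases "d > 0")
    case True
    then show ?thesis using ray[where d = d and b = False] by simp
  next
    case False
    then have "has_bochner_integral lborel (\<lambda>t. of_bool (0 < t) * exp (- (t * (- d)))) (1 / (- d))"
      using ray[where d = "-d" and b = True] assms by simp
    then have "has_bochner_integral lborel (\<lambda>t. of_bool (0 < - t) * exp (- ((- t) * (- d)))) (1 / (- d))"
      by (subst (asm) lborel_has_bochner_integral_real_affine_iff[of "-1" _ _ 0]) simp_all
    then have "has_bochner_integral lborel (\<lambda>t. - (of_bool (0 < - t) * exp (- ((- t) * (- d))))) (- (1 / (- d)))"
      by (rule has_bochner_integral_minus)
    then show ?thesis using False by simp
  qed
qed

text \<open>The value \<open>0\<close> at the empty list makes nonnegativity of the last coordinate an instance of the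
  comparison of a coordinate with its successor.\<close>
definition hd_coord :: "nat list \<Rightarrow> (nat \<Rightarrow> real) \<Rightarrow> real" where
  "hd_coord l v = (case l of [] \<Rightarrow> 0 | a # _ \<Rightarrow> v a)"

text \<open>The predicate \<open>s\<close> selects the strict walls of the half-open chamber; it sees an entry together with the
  list of its successors.\<close>
fun chamber :: "(nat \<Rightarrow> nat list \<Rightarrow> bool) \<Rightarrow> nat list \<Rightarrow> (nat \<Rightarrow> real) \<Rightarrow> bool" where
  "chamber s [] v = True"
| "chamber s (a # l) v =
     ((if s a l then hd_coord l v < v a else hd_coord l v \<le> v a) \<and> chamber s l v)"

text \<open>The parameter \<open>t\<close> is the sum of \<open>x\<close> over the entries that precede the list.\<close>
fun prefix_prod :: "(nat \<Rightarrow> real) \<Rightarrow> real \<Rightarrow> nat list \<Rightarrow> real" where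
  "prefix_prod x t [] = 1"
| "prefix_prod x t (a # l) = (t + x a) * prefix_prod x (t + x a) l"

fun prefix_pos :: "(nat \<Rightarrow> real) \<Rightarrow> real \<Rightarrow> nat list \<Rightarrow> bool" where
  "prefix_pos x t [] = True"
| "prefix_pos x t (a # l) = (0 < t + x a \<and> prefix_pos x (t + x a) l)"

lemma prefix_prod_pos: "prefix_pos x t l \<Longrightarrow> prefix_prod x t l > 0"
  by (induction l arbitrary: t) auto

lemma measurable_hd_coord:
  "set l \<subseteq> I \<Longrightarrow> hd_coord l \<in> borel_measurable (PiM I (\<lambda>_. lborel))"
  by (cases l) (auto simp: hd_coord_def[abs_def])

lemma pred_chamber:
  "set l \<subseteq> I \<Longrightarrow> Measurable.pred (PiM I (\<lambda>_. lborel)) (chamber s l)"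
proof (induction l)
  case Nil
  have "chamber s [] = (\<lambda>_. True)" by auto
  then show ?case by simp
next
  case (Cons a l)
  then have [measurable]: "Measurable.pred (PiM I (\<lambda>_. lborel)) (chamber s l)"
      "hd_coord l \<in> borel_measurable (PiM I (\<lambda>_. lborel))"
      "(\<lambda>v. v a) \<in> borel_measurable (PiM I (\<lambda>_. lborel :: real measure))"
    by (auto intro: measurable_hd_coord)
  have "Measurable.pred (PiM I (\<lambda>_. lborel)) (\<lambda>v. hd_coord l v < v a \<and> chamber s l v)"
    by measurable
  moreover have "Measurable.pred (PiM I (\<lambda>_. lborel)) (\<lambda>v. \<not> v a < hd_coord l v \<and> chamber s l v)"
    by measurable
  then have "Measurable.pred (PiM I (\<lambda>_. lborel)) (\<lambda>v. hd_coord l v \<le> v a \<and> chamber s l v)"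
    by (simp only: not_less)
  moreover have "chamber s (a # l) = (if s a l then (\<lambda>v. hd_coord l v < v a \<and> chamber s l v)
      else (\<lambda>v. hd_coord l v \<le> v a \<and> chamber s l v))"
    by auto
  ultimately show ?case by presburger
qed

lemma hd_coord_fun_upd: "a \<notin> set l \<Longrightarrow> hd_coord l (v(a := y)) = hd_coord l v"
  by (cases l) (auto simp: hd_coord_def)

lemma chamber_fun_upd: "a \<notin> set l \<Longrightarrow> chamber s l (v(a := y)) = chamber s l v"
  by (induction l) (auto simp: hd_coord_fun_upd)

text \<open>The head of the list is the largest coordinate and is bounded below by its successor only.
  Integrating it out moves its weight to the exponent of the successor; this is what the extra
  term \<open>t * hd_coord l v\<close> keeps track of.\<close>
lemma nn_integral_chamber:
  assumes "distinct l" "prefix_pos x t l"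
  shows "(\<integral>\<^sup>+v. ennreal (of_bool (chamber s l v) * exp (- (t * hd_coord l v + (\<Sum>a\<in>set l. x a * v a))))
           \<partial>PiM (set l) (\<lambda>_. lborel)) = ennreal (1 / prefix_prod x t l)"
  using assms
proof (induction l arbitrary: t)
  case Nil
  show ?case by (simp add: PiM_empty nn_integral_count_space_finite hd_coord_def)
next
  case (Cons a l)
  define d where "d = t + x a"
  have d: "d > 0" and pos: "prefix_pos x d l" and a: "a \<notin> set l" and dist: "distinct l"
    using Cons.prems by (auto simp: d_def)
  define h where "h l t v = of_bool (chamber s l v) * exp (- (t * hd_coord l v + (\<Sum>a\<in>set l. x a * v a)))"
    for l t and v :: "nat \<Rightarrow> real"
  have hm: "h l t \<in> borel_measurable (PiM (set l) (\<lambda>_. lborel))" for l t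
  proof -
    have [measurable]: "Measurable.pred (PiM (set l) (\<lambda>_. lborel)) (chamber s l)"
      "hd_coord l \<in> borel_measurable (PiM (set l) (\<lambda>_. lborel))"
      by (auto intro: measurable_hd_coord pred_chamber)
    show ?thesis unfolding h_def by measurable
  qed
  have split: "h (a # l) t (v(a := y)) =
      of_bool (chamber s l v) * exp (- (\<Sum>a\<in>set l. x a * v a)) *
      (exp (- (d * y)) * of_bool (if s a l then hd_coord l v < y else hd_coord l v \<le> y))" for v y
  proof -
    have "(\<Sum>b\<in>set l. x b * (v(a := y)) b) = (\<Sum>b\<in>set l. x b * v b)"
      using a by (intro sum.cong) auto
    then have eq: "t * hd_coord (a # l) (v(a := y)) + (\<Sum>b\<in>set (a # l). x b * (v(a := y)) b)
        = d * y + (\<Sum>b\<in>set l. x b * v b)"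
      using a by (simp add: hd_coord_def d_def algebra_simps)
    have "exp (- (d * y + (\<Sum>b\<in>set l. x b * v b))) = exp (- (\<Sum>b\<in>set l. x b * v b)) * exp (- (d * y))"
      by (simp add: exp_add[symmetric])
    then show ?thesis
      unfolding h_def eq chamber.simps hd_coord_fun_upd[OF a] chamber_fun_upd[OF a]
      by (auto simp: of_bool_def)
  qed
  have "(\<integral>\<^sup>+v. ennreal (h (a # l) t v) \<partial>PiM (set (a # l)) (\<lambda>_. lborel))
      = (\<integral>\<^sup>+v. \<integral>\<^sup>+y. ennreal (h (a # l) t (v(a := y))) \<partial>lborel \<partial>PiM (set l) (\<lambda>_. lborel))"
    using hm[of "a # l" t] a by (simp add: lb.product_nn_integral_insert)
  also have "\<dots> = (\<integral>\<^sup>+v. ennreal (1 / d) * ennreal (h l d v) \<partial>PiM (set l) (\<lambda>_. lborel))"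
  proof (rule nn_integral_cong)
    fix v
    let ?c = "of_bool (chamber s l v) * exp (- (\<Sum>a\<in>set l. x a * v a))"
    have "(\<integral>\<^sup>+y. ennreal (h (a # l) t (v(a := y))) \<partial>lborel)
        = (\<integral>\<^sup>+y. ennreal ?c * (ennreal (exp (- (d * y))) *
             of_bool (if s a l then hd_coord l v < y else hd_coord l v \<le> y)) \<partial>lborel)"
      unfolding split by (intro nn_integral_cong) (auto simp: ennreal_mult)
    also have "\<dots> = ennreal ?c * ennreal (exp (- (d * hd_coord l v)) / d)"
      by (subst nn_integral_cmult) (simp_all add: nn_integral_exp_ray[OF d])
    also have "\<dots> = ennreal (1 / d) * ennreal (h l d v)"
      using d by (simp add: h_def ennreal_mult[symmetric] exp_add exp_diff exp_minus field_simps)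
    finally show "(\<integral>\<^sup>+y. ennreal (h (a # l) t (v(a := y))) \<partial>lborel) = ennreal (1 / d) * ennreal (h l d v)" .
  qed
  also have "\<dots> = ennreal (1 / d) * ennreal (1 / prefix_prod x d l)"
    unfolding Cons.IH[OF dist pos, folded h_def, symmetric]
    by (rule nn_integral_cmult) (use hm[of l d] in measurable)
  also have "\<dots> = ennreal (1 / prefix_prod x t (a # l))"
    using d prefix_prod_pos[OF pos] by (simp add: d_def ennreal_mult[symmetric])
  finally show ?case by (simp add: h_def)
qed

section \<open>The rational function of a cone\<close>

lemma lin_span_lincomb:
  assumes u: "u \<in> lin_span n K" and v: "v \<in> lin_span n K"
  shows "(\<lambda>k\<in>{1..n}. a * u k + b * v k) \<in> lin_span n K"
proof -
  obtain F c where F: "finite F" "F \<subseteq> K" "u = (\<lambda>k\<in>{1..n}. \<Sum>z\<in>F. c z * z k)"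
    using u by (auto simp: lin_span_def)
  obtain G d where G: "finite G" "G \<subseteq> K" "v = (\<lambda>k\<in>{1..n}. \<Sum>z\<in>G. d z * z k)"
    using v by (auto simp: lin_span_def)
  define e where "e z = a * (if z \<in> F then c z else 0) + b * (if z \<in> G then d z else 0)" for z
  have "(\<lambda>k\<in>{1..n}. a * u k + b * v k) = (\<lambda>k\<in>{1..n}. \<Sum>z\<in>F \<union> G. e z * z k)"
  proof (rule restrict_ext)
    fix k assume k: "k \<in> {1..n}"
    have "(\<Sum>z\<in>F \<union> G. (if z \<in> F then c z else 0) * z k) = (\<Sum>z\<in>F. c z * z k)"
      using F G by (intro sum.mono_neutral_cong_right) auto
    moreover have "(\<Sum>z\<in>F \<union> G. (if z \<in> G then d z else 0) * z k) = (\<Sum>z\<in>G. d z * z k)"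
      using F G by (intro sum.mono_neutral_cong_right) auto
    ultimately have "a * (\<Sum>z\<in>F. c z * z k) + b * (\<Sum>z\<in>G. d z * z k) = (\<Sum>z\<in>F \<union> G. e z * z k)"
      by (simp add: e_def distrib_right sum.distrib mult.assoc flip: sum_distrib_left)
    then show "a * u k + b * v k = (\<Sum>z\<in>F \<union> G. e z * z k)"
      using k F G by simp
  qed
  then show ?thesis using F G unfolding lin_span_def by blast
qed

lemma lin_span_base:
  assumes "v \<in> K" "v \<in> extensional {1..n}"
  shows "v \<in> lin_span n K"
proof -
  have "v = (\<lambda>k\<in>{1..n}. \<Sum>z\<in>{v}. 1 * z k)"
    using assms(2) by (auto simp: extensional_def restrict_def fun_eq_iff)
  then show ?thesis unfolding lin_span_def using assms(1)
    by (intro CollectI exI[of _ "{v}"] exI[of _ "\<lambda>_. 1"]) auto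
qed

lemma lin_span_sum:
  assumes "finite J" "\<And>j. j \<in> J \<Longrightarrow> u j \<in> lin_span n K"
  shows "(\<lambda>k\<in>{1..n}. \<Sum>j\<in>J. a j * u j k) \<in> lin_span n K"
  using assms
proof (induction J rule: finite_induct)
  case empty
  show ?case
    unfolding lin_span_def by (rule CollectI, rule exI[of _ "{}"], rule exI[of _ "\<lambda>_. 0"]) (simp add: restrict_def)
next
  case (insert j J)
  then have "(\<lambda>k\<in>{1..n}. a j * u j k + 1 * (\<lambda>k\<in>{1..n}. \<Sum>j\<in>J. a j * u j k) k) \<in> lin_span n K"
    by (intro lin_span_lincomb) auto
  moreover have "(\<lambda>k\<in>{1..n}. a j * u j k + 1 * (\<lambda>k\<in>{1..n}. \<Sum>j\<in>J. a j * u j k) k)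
      = (\<lambda>k\<in>{1..n}. \<Sum>j\<in>insert j J. a j * u j k)"
    using insert by (intro restrict_ext) simp
  ultimately show ?case by (simp only:)
qed

lemma lin_span_extensional: "lin_span n K \<subseteq> extensional {1..n}"
  by (auto simp: lin_span_def)

text \<open>An interior point can be moved a little in the direction \<open>- d\<close>; this turns the weak inequalities of the
  dual cone into strict ones on its interior.\<close>
lemma dual_interior_perturb:
  assumes "x \<in> dual_interior n K"
  shows "\<exists>\<epsilon>>0. (\<lambda>k\<in>{1..n}. x k - \<epsilon> * d k) \<in> dual_cone n K"
proof -
  obtain T where T: "openin (powertop_real {1..n}) T" "x \<in> T" "T \<subseteq> dual_cone n K"
    using assms by (auto simp: dual_interior_def interior_of_def)
  define f where "f t = (\<lambda>k\<in>{1..n}. x k - t * d k)" for t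
  have "continuous_map euclideanreal (powertop_real {1..n}) f"
    unfolding continuous_map_componentwise f_def
    by (auto intro!: continuous_intros)
  then have "openin euclideanreal {t \<in> topspace euclideanreal. f t \<in> T}"
    using T(1) by (rule openin_continuous_map_preimage)
  then have "open {t. f t \<in> T}" by simp
  moreover have "x \<in> extensional {1..n}" using T(2,3) by (auto simp: dual_cone_def)
  then have "f 0 = x" unfolding f_def by (simp add: extensional_restrict)
  then have "0 \<in> {t. f t \<in> T}" using T(2) by simp
  ultimately obtain \<epsilon> where \<epsilon>: "\<epsilon> > 0" "\<And>t. dist t 0 < \<epsilon> \<Longrightarrow> t \<in> {t. f t \<in> T}"
    unfolding open_dist by blast
  have "f (\<epsilon> / 2) \<in> T" using \<epsilon> by auto
  then show ?thesis using \<epsilon>(1) T(3) by (intro exI[of _ "\<epsilon> / 2"]) (auto simp: f_def)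
qed

lemma open_box_subset_dual_interior:
  assumes "\<And>i. i \<in> {1..n} \<Longrightarrow> open (S i)" "(\<Pi>\<^sub>E i\<in>{1..n}. S i) \<subseteq> dual_cone n K"
  shows "(\<Pi>\<^sub>E i\<in>{1..n}. S i) \<subseteq> dual_interior n K"
  unfolding dual_interior_def
  using assms by (intro interior_of_maximal) (auto simp: openin_PiE)

text \<open>A rational function with the right values on the interior of the dual cone is the only one, because
  the interior contains a box with infinite sides.\<close>
lemma cone_s_eqI:
  assumes "\<not> contains_line n K" "lin_span n K = space M" "f \<in> ratfuns_in n"
    and val: "\<And>x. x \<in> dual_interior n K \<Longrightarrow>
      \<exists>c. has_bochner_integral M (\<lambda>v. indicator K v * exp (- pairing n x v)) c \<and> ratfun_value f x c"
    and S: "\<And>i. i \<in> {1..n} \<Longrightarrow> infinite (S i)" "(\<Pi>\<^sub>E i\<in>{1..n}. S i) \<subseteq> dual_interior n K"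
  shows "cone_s n M K = f"
proof -
  have "cone_s n M K = (THE f. f \<in> ratfuns_in n \<and>
        (\<forall>x\<in>dual_interior n K. \<exists>c.
           has_bochner_integral M (\<lambda>v. indicator K v * exp (- pairing n x v)) c \<and>
           ratfun_value f x c))"
    using assms(1,2) by (simp add: cone_s_def)
  also have "\<dots> = f"
  proof (rule the_equality)
    fix g assume g: "g \<in> ratfuns_in n \<and> (\<forall>x\<in>dual_interior n K. \<exists>c.
           has_bochner_integral M (\<lambda>v. indicator K v * exp (- pairing n x v)) c \<and> ratfun_value g x c)"
    show "g = f"
    proof (rule ratfun_eqI[OF _ assms(3) S(1)])
      fix x assume "x \<in> (\<Pi>\<^sub>E i\<in>{1..n}. S i)"
      then have "x \<in> dual_interior n K" using S(2) by blast
      then obtain c c' where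
        "has_bochner_integral M (\<lambda>v. indicator K v * exp (- pairing n x v)) c" "ratfun_value f x c"
        "has_bochner_integral M (\<lambda>v. indicator K v * exp (- pairing n x v)) c'" "ratfun_value g x c'"
        using val g by blast
      then show "\<exists>c. ratfun_value g x c \<and> ratfun_value f x c"
        using has_bochner_integral_eq by metis
    qed (use g in auto)
  qed (use assms(3) val in blast)
  finally show ?thesis .
qed

lemma partial_order_on_subset: "partial_order_on A P \<Longrightarrow> P \<subseteq> A \<times> A"
  by (simp add: partial_order_on_def preorder_on_def)

lemma ideals_principal:
  assumes P: "partial_order_on {1..n} P" and k: "k \<in> {1..n}"
  shows "{j. (j, k) \<in> P} \<in> ideals n P" "{j. (j, k) \<in> P} - {k} \<in> ideals n P" "(k, k) \<in> P"
proof -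
  have *: "P \<subseteq> {1..n} \<times> {1..n}" "trans P" "antisym P" "\<forall>k\<in>{1..n}. (k, k) \<in> P"
    using P by (auto simp: partial_order_on_def preorder_on_def refl_on_def)
  show "{j. (j, k) \<in> P} \<in> ideals n P" using * by (fastforce simp: ideals_def dest: transD)
  show "{j. (j, k) \<in> P} - {k} \<in> ideals n P"
    using * unfolding ideals_def by (fastforce dest: transD antisymD)
  show "(k, k) \<in> P" using * k by auto
qed

lemma trans_strict_part: "partial_order_on A P \<Longrightarrow> trans (P - Id)"
  unfolding partial_order_on_def preorder_on_def trans_def antisym_def by blast

text \<open>The number of elements above \<open>k\<close> decreases along \<open>P\<close>; scaling it by \<open>n + 1\<close> leaves room for adding \<open>k\<close>,
  which separates elements with the same number.\<close>
lemma ex_compatible_labelling: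
  assumes P: "partial_order_on {1..n} P"
  shows "\<exists>r::nat \<Rightarrow> nat. inj_on r {1..n} \<and> (\<forall>(a, b)\<in>P - Id. r b < r a)"
proof -
  have *: "P \<subseteq> {1..n} \<times> {1..n}" "trans P" "antisym P" "\<forall>k\<in>{1..n}. (k, k) \<in> P"
    using P by (auto simp: partial_order_on_def preorder_on_def refl_on_def)
  define up where "up k = {j. (k, j) \<in> P}" for k
  have fin: "finite (up k)" for k by (rule finite_subset[of _ "{1..n}"]) (use * in \<open>auto simp: up_def\<close>)
  define r where "r k = (n + 1) * card (up k) + k" for k
  have "inj_on r {1..n}"
  proof (rule inj_onI)
    fix a b assume ab: "a \<in> {1..n}" "b \<in> {1..n}" "r a = r b"
    then have "r a mod (n + 1) = r b mod (n + 1)" by simp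
    then show "a = b" using ab(1,2) unfolding r_def by (simp only: mod_mult_self4) simp
  qed
  moreover have "r b < r a" if ab: "(a, b) \<in> P - Id" for a b
  proof -
    have "up b \<subseteq> up a" "b \<le> n" using ab * unfolding up_def by (auto dest: transD)
    moreover have "a \<in> up a" "a \<notin> up b" using ab * unfolding up_def by (auto dest: antisymD)
    ultimately have "up b \<subset> up a" "b \<le> n" by auto
    then have "card (up b) + 1 \<le> card (up a)"
      using fin by (simp add: Suc_leI psubset_card_mono)
    then have "(n + 1) * (card (up b) + 1) \<le> (n + 1) * card (up a)" by (rule mult_le_mono2)
    then show ?thesis using \<open>b \<le> n\<close> unfolding r_def by (simp add: algebra_simps)
  qed
  ultimately show ?thesis by blast
qed

lemma affine_nonneg_slope_0:
  fixes a b :: real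
  assumes "\<And>t. 0 \<le> a + t * b"
  shows "b = 0"
proof (rule ccontr)
  assume "b \<noteq> 0"
  then show False using assms[of "- (a + 1) / b"] by simp
qed

section \<open>The weight cone\<close>

lemma Fract_sum: "(\<Sum>i\<in>A. Fract (f i) 1) = Fract (\<Sum>i\<in>A. f i) (1 :: mpoly)"
  by (induction A rule: infinite_finite_induct) (auto simp: Zero_fract_def)

lemma Fract_prod: "(\<Prod>i\<in>A. Fract (f i) 1) = Fract (\<Prod>i\<in>A. f i) (1 :: mpoly)"
  by (induction A rule: infinite_finite_induct) (auto simp: One_fract_def)

lemma xvar_polyvar: "xvar i = Fract (polyvar i) 1"
  by (simp add: xvar_def polyvar_def)

lemma perm_act_reciprocal:
  assumes "bij w" "q \<noteq> 0"
  shows "perm_act w (1 / Fract q 1) = Fract 1 (mpoly_rename w q)"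
proof -
  have "1 / Fract q 1 = Fract 1 q" by (simp add: One_fract_def)
  then show ?thesis using perm_act_Fract[OF assms, of 1] by (simp add: rename_hom)
qed

definition precedes :: "(nat \<Rightarrow> real) \<Rightarrow> (nat \<Rightarrow> nat) \<Rightarrow> nat \<Rightarrow> nat \<Rightarrow> bool" where
  "precedes v r a b \<longleftrightarrow> v b < v a \<or> v a = v b \<and> r b < r a"

text \<open>A wall of a chamber is strict where the tie-breaking rule would list the two entries in the opposite
  order.\<close>
definition tie :: "(nat \<Rightarrow> nat) \<Rightarrow> nat \<Rightarrow> nat list \<Rightarrow> bool" where
  "tie r a l \<longleftrightarrow> l \<noteq> [] \<and> r a < r (hd l)"

lemma chamber_iff_precedes:
  assumes inj: "inj_on r {1..n}" and w: "w permutes {1..n}" and i: "1 \<le> i" "i \<le> Suc n"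
  shows "chamber (tie r) (map w [i..<Suc n]) v \<longleftrightarrow>
    (\<forall>k\<in>{i..<n}. precedes v r (w k) (w (Suc k))) \<and> (i \<le> n \<longrightarrow> 0 \<le> v (w n))"
  using i(2,1)
proof (induction i rule: inc_induct)
  case (step m)
  have cons: "map w [m..<Suc n] = w m # map w [Suc m..<Suc n]"
    using step.hyps by (simp add: upt_conv_Cons del: upt_Suc)
  show ?case
  proof (cases "m = n")
    case True
    then show ?thesis unfolding cons by (auto simp: tie_def hd_coord_def)
  next
    case False
    then have m: "m < n" using step.hyps by simp
    then have cons': "map w [Suc m..<Suc n] = w (Suc m) # map w [Suc (Suc m)..<Suc n]"
      by (simp add: upt_conv_Cons del: upt_Suc)
    have hd: "hd_coord (map w [Suc m..<Suc n]) v = v (w (Suc m))"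
        "tie r (w m) (map w [Suc m..<Suc n]) \<longleftrightarrow> r (w m) < r (w (Suc m))"
      unfolding cons' by (simp_all add: hd_coord_def tie_def del: upt_Suc)
    have "w m \<noteq> w (Suc m)" using injD[OF permutes_inj[OF w], of m "Suc m"] by auto
    moreover have "w m \<in> {1..n}" "w (Suc m) \<in> {1..n}"
      using permutes_in_image[OF w] m step.prems by auto
    ultimately have "r (w m) \<noteq> r (w (Suc m))" using inj_onD[OF inj, of "w m" "w (Suc m)"] by blast
    moreover have "{m..<n} = insert m {Suc m..<n}" using m by auto
    moreover have "(if r a < r b then v b < v a else v b \<le> v a) \<longleftrightarrow> precedes v r a b"
      if "r a \<noteq> r b" for a b
      using that by (auto simp: precedes_def)
    moreover have "chamber (tie r) (map w [Suc m..<Suc n]) v \<longleftrightarrow>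
        (\<forall>k\<in>{Suc m..<n}. precedes v r (w k) (w (Suc k))) \<and> 0 \<le> v (w n)"
      using step.IH m by simp
    ultimately show ?thesis
      unfolding cons chamber.simps hd using m by auto
  qed
qed simp

lemma prefix_prod_map:
  assumes "i \<le> Suc n"
  shows "prefix_prod x t (map w [i..<Suc n]) = (\<Prod>k\<in>{i..n}. t + (\<Sum>j\<in>{i..k}. x (w j)))"
  using assms
proof (induction i arbitrary: t rule: inc_induct)
  case (step m)
  have cons: "map w [m..<Suc n] = w m # map w [Suc m..<Suc n]"
    using step.hyps by (simp add: upt_conv_Cons del: upt_Suc)
  have "(\<Prod>k\<in>{Suc m..n}. t + x (w m) + (\<Sum>j\<in>{Suc m..k}. x (w j))) =
        (\<Prod>k\<in>{Suc m..n}. t + (\<Sum>j\<in>{m..k}. x (w j)))"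
    by (intro prod.cong) (auto simp: sum.atLeast_Suc_atMost[of m])
  moreover have "m \<le> n" using step.hyps by simp
  ultimately show ?case
    unfolding cons by (simp add: step.IH prod.atLeast_Suc_atMost[of m n] del: upt_Suc)
qed simp

lemma prefix_pos_map:
  assumes "i \<le> Suc n" "\<And>k. k \<in> {i..n} \<Longrightarrow> 0 < t + (\<Sum>j\<in>{i..k}. x (w j))"
  shows "prefix_pos x t (map w [i..<Suc n])"
  using assms
proof (induction i arbitrary: t rule: inc_induct)
  case (step m)
  have cons: "map w [m..<Suc n] = w m # map w [Suc m..<Suc n]"
    using step.hyps by (simp add: upt_conv_Cons del: upt_Suc)
  have "prefix_pos x (t + x (w m)) (map w [Suc m..<Suc n])"
  proof (rule step.IH)
    fix k assume "k \<in> {Suc m..n}"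
    then show "0 < t + x (w m) + (\<Sum>j\<in>{Suc m..k}. x (w j))"
      using step.prems[of k] by (simp add: sum.atLeast_Suc_atMost[of m])
  qed
  then show ?case
    unfolding cons using step.prems[of m] step.hyps by simp
qed simp

lemma sorts_if_adjacent:
  assumes "w permutes {1..n}" "transp lt" "\<And>k. k \<in> {1..<n} \<Longrightarrow> lt (w k) (w (Suc k))"
  shows "sorts n lt w"
  unfolding sorts_def
proof (intro conjI ballI impI assms(1))
  fix i j assume ij: "i \<in> {1..n}" "j \<in> {1..n}" "i < j"
  have "lt (w i) (w (Suc i + d))" if "Suc i + d \<le> n" for d
    using that
  proof (induction d)
    case 0
    then show ?case using assms(3)[of i] ij by simp
  next
    case (Suc d)
    then have "lt (w i) (w (Suc i + d))" "lt (w (Suc i + d)) (w (Suc (Suc i + d)))"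
      using assms(3)[of "Suc i + d"] by auto
    then show ?case using transpD[OF assms(2)] by simp
  qed
  from this[of "j - Suc i"] show "lt (w i) (w j)" using ij by simp
qed

text \<open>A vector lies in no chamber other than that of the permutation that sorts it. For a vector of the
  cone it does lie there, and the permutation is a linear extension, ties included, because the labels decrease along
  \<open>P\<close>; conversely the inequalities of the chamber of a linear extension imply those of the cone.\<close>
lemma indicator_K_wt:
  assumes P: "P \<subseteq> {1..n} \<times> {1..n}"
    and r: "inj_on r {1..n}" "\<And>a b. (a, b) \<in> P - Id \<Longrightarrow> r b < r a"
    and v: "v \<in> extensional {1..n}"
  shows "(indicator (K_wt n P) v :: real) =
    (\<Sum>w\<in>linear_extensions n P. of_bool (chamber (tie r) (map w [1..<Suc n]) v))"
proof -
  let ?ch = "\<lambda>w. chamber (tie r) (map w [1..<Suc n]) v" and ?L = "linear_extensions n P"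
  have tr: "transp (precedes v r)" by (auto simp: transp_def precedes_def)
  have fin: "finite ?L"
    by (rule finite_subset[OF _ finite_permutations[of "{1..n}"]]) (auto simp: linear_extensions_def)
  have ch_iff: "?ch w \<longleftrightarrow> sorts n (precedes v r) w \<and> (1 \<le> n \<longrightarrow> 0 \<le> v (w n))"
    if w: "w permutes {1..n}" for w
  proof -
    have "sorts n (precedes v r) w \<longleftrightarrow> (\<forall>k\<in>{1..<n}. precedes v r (w k) (w (Suc k)))"
      using sorts_if_adjacent[OF w tr] by (auto simp: sorts_def)
    then show ?thesis using chamber_iff_precedes[OF r(1) w, of 1 v] by simp
  qed
  have perm: "w permutes {1..n}" if "w \<in> ?L" for w using that by (simp add: linear_extensions_def)
  have ex1: "\<exists>!w. sorts n (precedes v r) w"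
  proof (rule ex1_sorts)
    fix a b assume "a \<in> {1..n}" "b \<in> {1..n}" "a \<noteq> b"
    then have "r a \<noteq> r b" using r(1) by (auto dest: inj_onD)
    then show "precedes v r a b \<or> precedes v r b a" by (auto simp: precedes_def)
  qed (use tr in \<open>auto simp: precedes_def transp_def\<close>)
  then obtain w0 where w0: "sorts n (precedes v r) w0" by blast
  then have p0: "w0 permutes {1..n}" by (simp add: sorts_def)
  show ?thesis
  proof (cases "v \<in> K_wt n P")
    case True
    have "w0 \<in> ?L"
      unfolding linear_extensions_def
    proof (intro CollectI conjI ballI impI p0)
      fix a b assume ab: "a \<in> {1..n}" "b \<in> {1..n}" "(w0 a, w0 b) \<in> P - Id"
      then have "v (w0 b) \<le> v (w0 a)" "r (w0 b) < r (w0 a)"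
        using True r(2)[OF ab(3)] by (auto simp: K_wt_def)
      then have "\<not> precedes v r (w0 b) (w0 a)" by (auto simp: precedes_def)
      moreover have "a \<noteq> b" using ab by auto
      moreover have "b < a \<Longrightarrow> precedes v r (w0 b) (w0 a)" using w0 ab by (simp add: sorts_def)
      ultimately show "a < b" by (meson linorder_neqE_nat)
    qed
    moreover have "?ch w0"
      using True permutes_in_image[OF p0, of n] w0 unfolding ch_iff[OF p0] by (auto simp: K_wt_def)
    moreover have "w = w0" if "w \<in> ?L" "?ch w" for w
      using that(2) ex1 w0 unfolding ch_iff[OF perm[OF that(1)]] by blast
    ultimately have "?ch w \<longleftrightarrow> w = w0" if "w \<in> ?L" for w using that by blast
    then have "(\<Sum>w\<in>?L. of_bool (?ch w)) = (\<Sum>w\<in>?L. if w = w0 then 1 else (0::real))"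
      by (intro sum.cong refl) (simp del: upt_Suc)
    then show ?thesis using True fin \<open>w0 \<in> ?L\<close> by (simp del: upt_Suc)
  next
    case False
    have "\<not> ?ch w" if w: "w \<in> ?L" for w
    proof
      assume ch: "?ch w"
      have p: "w permutes {1..n}" using w by (simp add: linear_extensions_def)
      have srt: "sorts n (precedes v r) w" and last: "1 \<le> n \<Longrightarrow> 0 \<le> v (w n)"
        using ch ch_iff[OF p] by auto
      have mono: "v (w j) \<le> v (w i)" if "i \<in> {1..n}" "j \<in> {1..n}" "i \<le> j" for i j
      proof (cases "i = j")
        case False
        then have "precedes v r (w i) (w j)" using that srt by (simp add: sorts_def)
        then show ?thesis by (auto simp: precedes_def)
      qed simp
      have onto: "\<exists>i\<in>{1..n}. k = w i" if "k \<in> {1..n}" for k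
        using that permutes_image[OF p] by blast
      have "0 \<le> v k" if k: "k \<in> {1..n}" for k
      proof -
        obtain i where "i \<in> {1..n}" "k = w i" using onto[OF k] by blast
        then show ?thesis using mono[of i n] last by fastforce
      qed
      moreover have "v b \<le> v a" if ab: "(a, b) \<in> P - Id" for a b
      proof -
        obtain i j where ij: "i \<in> {1..n}" "j \<in> {1..n}" "a = w i" "b = w j"
          using ab P onto by (metis DiffD1 SigmaD1 SigmaD2 subsetD)
        then have "i < j" using ab w by (auto simp: linear_extensions_def)
        then show ?thesis using ij mono by simp
      qed
      ultimately have "v \<in> K_wt n P" using v by (auto simp: K_wt_def)
      then show False using False by simp
    qed
    then show ?thesis using False by (simp del: upt_Suc)
  qed
qed

text \<open>The cone contains the indicators of all ideals. They show that the cone is full-dimensional, since a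
  unit vector is the difference of the indicators of a principal ideal with and without its top
  element, and that \<open>x\<close> is positive on nonempty ideals for \<open>x\<close> interior to the dual cone.\<close>
theorem Phi_eq_cone_s:
  assumes P: "partial_order_on {1..n} P"
  shows "cone_s n (std_measure n) (K_wt n P) = Phi n P"
proof -
  let ?A = "{1..n}" and ?L = "linear_extensions n P" and ?K = "K_wt n P"
  note PA = partial_order_on_subset[OF P]
  obtain r :: "nat \<Rightarrow> nat" where r: "inj_on r ?A" "\<And>a b. (a, b) \<in> P - Id \<Longrightarrow> r b < r a"
    using ex_compatible_labelling[OF P] by blast
  have perm: "w permutes ?A" if "w \<in> ?L" for w using that by (simp add: linear_extensions_def)
  have ext: "?K \<subseteq> extensional ?A" by (auto simp: K_wt_def)
  define ind where "ind I = (\<lambda>k\<in>?A. of_bool (k \<in> I) :: real)" for I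
  have ind_ext: "ind I \<in> extensional ?A" for I
    unfolding ind_def by (rule restrict_extensional)
  have ind_K: "ind I \<in> ?K" if "I \<in> ideals n P" for I
    using that PA by (fastforce simp: ind_def K_wt_def ideals_def)

  define q where "q w = (\<Prod>i\<in>?A. \<Sum>j\<in>{1..i}. polyvar (w j))" for w
  have Phi_term: "perm_act w (1 / (\<Prod>i\<in>?A. \<Sum>j\<in>{1..i}. xvar j)) = Fract 1 (q w)" if "w permutes ?A" for w
  proof -
    have "mpoly_eval (\<lambda>_. 1) (q id) = (\<Prod>i\<in>?A. real i)"
      by (simp add: q_def eval_hom)
    then have "q id \<noteq> 0" by (auto simp: eval_hom)
    then have "perm_act w (1 / Fract (q id) 1) = Fract 1 (mpoly_rename w (q id))"
      using that by (intro perm_act_reciprocal permutes_bij)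
    moreover have "mpoly_rename w (q id) = q w"
      by (simp add: q_def rename_hom)
    ultimately show ?thesis by (simp add: xvar_polyvar Fract_sum Fract_prod q_def)
  qed
  have Phi: "Phi n P = (\<Sum>w\<in>?L. Fract 1 (q w))"
    unfolding Phi_def using Phi_term perm by (intro sum.cong) auto

  have eval_q: "mpoly_eval x (q w) = (\<Prod>i\<in>?A. \<Sum>j\<in>{1..i}. x (w j))" for x w
    by (simp add: q_def eval_hom)

  show ?thesis
  proof (rule cone_s_eqI[where S = "\<lambda>_. {0<..}"])
    show "\<not> contains_line n ?K"
    proof
      assume "contains_line n ?K"
      then obtain a d k where k: "k \<in> ?A" "d k \<noteq> 0" and line: "\<And>t. (\<lambda>k\<in>?A. a k + t * d k) \<in> ?K"
        unfolding contains_line_def by blast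
      have "0 \<le> a k + t * d k" for t using line[of t] k by (auto simp: K_wt_def)
      then show False using affine_nonneg_slope_0 k by blast
    qed
    show "lin_span n ?K = space (std_measure n)"
    proof
      show "lin_span n ?K \<subseteq> space (std_measure n)"
        using lin_span_extensional[of n ?K] by (auto simp: std_measure_def space_PiM PiE_def)
      show "space (std_measure n) \<subseteq> lin_span n ?K"
      proof
        fix v assume v: "v \<in> space (std_measure n)"
        define u where "u j = (\<lambda>k\<in>?A. 1 * ind {i. (i, j) \<in> P} k + (-1) * ind ({i. (i, j) \<in> P} - {j}) k)" for j
        have "u j \<in> lin_span n ?K" if "j \<in> ?A" for j
          unfolding u_def using ideals_principal[OF P that]
          by (intro lin_span_lincomb lin_span_base ind_K ind_ext)
        then have "(\<lambda>k\<in>?A. \<Sum>j\<in>?A. v j * u j k) \<in> lin_span n ?K"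
          by (intro lin_span_sum) auto
        moreover have "(\<lambda>k\<in>?A. \<Sum>j\<in>?A. v j * u j k) = v"
        proof
          fix k
          have "u j k = of_bool (j = k)" if "k \<in> ?A" "j \<in> ?A" for j
            using that ideals_principal(3)[OF P that(2)] by (auto simp: u_def ind_def)
          then have "(\<Sum>j\<in>?A. v j * u j k) = (\<Sum>j\<in>?A. if j = k then v j else 0)" if "k \<in> ?A"
            using that by (intro sum.cong) auto
          then have "(\<Sum>j\<in>?A. v j * u j k) = v k" if "k \<in> ?A" using that by simp
          then show "(\<lambda>k\<in>?A. \<Sum>j\<in>?A. v j * u j k) k = v k"
            using v by (auto simp: std_measure_def space_PiM PiE_def extensional_def)
        qed
        ultimately show "v \<in> lin_span n ?K" by simp
      qed
    qed
    show "Phi n P \<in> ratfuns_in n"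
      unfolding Phi
    proof (rule ratfuns_in_sum)
      fix w assume "w \<in> ?L"
      then have p: "w permutes ?A" by (rule perm)
      have "q w \<in> polys_in n"
        unfolding q_def using permutes_in_image[OF p] by (intro polys_in_prod polys_in_sum polys_in_var) auto
      moreover have "mpoly_eval (\<lambda>_. 1) (q w) \<noteq> 0" by (simp add: eval_q)
      then have "q w \<noteq> 0" by (auto simp: eval_hom)
      ultimately show "Fract 1 (q w) \<in> ratfuns_in n"
        unfolding ratfuns_in_def using polys_in_1 by blast
    qed
    show "(\<Pi>\<^sub>E i\<in>?A. {0<..}) \<subseteq> dual_interior n ?K"
    proof (rule open_box_subset_dual_interior)
      show "(\<Pi>\<^sub>E i\<in>?A. {0<..}) \<subseteq> dual_cone n ?K"
        by (force simp: dual_cone_def pairing_def K_wt_def PiE_iff intro!: sum_nonneg mult_nonneg_nonneg)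
    qed simp
    show "infinite {0::real<..}" by (rule infinite_Ioi)
  next
    fix x assume x: "x \<in> dual_interior n ?K"
    have pos: "(\<Sum>k\<in>I. x k) > 0" if I: "I \<in> ideals n P" "I \<noteq> {}" for I
    proof -
      obtain \<epsilon> where \<epsilon>: "\<epsilon> > 0" "(\<lambda>k\<in>?A. x k - \<epsilon> * 1) \<in> dual_cone n ?K"
        using dual_interior_perturb[OF x, of "\<lambda>_. 1"] by blast
      have IA: "I \<subseteq> ?A" "finite I" using I finite_subset by (auto simp: ideals_def)
      have "0 \<le> pairing n (\<lambda>k\<in>?A. x k - \<epsilon> * 1) (ind I)"
        using \<epsilon>(2) ind_K[OF I(1)] by (simp add: dual_cone_def)
      also have "\<dots> = (\<Sum>k\<in>?A. if k \<in> I then x k - \<epsilon> else 0)"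
        unfolding pairing_def by (intro sum.cong) (auto simp: ind_def)
      also have "\<dots> = (\<Sum>k\<in>I. x k - \<epsilon>)"
        using IA by (simp add: sum.If_cases Int_absorb1)
      also have "\<dots> = (\<Sum>k\<in>I. x k) - card I * \<epsilon>" by (simp add: sum_subtractf)
      finally show ?thesis
        using \<epsilon>(1) I(2) IA by (smt (verit) card_gt_0_iff mult_pos_pos of_nat_0_less_iff)
    qed
    have prefix: "0 < (\<Sum>j\<in>{1..k}. x (w j))" if w: "w \<in> ?L" and k: "k \<in> ?A" for w k
    proof -
      note p = perm[OF w]
      have "w ` {1..k} \<in> ideals n P"
        unfolding ideals_def
      proof safe
        fix i assume "i \<in> {1..k}"
        then show "w i \<in> ?A" using permutes_in_image[OF p] k by auto
      next
        fix a i assume i: "(a, w i) \<in> P" "a \<noteq> w i" "i \<in> {1..k}"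
        then obtain j where j: "j \<in> ?A" "a = w j" using PA permutes_image[OF p] by blast
        then have "j < i" using i k w by (auto simp: linear_extensions_def)
        then show "a \<in> w ` {1..k}" using i j by auto
      qed
      moreover have "(\<Sum>k\<in>w ` {1..k}. x k) = (\<Sum>j\<in>{1..k}. x (w j))"
        using permutes_inj[OF p] by (subst sum.reindex) (auto intro: inj_on_subset)
      ultimately show ?thesis using pos[of "w ` {1..k}"] k by auto
    qed
    have summand: "has_bochner_integral (std_measure n)
        (\<lambda>v. of_bool (chamber (tie r) (map w [1..<Suc n]) v) * exp (- pairing n x v))
        (1 / mpoly_eval x (q w))" if w: "w \<in> ?L" for w
    proof -
      let ?l = "map w [1..<Suc n]"
      note p = perm[OF w]
      have set_l: "set ?l = ?A"
        using permutes_image[OF p] by (simp add: atLeastLessThanSuc_atLeastAtMost del: upt_Suc)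
      have dist: "distinct ?l"
        using permutes_inj[OF p] by (auto simp: distinct_map simp del: upt_Suc intro: inj_on_subset)
      have pp: "prefix_pos x 0 ?l" by (rule prefix_pos_map) (use prefix[OF w] in auto)
      have qv: "mpoly_eval x (q w) = prefix_prod x 0 ?l"
        unfolding eval_q by (subst prefix_prod_map) auto
      have "(\<lambda>v. of_bool (chamber (tie r) ?l v) * exp (- (\<Sum>i\<in>?A. x i * v i)))
          \<in> borel_measurable (PiM ?A (\<lambda>_. lborel))"
      proof -
        have [measurable]: "Measurable.pred (PiM ?A (\<lambda>_. lborel)) (chamber (tie r) ?l)"
          by (rule pred_chamber) (simp only: set_l order_refl)
        show ?thesis by measurable
      qed
      moreover have "(\<integral>\<^sup>+v. ennreal (of_bool (chamber (tie r) ?l v) * exp (- (\<Sum>i\<in>?A. x i * v i)))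
          \<partial>PiM ?A (\<lambda>_. lborel)) = ennreal (1 / prefix_prod x 0 ?l)"
        using nn_integral_chamber[OF dist pp, of "tie r"] unfolding set_l by (simp del: upt_Suc)
      ultimately show ?thesis
        unfolding std_measure_def pairing_def qv
        using prefix_prod_pos[OF pp] by (intro has_bochner_integral_nn_integral) (auto simp del: upt_Suc)
    qed
    let ?c = "\<Sum>w\<in>?L. 1 / mpoly_eval x (q w)"
    have "has_bochner_integral (std_measure n)
        (\<lambda>v. \<Sum>w\<in>?L. of_bool (chamber (tie r) (map w [1..<Suc n]) v) * exp (- pairing n x v)) ?c"
      by (rule has_bochner_integral_sum) (rule summand)
    moreover have "(\<Sum>w\<in>?L. of_bool (chamber (tie r) (map w [1..<Suc n]) v) * exp (- pairing n x v))
        = indicator ?K v * exp (- pairing n x v)" if "v \<in> space (std_measure n)" for v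
      using that indicator_K_wt[OF PA r, of v]
      by (simp add: std_measure_def space_PiM PiE_def sum_distrib_right del: upt_Suc)
    ultimately have "has_bochner_integral (std_measure n) (\<lambda>v. indicator ?K v * exp (- pairing n x v)) ?c"
      by (subst (asm) has_bochner_integral_cong[OF refl _ refl]) auto
    moreover have "ratfun_value (Phi n P) x ?c"
      unfolding Phi
    proof (rule ratfun_value_sum)
      fix w assume "w \<in> ?L"
      then have "mpoly_eval x (q w) \<noteq> 0"
        using prefix unfolding eval_q by (auto simp: less_imp_neq[symmetric])
      then show "ratfun_value (Fract 1 (q w)) x (1 / mpoly_eval x (q w))"
        by (simp add: ratfun_value_Fract eval_hom)
    qed
    ultimately show "\<exists>c. has_bochner_integral (std_measure n)
        (\<lambda>v. indicator ?K v * exp (- pairing n x v)) c \<and> ratfun_value (Phi n P) x c" by blast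
  qed
qed

section \<open>Denominators that are products of linear forms\<close>

definition linear_prod :: "(nat \<times> nat) list \<Rightarrow> mpoly" where
  "linear_prod xs = (\<Prod>(a, b)\<leftarrow>xs. polyvar a - polyvar b)"

lemma linear_prod_simps [simp]:
  "linear_prod [] = 1"
  "linear_prod (e # xs) = (polyvar (fst e) - polyvar (snd e)) * linear_prod xs"
  "linear_prod (xs @ ys) = linear_prod xs * linear_prod ys"
  by (auto simp: linear_prod_def case_prod_beta)

lemma eval_linear_prod_eq_0_iff:
  "mpoly_eval x (linear_prod xs) = 0 \<longleftrightarrow> (\<exists>(a, b)\<in>set xs. x a = x b)"
  by (induction xs) (auto simp: eval_hom)

lemma linear_prod_in: "set xs \<subseteq> {1..n} \<times> {1..n} \<Longrightarrow> linear_prod xs \<in> polys_in n"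
  by (induction xs) (auto intro!: polys_in_mult polys_in_diff polys_in_var)

definition distinct_pairs :: "nat \<Rightarrow> (nat \<times> nat) set" where
  "distinct_pairs n = {1..n} \<times> {1..n} - Id"

lemma linear_prod_nonzero: "set xs \<subseteq> distinct_pairs n \<Longrightarrow> linear_prod xs \<noteq> 0"
  using eval_linear_prod_eq_0_iff[of real xs]
  by (auto simp: distinct_pairs_def eval_hom)

definition linear_fraction :: "nat \<Rightarrow> ratfun \<Rightarrow> bool" where
  "linear_fraction n f \<longleftrightarrow>
     (\<exists>p xs. p \<in> polys_in n \<and> set xs \<subseteq> distinct_pairs n \<and> f = Fract p (linear_prod xs))"

lemma linear_fraction_0: "linear_fraction n 0"
  unfolding linear_fraction_def Zero_fract_def
  by (rule exI[of _ 0], rule exI[of _ "[]"]) simp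

lemma linear_fraction_add:
  assumes "linear_fraction n f" "linear_fraction n g"
  shows "linear_fraction n (f + g)"
proof -
  obtain p xs q ys where *: "p \<in> polys_in n" "set xs \<subseteq> distinct_pairs n" "f = Fract p (linear_prod xs)"
    "q \<in> polys_in n" "set ys \<subseteq> distinct_pairs n" "g = Fract q (linear_prod ys)"
    using assms by (auto simp: linear_fraction_def)
  then have "f + g = Fract (p * linear_prod ys + q * linear_prod xs) (linear_prod (xs @ ys))"
    using linear_prod_nonzero by simp
  moreover have "p * linear_prod ys + q * linear_prod xs \<in> polys_in n"
    using * by (intro polys_in_add polys_in_mult linear_prod_in) (auto simp: distinct_pairs_def)
  moreover have "set (xs @ ys) \<subseteq> distinct_pairs n" using * by auto
  ultimately show ?thesis unfolding linear_fraction_def by blast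
qed

lemma linear_fraction_sum:
  "(\<And>a. a \<in> A \<Longrightarrow> linear_fraction n (f a)) \<Longrightarrow> linear_fraction n (sum f A)"
  by (induction A rule: infinite_finite_induct) (auto intro: linear_fraction_0 linear_fraction_add)

definition compatible :: "nat rel \<Rightarrow> (nat \<Rightarrow> real) \<Rightarrow> bool" where
  "compatible P x \<longleftrightarrow> (\<forall>(a, b)\<in>P - Id. x b < x a)"

lemma compatibleI: "(\<And>a b. (a, b) \<in> P - Id \<Longrightarrow> x b < x a) \<Longrightarrow> compatible P x"
  by (auto simp: compatible_def)

lemma compatibleD: "compatible P x \<Longrightarrow> (a, b) \<in> P - Id \<Longrightarrow> x b < x a"
  by (auto simp: compatible_def)

text \<open>A continuity property just strong enough to extend identities between polynomials and \<open>G\<close> from the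
  generic points to all points that decrease along \<open>P\<close>.\<close>
definition approximable :: "nat \<Rightarrow> nat rel \<Rightarrow> ((nat \<Rightarrow> real) \<Rightarrow> real) \<Rightarrow> bool" where
  "approximable n P G \<longleftrightarrow> (\<forall>y. compatible P y \<longrightarrow>
     (\<exists>X. (\<forall>k. compatible P (X k) \<and> inj_on (X k) {1..n}) \<and>
          (\<forall>i\<in>{1..n}. (\<lambda>k. X k i) \<longlonglongrightarrow> y i) \<and> (\<lambda>k. G (X k)) \<longlonglongrightarrow> G y))"

lemma fraction_extends:
  assumes G: "approximable n P G" and p: "p \<in> polys_in n" and q: "q \<in> polys_in n"
    and gen: "\<And>x. compatible P x \<Longrightarrow> inj_on x {1..n} \<Longrightarrow> mpoly_eval x p = mpoly_eval x q * G x"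
    and y: "compatible P y"
  shows "mpoly_eval y p = mpoly_eval y q * G y"
proof -
  obtain X where X: "\<And>k. compatible P (X k)" "\<And>k. inj_on (X k) {1..n}"
     "\<And>i. i \<in> {1..n} \<Longrightarrow> (\<lambda>k. X k i) \<longlonglongrightarrow> y i" "(\<lambda>k. G (X k)) \<longlonglongrightarrow> G y"
    using G y unfolding approximable_def by blast
  have "(\<lambda>k. mpoly_eval (X k) p) \<longlonglongrightarrow> mpoly_eval y p"
    by (rule tendsto_mpoly_eval[OF p X(3)])
  moreover have "(\<lambda>k. mpoly_eval (X k) q * G (X k)) \<longlonglongrightarrow> mpoly_eval y q * G y"
    by (intro tendsto_mult tendsto_mpoly_eval[OF q X(3)] X(4))
  then have "(\<lambda>k. mpoly_eval (X k) p) \<longlonglongrightarrow> mpoly_eval y q * G y"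
    by (simp add: gen[OF X(1,2)])
  ultimately show ?thesis by (rule LIMSEQ_unique)
qed

text \<open>Count the elements above \<open>k\<close> after \<open>a\<close> and \<open>b\<close> have been glued together; as they are incomparable, this
  creates no cycle.\<close>
lemma ex_labelling_tied:
  assumes P: "partial_order_on {1..n} P" and ab: "(a, b) \<notin> P" "(b, a) \<notin> P" "a \<in> {1..n}" "b \<in> {1..n}"
  shows "\<exists>r::nat \<Rightarrow> nat. r a = r b \<and> (\<forall>(i, j)\<in>P - Id. r j < r i)"
proof -
  have PA: "P \<subseteq> {1..n} \<times> {1..n}" and tr: "\<And>i j k. (i, j) \<in> P \<Longrightarrow> (j, k) \<in> P \<Longrightarrow> (i, k) \<in> P"
    and as: "\<And>i j. (i, j) \<in> P \<Longrightarrow> (j, i) \<in> P \<Longrightarrow> i = j" and rf: "\<And>k. k \<in> {1..n} \<Longrightarrow> (k, k) \<in> P"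
    using P unfolding partial_order_on_def preorder_on_def refl_on_def trans_def antisym_def by blast+
  define U where "U k = {j. (k, j) \<in> P} \<union>
      (if (k, a) \<in> P \<or> (k, b) \<in> P then {j. (a, j) \<in> P \<or> (b, j) \<in> P} else {})" for k
  have fin: "finite (U k)" for k
    by (rule finite_subset[of _ "{1..n}"]) (use PA in \<open>auto simp: U_def split: if_splits\<close>)
  have "U a = U b" using rf ab by (auto simp: U_def)
  moreover have "card (U j) < card (U i)" if ij: "(i, j) \<in> P - Id" for i j
  proof (rule psubset_card_mono[OF fin])
    have "U j \<subseteq> U i" using ij tr unfolding U_def by (auto split: if_splits)
    moreover have "i \<in> U i" using ij PA rf by (auto simp: U_def)
    moreover have "(j, i) \<notin> P" using ij as by auto
    moreover have "\<not> ((j, a) \<in> P \<and> (a, i) \<in> P)" "\<not> ((j, b) \<in> P \<and> (b, i) \<in> P)"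
      using \<open>(j, i) \<notin> P\<close> tr by blast+
    moreover have "\<not> ((j, a) \<in> P \<and> (b, i) \<in> P)" "\<not> ((j, b) \<in> P \<and> (a, i) \<in> P)"
      using ij ab tr by blast+
    ultimately have "i \<notin> U j" unfolding U_def by auto
    then show "U j \<subset> U i" using \<open>U j \<subseteq> U i\<close> \<open>i \<in> U i\<close> by blast
  qed
  ultimately show ?thesis by (intro exI[of _ "\<lambda>k. card (U k)"]) auto
qed

text \<open>For integral labels the sides of the box for different labels are disjoint, so every point of the box is
  ordered by the labels.\<close>
abbreviation box_around :: "(nat \<Rightarrow> nat) \<Rightarrow> nat \<Rightarrow> real set" where
  "box_around r i \<equiv> {real (r i) - 1 / 2<..<real (r i) + 1 / 2}"

lemma box_compatible:
  assumes P: "P \<subseteq> {1..n} \<times> {1..n}" and r: "\<And>i j. (i, j) \<in> P - Id \<Longrightarrow> r j < r i"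
    and x: "x \<in> (\<Pi>\<^sub>E i\<in>{1..n}. box_around r i)"
  shows "compatible P x"
proof (rule compatibleI)
  fix a b assume ab: "(a, b) \<in> P - Id"
  then have "a \<in> {1..n}" "b \<in> {1..n}" using P by auto
  then have "x a \<in> box_around r a" "x b \<in> box_around r b" using x by (auto simp only: PiE_iff)
  moreover have "real (r b) + 1 \<le> real (r a)" using r[of a b] ab by auto
  ultimately show "x b < x a" by simp
qed

lemma box_infinite: "infinite (box_around r i)"
  by (rule infinite_Ioo) simp

text \<open>The denominators are treated factor by factor. At a point with \<open>x\<^sub>a = x\<^sub>b\<close> the relation \<open>p = q G\<close> and a
  denominator \<open>q\<close> divisible by \<open>x\<^sub>a - x\<^sub>b\<close> force \<open>p\<close> to vanish. If \<open>a\<close> and \<open>b\<close> are incomparable, such points fill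
  the hyperplane section of a box, so that \<open>p\<close> is divisible by \<open>x\<^sub>a - x\<^sub>b\<close> as well. The list \<open>good\<close> collects the
  factors that stay.\<close>
theorem cancel_incomparable_factors:
  assumes P: "partial_order_on {1..n} P" and G: "approximable n P G"
    and "p \<in> polys_in n" "set (good @ bad) \<subseteq> distinct_pairs n"
    and "f = Fract p (linear_prod (good @ bad))"
    and "\<And>x. compatible P x \<Longrightarrow> inj_on x {1..n} \<Longrightarrow>
           mpoly_eval x p = mpoly_eval x (linear_prod (good @ bad)) * G x"
    and "\<forall>(a, b)\<in>set good. (a, b) \<in> P \<or> (b, a) \<in> P"
  shows "\<exists>q xs. q \<in> polys_in n \<and> set xs \<subseteq> distinct_pairs n \<and> f = Fract q (linear_prod xs) \<and>
      (\<forall>(a, b)\<in>set xs. (a, b) \<in> P \<or> (b, a) \<in> P) \<and>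
      (\<forall>y. compatible P y \<longrightarrow> mpoly_eval y q = mpoly_eval y (linear_prod xs) * G y)"
  using assms(3-7)
proof (induction bad arbitrary: p good)
  case Nil
  have "linear_prod good \<in> polys_in n"
    using Nil by (intro linear_prod_in) (auto simp: distinct_pairs_def)
  then have "mpoly_eval y p = mpoly_eval y (linear_prod good) * G y" if "compatible P y" for y
    using fraction_extends[OF G Nil(1) _ _ that, of "linear_prod good"] Nil(4) by simp
  then show ?case using Nil by (intro exI[of _ p] exI[of _ good]) auto
next
  case (Cons e bad)
  obtain a b where e: "e = (a, b)" by (cases e)
  have ab: "a \<in> {1..n}" "b \<in> {1..n}" "a \<noteq> b" using Cons.prems(2) by (auto simp: e distinct_pairs_def)
  show ?case
  proof (cases "(a, b) \<in> P \<or> (b, a) \<in> P")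
    case True
    show ?thesis
    proof (rule Cons.IH[of p "good @ [e]"])
    qed (use Cons.prems True in \<open>auto simp: e\<close>)
  next
    case False
    define D where "D = linear_prod (good @ bad)"
    have D: "linear_prod (good @ e # bad) = (polyvar a - polyvar b) * D"
      by (simp add: D_def e)
    have D_in: "D \<in> polys_in n" unfolding D_def
      using Cons.prems(2) by (intro linear_prod_in) (auto simp: distinct_pairs_def)
    have lin_in: "linear_prod (good @ e # bad) \<in> polys_in n"
      using Cons.prems(2) by (intro linear_prod_in) (auto simp: distinct_pairs_def)
    obtain r where r: "r a = r b" "\<And>i j. (i, j) \<in> P - Id \<Longrightarrow> r j < (r i :: nat)"
      using ex_labelling_tied[OF P _ _ ab(1,2)] False by blast
    note PA = partial_order_on_subset[OF P]
    have "\<exists>q\<in>polys_in n. p = (polyvar a - polyvar b) * q"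
    proof (rule linear_form_dvd[where S = "box_around r"])
      fix x assume x: "x \<in> (\<Pi>\<^sub>E i\<in>{1..n}. box_around r i)" "x a = x b"
      have "mpoly_eval x p = mpoly_eval x (linear_prod (good @ e # bad)) * G x"
        by (rule fraction_extends[OF G Cons.prems(1) lin_in Cons.prems(4)])
           (auto intro: box_compatible[OF PA r(2) x(1)])
      also have "\<dots> = 0" using x(2) unfolding D by (simp add: eval_hom)
      finally show "mpoly_eval x p = 0" .
    qed (use Cons.prems(1) ab r(1) box_infinite in auto)
    then obtain q where q: "q \<in> polys_in n" "p = (polyvar a - polyvar b) * q" by blast
    show ?thesis
    proof (rule Cons.IH[of q good])
      have "linear_prod [(a, b)] \<noteq> 0"
        by (rule linear_prod_nonzero[of _ n]) (use ab in \<open>auto simp: distinct_pairs_def\<close>)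
      then have nz: "polyvar a - polyvar b \<noteq> 0" by simp
      have "D \<noteq> 0" unfolding D_def using Cons.prems(2) by (intro linear_prod_nonzero) auto
      then show "f = Fract q (linear_prod (good @ bad))"
        using Cons.prems(3) nz unfolding D q(2) D_def[symmetric] by (simp add: eq_fract)
      fix x assume x: "compatible P x" "inj_on x {1..n}"
      then have "x a \<noteq> x b" using ab by (auto dest: inj_onD)
      moreover have "(x a - x b) * mpoly_eval x q = (x a - x b) * (mpoly_eval x D * G x)"
        using Cons.prems(4)[OF x] unfolding D q(2) by (simp add: eval_hom)
      ultimately show "mpoly_eval x q = mpoly_eval x (linear_prod (good @ bad)) * G x"
        by (simp add: D_def)
    qed (use Cons.prems q in auto)
  qed
qed

section \<open>The integral over the root cone\<close>

lemma abel_summation: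
  fixes u y :: "nat \<Rightarrow> real"
  shows "(\<Sum>i\<in>{1..<n}. (\<Sum>k\<in>{1..i}. u k) * (y i - y (i + 1))) =
    (\<Sum>k\<in>{1..n}. y k * u k) - y n * (\<Sum>k\<in>{1..n}. u k)"
proof (induction n)
  case (Suc n)
  show ?case
  proof (cases n)
    case (Suc m)
    then have "{1..<Suc n} = insert n {1..<n}" by auto
    then show ?thesis using Suc.IH by (simp add: algebra_simps)
  qed simp
qed simp

definition root_integrand :: "nat \<Rightarrow> nat rel \<Rightarrow> (nat \<Rightarrow> real) \<Rightarrow> (nat \<Rightarrow> real) \<Rightarrow> real" where
  "root_integrand n P x v = indicator (K_root n P) v * exp (- pairing n x v)"

text \<open>By Abel summation \<open>exp (- pairing n x v)\<close> factors over the partial sums of \<open>v\<close> along \<open>w\<close>, so each piece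
  of the signed decomposition is a product of one-dimensional integrals.\<close>
lemma has_bochner_integral_root_generic:
  assumes P: "partial_order_on {1..n} P" and x: "compatible P x" and inj: "inj_on x {1..n}"
  shows "has_bochner_integral (root_measure n) (root_integrand n P x)
    (\<Sum>w\<in>linear_extensions n P. \<Prod>i\<in>{1..<n}. 1 / (x (w i) - x (w (i + 1))))"
proof -
  let ?L = "linear_extensions n P" and ?A = "{1..n}"
  note PA = partial_order_on_subset[OF P]
  define d where "d w i = x (w i) - x (w (i + 1))" for w and i :: nat
  define F where "F w i t = (if d w i > 0 then of_bool (t \<ge> 0) else - of_bool (t < 0)) * exp (- (t * d w i))"
    for w i and t :: real
  have "has_bochner_integral (root_measure n)
      (\<lambda>v. \<Sum>w\<in>?L. \<Prod>i\<in>{1..<n}. F w i (\<Sum>k\<in>{1..i}. v (w k)))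
      (\<Sum>w\<in>?L. \<Prod>i\<in>{1..<n}. 1 / d w i)"
  proof (rule has_bochner_integral_sum)
    fix w assume "w \<in> ?L"
    then have p: "w permutes ?A" by (simp add: linear_extensions_def)
    show "has_bochner_integral (root_measure n)
      (\<lambda>v. \<Prod>i\<in>{1..<n}. F w i (\<Sum>k\<in>{1..i}. v (w k))) (\<Prod>i\<in>{1..<n}. 1 / d w i)"
    proof (rule has_bochner_integral_root_product[OF p])
      fix i assume i: "i \<in> {1..<n}"
      have "w i \<noteq> w (i + 1)" using injD[OF permutes_inj[OF p], of i "i + 1"] by auto
      moreover have "w i \<in> ?A" "w (i + 1) \<in> ?A" using permutes_in_image[OF p] i by auto
      ultimately have "d w i \<noteq> 0" using inj_onD[OF inj, of "w i" "w (i + 1)"] by (auto simp: d_def)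
      then show "has_bochner_integral lborel (F w i) (1 / d w i)"
        unfolding F_def by (rule has_bochner_integral_signed_exp)
    qed
  qed
  moreover have "(\<Sum>w\<in>?L. \<Prod>i\<in>{1..<n}. F w i (\<Sum>k\<in>{1..i}. v (w k))) = root_integrand n P x v"
    if v: "v \<in> V_root n" for v
  proof -
    have v0: "(\<Sum>k\<in>?A. v k) = 0" using v by (simp add: V_root_def)
    have "(\<Prod>i\<in>{1..<n}. F w i (\<Sum>k\<in>{1..i}. v (w k))) =
        (\<Prod>i\<in>{1..<n}. signed_ind (x (w i) > x (w (i + 1))) (\<Sum>k\<in>{1..i}. v (w k))) * exp (- pairing n x v)"
      if "w \<in> ?L" for w
    proof -
      have p: "w permutes ?A" using that by (simp add: linear_extensions_def)
      have "(\<Sum>i\<in>{1..<n}. (\<Sum>k\<in>{1..i}. v (w k)) * d w i) = (\<Sum>k\<in>?A. x (w k) * v (w k)) - x (w n) * (\<Sum>k\<in>?A. v (w k))"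
        unfolding d_def by (rule abel_summation)
      also have "(\<Sum>k\<in>?A. v (w k)) = 0" using sum.permute[OF p, of v] v0 by (simp add: o_def)
      also have "(\<Sum>k\<in>?A. x (w k) * v (w k)) = pairing n x v"
        using sum.permute[OF p, of "\<lambda>k. x k * v k"] by (simp add: o_def pairing_def)
      finally have e: "(\<Sum>i\<in>{1..<n}. (\<Sum>k\<in>{1..i}. v (w k)) * d w i) = pairing n x v" by simp
      have "(\<Prod>i\<in>{1..<n}. F w i (\<Sum>k\<in>{1..i}. v (w k))) =
        (\<Prod>i\<in>{1..<n}. signed_ind (x (w i) > x (w (i + 1))) (\<Sum>k\<in>{1..i}. v (w k))) *
        (\<Prod>i\<in>{1..<n}. exp (- ((\<Sum>k\<in>{1..i}. v (w k)) * d w i)))"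
        by (simp add: F_def signed_ind_def d_def prod.distrib[symmetric])
      also have "(\<Prod>i\<in>{1..<n}. exp (- ((\<Sum>k\<in>{1..i}. v (w k)) * d w i))) = exp (- pairing n x v)"
        by (simp add: exp_sum[symmetric] sum_negf e[symmetric])
      finally show ?thesis .
    qed
    then have "(\<Sum>w\<in>?L. \<Prod>i\<in>{1..<n}. F w i (\<Sum>k\<in>{1..i}. v (w k))) =
       (\<Sum>w\<in>?L. \<Prod>i\<in>{1..<n}. signed_ind (x (w i) > x (w (i + 1))) (\<Sum>k\<in>{1..i}. v (w k))) * exp (- pairing n x v)"
      by (simp add: sum_distrib_right)
    also have "\<dots> = of_bool (\<forall>I\<in>ideals n P. (\<Sum>k\<in>I. v k) \<ge> 0) * exp (- pairing n x v)"
      by (subst signed_sum_linear_extensions[OF PA inj _ v0]) (use x in \<open>auto simp: compatible_def\<close>)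
    also have "\<dots> = root_integrand n P x v"
      using K_root_iff[OF PA trans_strict_part[OF P], of v] v by (auto simp: root_integrand_def)
    finally show ?thesis .
  qed
  ultimately show ?thesis
    by (subst (asm) has_bochner_integral_cong[OF refl _ refl]) (auto simp: space_root_measure d_def)
qed

lemma sum_mult_unitv:
  fixes x :: "nat \<Rightarrow> real"
  assumes "i \<in> {1..n}" shows "(\<Sum>k\<in>{1..n}. x k * unitv i k) = x i"
  using assms by (simp add: unitv_def of_bool_def if_distrib cong: if_cong)

lemma pairing_K_root_nonneg:
  assumes P: "P \<subseteq> {1..n} \<times> {1..n}" and v: "v \<in> K_root n P"
    and x: "\<And>a b. (a, b) \<in> P - Id \<Longrightarrow> x b \<le> x a"
  shows "0 \<le> pairing n x v"
proof -
  obtain c where c: "v = (\<lambda>k\<in>{1..n}. \<Sum>(i, j)\<in>P - Id. c (i, j) * (unitv i k - unitv j k))"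
    "\<forall>a\<in>P - Id. 0 \<le> c a"
    using v by (auto simp: K_root_def)
  have "pairing n x v = (\<Sum>k\<in>{1..n}. \<Sum>e\<in>P - Id. c e * (x k * unitv (fst e) k - x k * unitv (snd e) k))"
    unfolding pairing_def c(1) by (intro sum.cong) (auto simp: sum_distrib_left case_prod_beta algebra_simps)
  also have "\<dots> = (\<Sum>e\<in>P - Id. c e * (x (fst e) - x (snd e)))"
  proof (subst sum.swap, intro sum.cong refl)
    fix e assume "e \<in> P - Id"
    then have "fst e \<in> {1..n}" "snd e \<in> {1..n}" using P by auto
    then show "(\<Sum>k\<in>{1..n}. c e * (x k * unitv (fst e) k - x k * unitv (snd e) k)) = c e * (x (fst e) - x (snd e))"
      by (simp only: sum_distrib_left[symmetric] sum_subtractf sum_mult_unitv)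
  qed
  also have "\<dots> \<ge> 0"
  proof (intro sum_nonneg mult_nonneg_nonneg)
    fix e assume e: "e \<in> P - Id"
    then show "0 \<le> c e" using c(2) by blast
    have "(fst e, snd e) \<in> P - Id" using e by simp
    then show "0 \<le> x (fst e) - x (snd e)" using x[of "fst e" "snd e"] by simp
  qed
  finally show ?thesis .
qed

lemma measurable_pairing [measurable]:
  "pairing n x \<in> borel_measurable (root_measure n)"
proof -
  have "(\<lambda>v. \<Sum>i\<in>{1..n}. x i * v i) \<in> borel_measurable (restrict_space (std_measure n) (V_root n))"
    by (intro borel_measurable_sum borel_measurable_times borel_measurable_const measurable_root_component)
  then show ?thesis by (simp add: pairing_def[abs_def] root_measure_eq)
qed

text \<open>Measurability at an arbitrary \<open>x\<close> follows from measurability at one generic \<open>r\<close>.\<close>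
lemma root_integrand_shift:
  "root_integrand n P x v = root_integrand n P r v * exp (pairing n r v - pairing n x v)"
  by (simp add: root_integrand_def exp_add[symmetric])

lemma finite_pos_scale:
  fixes f g :: "'a \<Rightarrow> real"
  assumes "finite S" "\<And>e. e \<in> S \<Longrightarrow> 0 < f e" "\<And>e. e \<in> S \<Longrightarrow> 0 < g e"
  shows "\<exists>\<epsilon>>0. \<forall>e\<in>S. \<epsilon> * g e \<le> f e"
proof -
  define \<epsilon> where "\<epsilon> = Min (insert 1 ((\<lambda>e. f e / g e) ` S))"
  have "\<epsilon> > 0" using assms by (auto simp: \<epsilon>_def)
  moreover have "\<epsilon> * g e \<le> f e" if "e \<in> S" for e
  proof -
    have "\<epsilon> \<le> f e / g e" unfolding \<epsilon>_def using assms(1) that by (intro Min_le) auto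
    then show ?thesis using assms(3)[OF that] by (simp add: field_simps)
  qed
  ultimately show ?thesis by blast
qed

text \<open>A small multiple \<open>r\<close> of an injective labelling is a generic point with \<open>x - r\<close> in the dual cone, so the
  integrand at \<open>r\<close> dominates the one at \<open>x\<close>.\<close>
lemma integrable_root_integrand:
  assumes P: "partial_order_on {1..n} P" and x: "compatible P x"
  shows "integrable (root_measure n) (root_integrand n P x)"
proof -
  note PA = partial_order_on_subset[OF P]
  have fin: "finite (P - Id)" using PA finite_subset by blast
  obtain r0 :: "nat \<Rightarrow> nat" where r0: "inj_on r0 {1..n}" "\<And>a b. (a, b) \<in> P - Id \<Longrightarrow> r0 b < r0 a"
    using ex_compatible_labelling[OF P] by blast
  have "\<exists>\<epsilon>>0. \<forall>e\<in>P - Id. \<epsilon> * (real (r0 (fst e)) - real (r0 (snd e))) \<le> x (fst e) - x (snd e)"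
  proof (rule finite_pos_scale[OF fin])
    fix e assume e: "e \<in> P - Id"
    obtain a b where ab: "e = (a, b)" by (cases e)
    show "0 < x (fst e) - x (snd e)" using compatibleD[OF x, of a b] e unfolding ab by simp
    show "0 < real (r0 (fst e)) - real (r0 (snd e))" using r0(2)[of a b] e unfolding ab by simp
  qed
  then obtain \<epsilon> where \<epsilon>: "\<epsilon> > 0"
    "\<forall>e\<in>P - Id. \<epsilon> * (real (r0 (fst e)) - real (r0 (snd e))) \<le> x (fst e) - x (snd e)"
    by (elim exE conjE)
  define r where "r k = \<epsilon> * real (r0 k)" for k
  have "compatible P r" by (rule compatibleI) (use r0(2) \<epsilon>(1) in \<open>simp add: r_def\<close>)
  moreover have "inj_on r {1..n}"
  proof (rule inj_onI)
    fix a b assume ab: "a \<in> {1..n}" "b \<in> {1..n}" "r a = r b"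
    then have "r0 a = r0 b" using \<epsilon>(1) by (simp add: r_def)
    then show "a = b" using inj_onD[OF r0(1)] ab by blast
  qed
  ultimately have int: "integrable (root_measure n) (root_integrand n P r)"
    using has_bochner_integral_root_generic[OF P] by (auto simp: has_bochner_integral_iff)
  have m: "root_integrand n P x \<in> borel_measurable (root_measure n)"
  proof -
    have [measurable]: "root_integrand n P r \<in> borel_measurable (root_measure n)"
      using int by (rule borel_measurable_integrable)
    show ?thesis unfolding root_integrand_shift[of n P x _ r, abs_def] by measurable
  qed
  show ?thesis
  proof (rule Bochner_Integration.integrable_bound[OF int m AE_I2])
    fix v
    have "pairing n r v \<le> pairing n x v" if "v \<in> K_root n P"
    proof -
      have "0 \<le> pairing n (\<lambda>k. x k - r k) v"
      proof (rule pairing_K_root_nonneg[OF PA that])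
        fix a b assume "(a, b) \<in> P - Id"
        then have "\<epsilon> * (real (r0 a) - real (r0 b)) \<le> x a - x b"
          using bspec[OF \<epsilon>(2), of "(a, b)"] by simp
        then show "x b - r b \<le> x a - r a" by (simp add: r_def algebra_simps)
      qed
      then show ?thesis by (simp add: pairing_def sum_subtractf algebra_simps)
    qed
    then show "norm (root_integrand n P x v) \<le> norm (root_integrand n P r v)"
      by (auto simp: root_integrand_def indicator_def)
  qed
qed

definition root_integral :: "nat \<Rightarrow> nat rel \<Rightarrow> (nat \<Rightarrow> real) \<Rightarrow> real" where
  "root_integral n P x = integral\<^sup>L (root_measure n) (root_integrand n P x)"

text \<open>The point \<open>y\<close> is approached along the ray \<open>y + t r\<close> with an injective labelling \<open>r\<close>. Two coordinates
  collide for at most one \<open>t\<close>, so all points with small \<open>t > 0\<close> are generic, and since \<open>r\<close> is in the dual cone,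
  the integrand at \<open>y\<close> dominates all others.\<close>
lemma approximable_root_integral:
  assumes P: "partial_order_on {1..n} P"
  shows "approximable n P (root_integral n P)"
  unfolding approximable_def
proof (intro allI impI)
  fix y assume y: "compatible P y"
  note PA = partial_order_on_subset[OF P]
  obtain r :: "nat \<Rightarrow> nat" where r: "inj_on r {1..n}" "\<And>a b. (a, b) \<in> P - Id \<Longrightarrow> r b < r a"
    using ex_compatible_labelling[OF P] by blast
  define Y where "Y t k = y k + t * real (r k)" for t k
  \<comment> \<open>The parameters at which two coordinates of \<open>Y t\<close> can coincide.\<close>
  define B where "B = (\<lambda>(a, b). (y b - y a) / (real (r a) - real (r b))) ` ({1..n} \<times> {1..n})"
  have "finite B" by (simp add: B_def)
  then have "finite {t \<in> B. t > 0}" by simp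
  obtain \<delta> where \<delta>: "\<delta> > 0" "\<And>t. t \<in> B \<Longrightarrow> t > 0 \<Longrightarrow> \<delta> < t"
  proof -
    define M where "M = Min (insert 1 {t \<in> B. t > 0})"
    have "M > 0" and "\<And>t. t \<in> B \<Longrightarrow> t > 0 \<Longrightarrow> M \<le> t"
      using \<open>finite B\<close> by (auto simp: M_def)
    show thesis
    proof (rule that[of "M / 2"])
      show "M / 2 < t" if "t \<in> B" "t > 0" for t
        using \<open>t \<in> B \<Longrightarrow> t > 0 \<Longrightarrow> M \<le> t\<close> that by simp
    qed (use \<open>M > 0\<close> in simp)
  qed
  have inj: "inj_on (Y t) {1..n}" if t: "0 < t" "t \<le> \<delta>" for t
  proof (rule inj_onI, rule ccontr)
    fix a b assume ab: "a \<in> {1..n}" "b \<in> {1..n}" "Y t a = Y t b" "a \<noteq> b"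
    then have "real (r a) - real (r b) \<noteq> 0" using r(1) by (auto dest: inj_onD)
    then have "t = (y b - y a) / (real (r a) - real (r b))"
      using ab(3) by (simp add: Y_def field_simps)
    then have "t \<in> B" using ab by (auto simp: B_def)
    then show False using \<delta>(2)[of t] t by simp
  qed
  have comp: "compatible P (Y t)" if "0 \<le> t" for t
  proof (rule compatibleI)
    fix a b assume ab: "(a, b) \<in> P - Id"
    then have "y b < y a" using y by (rule compatibleD[rotated])
    moreover have "real (r b) \<le> real (r a)" using r(2)[of a b] ab by simp
    then have "t * real (r b) \<le> t * real (r a)" using that by (intro mult_left_mono)
    ultimately show "Y t b < Y t a" by (simp add: Y_def)
  qed
  define X where "X k = Y (\<delta> / real (Suc k))" for k
  have lim: "(\<lambda>k. \<delta> / real (Suc k)) \<longlonglongrightarrow> 0"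
    using LIMSEQ_inverse_real_of_nat[THEN tendsto_mult_left, of \<delta>] by (simp add: divide_inverse)
  have limX: "(\<lambda>k. X k i) \<longlonglongrightarrow> y i" for i
    using tendsto_add[OF tendsto_const[of "y i"] tendsto_mult_right[OF lim, of "real (r i)"]]
    by (simp add: X_def Y_def)
  have "(\<lambda>k. root_integral n P (X k)) \<longlonglongrightarrow> root_integral n P y"
    unfolding root_integral_def
  proof (rule integral_dominated_convergence[where w = "root_integrand n P y"])
    show int: "integrable (root_measure n) (root_integrand n P y)"
      by (rule integrable_root_integrand[OF P y])
    then show "root_integrand n P y \<in> borel_measurable (root_measure n)" by simp
    show "root_integrand n P (X k) \<in> borel_measurable (root_measure n)" for k
      using integrable_root_integrand[OF P comp] \<delta>(1) by (auto simp: X_def)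
    show "AE v in root_measure n. (\<lambda>k. root_integrand n P (X k) v) \<longlonglongrightarrow> root_integrand n P y v"
    proof (rule AE_I2)
      fix v
      have "(\<lambda>k. pairing n (X k) v) \<longlonglongrightarrow> pairing n y v"
        unfolding pairing_def by (intro tendsto_sum tendsto_mult limX tendsto_const)
      then show "(\<lambda>k. root_integrand n P (X k) v) \<longlonglongrightarrow> root_integrand n P y v"
        unfolding root_integrand_def by (intro tendsto_intros)
    qed
    show "AE v in root_measure n. norm (root_integrand n P (X k) v) \<le> root_integrand n P y v" for k
    proof (rule AE_I2)
      fix v
      have "pairing n y v \<le> pairing n (X k) v" if "v \<in> K_root n P"
      proof -
        have "0 \<le> pairing n (\<lambda>k. real (r k)) v"
          by (rule pairing_K_root_nonneg[OF PA that]) (use r(2) in \<open>auto intro: less_imp_le\<close>)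
        then have "0 \<le> \<delta> / real (Suc k) * pairing n (\<lambda>k. real (r k)) v" using \<delta>(1) by simp
        also have "\<dots> = pairing n (X k) v - pairing n y v"
          by (simp add: pairing_def X_def Y_def sum_distrib_left sum_subtractf[symmetric] algebra_simps)
        finally show ?thesis by simp
      qed
      then show "norm (root_integrand n P (X k) v) \<le> root_integrand n P y v"
        by (auto simp: root_integrand_def indicator_def)
    qed
  qed
  moreover have "compatible P (X k) \<and> inj_on (X k) {1..n}" for k
    unfolding X_def using \<delta>(1) by (intro conjI comp inj) (auto simp: field_simps)
  ultimately show "\<exists>X. (\<forall>k. compatible P (X k) \<and> inj_on (X k) {1..n}) \<and>
      (\<forall>i\<in>{1..n}. (\<lambda>k. X k i) \<longlonglongrightarrow> y i) \<and> (\<lambda>k. root_integral n P (X k)) \<longlonglongrightarrow> root_integral n P y"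
    using limX by blast
qed

section \<open>Dimension and dual of the root cone\<close>

lemma root_in_K_root:
  assumes "P \<subseteq> {1..n} \<times> {1..n}" "(a, b) \<in> P - Id"
  shows "(\<lambda>k\<in>{1..n}. unitv a k - unitv b k) \<in> K_root n P"
proof -
  have fin: "finite (P - Id)" using assms(1) finite_subset by blast
  have "(\<Sum>(i, j)\<in>P - Id. of_bool ((i, j) = (a, b)) * (unitv i k - unitv j k)) = unitv a k - unitv b k" for k
  proof -
    have "(\<Sum>(i, j)\<in>P - Id. of_bool ((i, j) = (a, b)) * (unitv i k - unitv j k))
        = (\<Sum>e\<in>P - Id. if e = (a, b) then unitv a k - unitv b k else 0)"
      by (intro sum.cong) (auto simp: case_prod_beta)
    then show ?thesis using fin assms(2) by simp
  qed
  then show ?thesis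
    unfolding K_root_def by (intro CollectI exI[of _ "\<lambda>e. of_bool (e = (a, b))"]) auto
qed

lemma pairing_root:
  assumes "a \<in> {1..n}" "b \<in> {1..n}"
  shows "pairing n x (\<lambda>k\<in>{1..n}. unitv a k - unitv b k) = x a - x b"
proof -
  have "pairing n x (\<lambda>k\<in>{1..n}. unitv a k - unitv b k) = (\<Sum>k\<in>{1..n}. x k * unitv a k - x k * unitv b k)"
    unfolding pairing_def by (intro sum.cong) (auto simp: right_diff_distrib)
  then show ?thesis using assms by (simp only: sum_subtractf sum_mult_unitv)
qed

text \<open>Move \<open>x\<close> against a labelling that decreases strictly along \<open>P\<close> and pair with the generators of the cone.\<close>
lemma dual_interior_K_root:
  assumes P: "partial_order_on {1..n} P" and x: "x \<in> dual_interior n (K_root n P)"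
  shows "compatible P x"
proof (rule compatibleI)
  fix a b assume ab: "(a, b) \<in> P - Id"
  note PA = partial_order_on_subset[OF P]
  then have abA: "a \<in> {1..n}" "b \<in> {1..n}" using ab by auto
  obtain r :: "nat \<Rightarrow> nat" where r: "\<And>a b. (a, b) \<in> P - Id \<Longrightarrow> r b < r a"
    using ex_compatible_labelling[OF P] by blast
  obtain \<epsilon> where \<epsilon>: "\<epsilon> > 0" "(\<lambda>k\<in>{1..n}. x k - \<epsilon> * real (r k)) \<in> dual_cone n (K_root n P)"
    using dual_interior_perturb[OF x, of "\<lambda>k. real (r k)"] by blast
  then have "0 \<le> pairing n (\<lambda>k\<in>{1..n}. x k - \<epsilon> * real (r k)) (\<lambda>k\<in>{1..n}. unitv a k - unitv b k)"
    using root_in_K_root[OF PA ab] by (simp only: dual_cone_def mem_Collect_eq)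
  then have "\<epsilon> * real (r a) - \<epsilon> * real (r b) \<le> x a - x b"
    unfolding pairing_root[OF abA] using abA by simp
  moreover have "\<epsilon> * real (r b) < \<epsilon> * real (r a)" using r[OF ab] \<epsilon>(1) by simp
  ultimately show "x b < x a" by simp
qed

text \<open>Along a line in the cone the sum over an ideal is affine and nonnegative, hence constant. So the direction of the line sums to
  \<open>0\<close> over all ideals, and a single coordinate is the difference of two such sums.\<close>
lemma K_root_pointed:
  assumes P: "partial_order_on {1..n} P"
  shows "\<not> contains_line n (K_root n P)"
proof
  note PA = partial_order_on_subset[OF P]
  assume "contains_line n (K_root n P)"
  then obtain a d k where k: "k \<in> {1..n}" "d k \<noteq> 0"
    and line: "\<And>t. (\<lambda>k\<in>{1..n}. a k + t * d k) \<in> K_root n P"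
    unfolding contains_line_def by blast
  have d0: "(\<Sum>k\<in>I. d k) = 0" if I: "I \<in> ideals n P" for I
  proof (rule affine_nonneg_slope_0[where a = "\<Sum>k\<in>I. a k"])
    fix t
    have "I \<subseteq> {1..n}" using I by (simp add: ideals_def)
    then have "(\<Sum>k\<in>I. (\<lambda>k\<in>{1..n}. a k + t * d k) k) = (\<Sum>k\<in>I. a k) + t * (\<Sum>k\<in>I. d k)"
      by (subst sum_distrib_left, subst sum.distrib[symmetric], intro sum.cong) auto
    moreover have "0 \<le> (\<Sum>k\<in>I. (\<lambda>k\<in>{1..n}. a k + t * d k) k)"
      using line[of t] I unfolding K_root_iff[OF PA trans_strict_part[OF P]] by blast
    ultimately show "0 \<le> (\<Sum>k\<in>I. a k) + t * (\<Sum>k\<in>I. d k)" by simp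
  qed
  let ?I = "{j. (j, k) \<in> P}"
  have "finite ?I" by (rule finite_subset[of _ "{1..n}"]) (use PA in auto)
  then have "(\<Sum>k\<in>?I. d k) = d k + (\<Sum>k\<in>?I - {k}. d k)"
    using ideals_principal(3)[OF P k(1)] by (intro sum.remove) auto
  then show False using d0 ideals_principal[OF P k(1)] k(2) by simp
qed

text \<open>Let \<open>B\<close> consist of the \<open>j\<close> with \<open>e\<^sub>1 - e\<^sub>j\<close> in the span. A relation of \<open>P\<close> between two elements puts both
  in \<open>B\<close> or both outside. If \<open>B\<close> is everything, these vectors span the hyperplane.\<close>
lemma K_root_spans_or_splits:
  assumes P: "partial_order_on {1..n} P"
  shows "lin_span n (K_root n P) = V_root n \<or>
    (\<exists>B. B \<noteq> {} \<and> B \<subset> {1..n} \<and> B \<in> ideals n P \<and> {1..n} - B \<in> ideals n P)"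
proof -
  let ?A = "{1..n}" and ?S = "lin_span n (K_root n P)"
  note PA = partial_order_on_subset[OF P]
  define u where "u j = (\<lambda>k\<in>?A. unitv 1 k - unitv j k)" for j
  define B where "B = {j \<in> ?A. u j \<in> ?S}"
  have root: "(\<lambda>k\<in>?A. unitv a k - unitv b k) \<in> ?S" if "(a, b) \<in> P - Id" for a b
    using root_in_K_root[OF PA that] by (rule lin_span_base) (rule restrict_extensional)
  have edge: "a \<in> B \<longleftrightarrow> b \<in> B" if ab: "(a, b) \<in> P - Id" for a b
  proof -
    have abA: "a \<in> ?A" "b \<in> ?A" using ab PA by auto
    have "(\<lambda>k\<in>?A. 1 * u a k + 1 * (\<lambda>k\<in>?A. unitv a k - unitv b k) k) = u b"
      "(\<lambda>k\<in>?A. 1 * u b k + (-1) * (\<lambda>k\<in>?A. unitv a k - unitv b k) k) = u a"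
      by (auto simp: u_def)
    then have "u a \<in> ?S \<longleftrightarrow> u b \<in> ?S" using lin_span_lincomb[OF _ root[OF ab]] by metis
    then show ?thesis using abA by (simp add: B_def)
  qed
  show ?thesis
  proof (cases "B = ?A")
    case True
    have "V_root n \<subseteq> ?S"
    proof
      fix v assume v: "v \<in> V_root n"
      have "(\<lambda>k\<in>?A. \<Sum>j\<in>?A. (- v j) * u j k) \<in> ?S"
      proof (rule lin_span_sum)
        fix j assume "j \<in> ?A"
        then have "j \<in> B" using True by simp
        then show "u j \<in> ?S" by (simp add: B_def)
      qed simp
      moreover have "(\<lambda>k\<in>?A. \<Sum>j\<in>?A. (- v j) * u j k) = v"
      proof
        fix k
        have "(\<Sum>j\<in>?A. (- v j) * u j k) = v k" if k: "k \<in> ?A"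
        proof -
          have "(\<Sum>j\<in>?A. (- v j) * u j k) = (\<Sum>j\<in>?A. (if j = k then v j else 0) - v j * unitv 1 k)"
            using k by (intro sum.cong) (auto simp: u_def unitv_def)
          also have "\<dots> = v k - (\<Sum>j\<in>?A. v j) * unitv 1 k"
            using k by (simp add: sum_subtractf sum_distrib_right)
          finally show ?thesis using v by (simp add: V_root_def)
        qed
        then show "(\<lambda>k\<in>?A. \<Sum>j\<in>?A. (- v j) * u j k) k = v k"
          using v by (auto simp: V_root_def extensional_def)
      qed
      ultimately show "v \<in> ?S" by simp
    qed
    moreover have "?S \<subseteq> V_root n"
    proof
      fix v assume "v \<in> ?S"
      then obtain F c where F: "finite F" "F \<subseteq> K_root n P" "v = (\<lambda>k\<in>?A. \<Sum>z\<in>F. c z * z k)"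
        by (auto simp: lin_span_def)
      have z0: "(\<Sum>k\<in>?A. z k) = 0" if "z \<in> F" for z
        using that F(2) K_root_iff[OF PA trans_strict_part[OF P]] by (auto simp: V_root_def)
      have "(\<Sum>k\<in>?A. v k) = (\<Sum>z\<in>F. \<Sum>k\<in>?A. c z * z k)"
        unfolding F(3) by (subst sum.swap) (auto intro: sum.cong)
      also have "\<dots> = (\<Sum>z\<in>F. c z * 0)" by (simp only: sum_distrib_left[symmetric] z0 cong: sum.cong)
      also have "\<dots> = 0" by simp
      finally show "v \<in> V_root n" using F(3) by (simp add: V_root_def)
    qed
    ultimately show ?thesis by blast
  next
    case False
    then have "1 \<le> n" by (cases n) (auto simp: B_def)
    moreover have "u 1 \<in> ?S"
      using lin_span_sum[of "{}" undefined n "K_root n P" undefined] by (simp add: u_def)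
    ultimately have "1 \<in> B" by (simp add: B_def)
    moreover have "B \<subset> ?A" using False by (auto simp: B_def)
    moreover have "B \<in> ideals n P" "?A - B \<in> ideals n P"
    proof -
      have "B \<subseteq> ?A" by (auto simp: B_def)
      then show "B \<in> ideals n P" unfolding ideals_def using edge by blast
      show "?A - B \<in> ideals n P" unfolding ideals_def using edge PA by blast
    qed
    ultimately show ?thesis by blast
  qed
qed

lemma ex_permutation_prefix:
  assumes "B \<subseteq> {1..n}"
  shows "\<exists>w. w permutes {1..n} \<and> w ` {1..card B} = B"
proof -
  let ?I = "{1..card B}"
  have fB: "finite B" and le: "card B \<le> n"
    using assms finite_subset card_mono[OF _ assms] by auto
  then have sub: "?I \<subseteq> {1..n}" by auto
  obtain f where f: "bij_betw f ?I B" using finite_same_card_bij[of ?I B] fB by auto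
  have "card ({1..n} - ?I) = card ({1..n} - B)"
    using sub assms fB by (simp add: card_Diff_subset)
  then obtain g where g: "bij_betw g ({1..n} - ?I) ({1..n} - B)"
    using finite_same_card_bij[of "{1..n} - ?I" "{1..n} - B"] by auto
  define w where "w i = (if i \<in> ?I then f i else if i \<in> {1..n} then g i else i)" for i
  have wI: "bij_betw w ?I B" using f by (rule bij_betw_cong[THEN iffD1, rotated]) (simp add: w_def)
  have "bij_betw w ({1..n} - ?I) ({1..n} - B)"
    using g by (rule bij_betw_cong[THEN iffD1, rotated]) (auto simp: w_def)
  with wI have "bij_betw w (?I \<union> ({1..n} - ?I)) (B \<union> ({1..n} - B))"
    by (rule bij_betw_combine) auto
  moreover have "?I \<union> ({1..n} - ?I) = {1..n}" "B \<union> ({1..n} - B) = {1..n}" using sub assms by auto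
  ultimately have "w permutes {1..n}"
    using sub by (intro bij_imp_permutes) (auto simp: w_def)
  then show ?thesis using wI by (auto simp: bij_betw_def)
qed

text \<open>On the cone the sums over \<open>B\<close> and over its complement are nonnegative and add up to \<open>0\<close>, so the sum over
  \<open>B\<close> is \<open>0\<close>. Listing \<open>B\<close> first makes this sum a coordinate of the product measure, and a coordinate
  hyperplane is a null set.\<close>
lemma root_integral_eq_0:
  assumes P: "partial_order_on {1..n} P" and x: "compatible P x"
    and B: "B \<noteq> {}" "B \<subset> {1..n}" "B \<in> ideals n P" "{1..n} - B \<in> ideals n P"
  shows "root_integral n P x = 0"
proof -
  let ?A = "{1..n}" and ?M = "coord_measure n"
  note PA = partial_order_on_subset[OF P]
  have fB: "finite B" using B(2) finite_subset by blast
  define m where "m = card B"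
  have m: "m \<in> {1..<n}"
    using B(1,2) fB psubset_card_mono[of ?A B] by (auto simp: m_def Suc_le_eq card_gt_0_iff)
  obtain w where w: "w permutes ?A" "w ` {1..m} = B"
    using ex_permutation_prefix[of B n] B(2) by (auto simp: m_def)
  have "AE c in ?M. c m \<noteq> 0"
  proof (rule AE_I')
    let ?N = "PiE {1..<n} (\<lambda>i. if i = m then {0::real} else UNIV)"
    have "emeasure ?M ?N = (\<Prod>i\<in>{1..<n}. emeasure lborel (if i = m then {0::real} else UNIV))"
      by (rule lb.emeasure_PiM) auto
    also have "\<dots> = 0" by (rule prod_zero) (use m in auto)
    finally show "?N \<in> null_sets ?M" by (auto simp: null_sets_def intro!: sets_PiM_I_finite)
    show "{c \<in> space ?M. \<not> c m \<noteq> 0} \<subseteq> ?N" by (auto simp: space_PiM PiE_def Pi_def)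
  qed
  then have "AE c in distr ?M ?M (reorder n w). c m \<noteq> 0" unfolding distr_reorder[OF w(1)] .
  then have AE: "AE c in ?M. reorder n w c m \<noteq> 0" by (rule AE_distrD[OF measurable_reorder])
  have m_int: "root_integrand n P x \<in> borel_measurable (restrict_space (std_measure n) (V_root n))"
    using borel_measurable_integrable[OF integrable_root_integrand[OF P x]]
    by (simp add: root_measure_eq)
  have "root_integral n P x = (\<integral>c. root_integrand n P x (root_vec n c) \<partial>?M)"
    unfolding root_integral_def root_measure_eq by (rule integral_distr[OF measurable_root_vec m_int])
  also have "\<dots> = 0"
  proof (rule integral_eq_zero_AE, use AE in eventually_elim)
    fix c assume c: "reorder n w c m \<noteq> 0"
    let ?v = "root_vec n c"
    have "(\<Sum>k\<in>B. ?v k) = reorder n w c m"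
      using m w permutes_inj[OF w(1)] unfolding w(2)[symmetric]
      by (subst sum.reindex) (auto simp: reorder_def intro: inj_on_subset)
    moreover have "(\<Sum>k\<in>B. ?v k) + (\<Sum>k\<in>?A - B. ?v k) = 0"
      using root_vec_sum_0[of n c] sum.subset_diff[of B ?A ?v] B(2) by (simp add: add.commute)
    ultimately have "\<not> (0 \<le> (\<Sum>k\<in>B. ?v k) \<and> 0 \<le> (\<Sum>k\<in>?A - B. ?v k))" using c by linarith
    then have "?v \<notin> K_root n P"
      unfolding K_root_iff[OF PA trans_strict_part[OF P]] using B(3,4) by blast
    then show "root_integrand n P x ?v = 0" by (simp add: root_integrand_def)
  qed
  finally show ?thesis .
qed

section \<open>The two identities\<close>

text \<open>The generic values determine \<open>Psi\<close> as a fraction with linear factors \<open>x\<^sub>a - x\<^sub>b\<close>; after cancelling those with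
  incomparable \<open>a\<close> and \<open>b\<close> the denominator has no zero in the interior of the dual cone. For a cone of smaller
  dimension the same fraction has numerator \<open>0\<close>, because the integral vanishes.\<close>

theorem Psi_eq_cone_s:
  assumes P: "partial_order_on {1..n} P"
  shows "cone_s n (root_measure n) (K_root n P) = Psi n P"
proof -
  let ?A = "{1..n}" and ?L = "linear_extensions n P" and ?K = "K_root n P"
  note PA = partial_order_on_subset[OF P]
  define steps where "steps w = map (\<lambda>i. (w i, w (i + 1))) [1..<n]" for w :: "nat \<Rightarrow> nat"
  have linear_steps: "linear_prod (steps w) = (\<Prod>i\<in>{1..<n}. polyvar (w i) - polyvar (w (i + 1)))" for w
    unfolding linear_prod_def steps_def
    using prod.distinct_set_conv_list[of "[1..<n]" "\<lambda>i. polyvar (w i) - polyvar (w (i + 1))"]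
    by (simp add: o_def)
  have steps_in: "set (steps w) \<subseteq> distinct_pairs n" if p: "w permutes ?A" for w
    using permutes_in_image[OF p] injD[OF permutes_inj[OF p]]
    by (fastforce simp: steps_def distinct_pairs_def)
  have perm: "w permutes ?A" if "w \<in> ?L" for w using that by (simp add: linear_extensions_def)
  have Psi_term: "perm_act w (1 / (\<Prod>i\<in>{1..<n}. xvar i - xvar (i + 1))) = Fract 1 (linear_prod (steps w))"
    if w: "w permutes ?A" for w
  proof -
    have "linear_prod (steps id) \<noteq> 0" using steps_in[OF permutes_id] by (rule linear_prod_nonzero)
    then have "perm_act w (1 / Fract (linear_prod (steps id)) 1) = Fract 1 (mpoly_rename w (linear_prod (steps id)))"
      using w by (intro perm_act_reciprocal permutes_bij)
    moreover have "mpoly_rename w (linear_prod (steps id)) = linear_prod (steps w)"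
      by (simp add: linear_steps rename_hom)
    moreover have "(\<Prod>i\<in>{1..<n}. xvar i - xvar (i + 1)) = Fract (linear_prod (steps id)) 1"
      unfolding linear_steps Fract_prod[symmetric] by (simp add: xvar_polyvar)
    ultimately show ?thesis by simp
  qed
  have Psi: "Psi n P = (\<Sum>w\<in>?L. Fract 1 (linear_prod (steps w)))"
    unfolding Psi_def using Psi_term perm by (intro sum.cong) auto
  have "linear_fraction n (Psi n P)"
    unfolding Psi
  proof (rule linear_fraction_sum)
    fix w assume "w \<in> ?L"
    then show "linear_fraction n (Fract 1 (linear_prod (steps w)))"
      unfolding linear_fraction_def using steps_in perm polys_in_1 by blast
  qed
  then obtain p xs where p: "p \<in> polys_in n" and xs: "set xs \<subseteq> distinct_pairs n"
    and Psi_p: "Psi n P = Fract p (linear_prod xs)"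
    by (auto simp: linear_fraction_def)

  have eval_nz: "mpoly_eval x (linear_prod ys) \<noteq> 0"
    if "inj_on x ?A" "set ys \<subseteq> distinct_pairs n" for x ys
    using that unfolding eval_linear_prod_eq_0_iff by (fastforce simp: distinct_pairs_def dest: inj_onD)

  have generic: "mpoly_eval x p = mpoly_eval x (linear_prod ([] @ xs)) * root_integral n P x"
    if x: "compatible P x" and inj: "inj_on x ?A" for x
  proof -
    have int: "root_integral n P x = (\<Sum>w\<in>?L. \<Prod>i\<in>{1..<n}. 1 / (x (w i) - x (w (i + 1))))"
      unfolding root_integral_def
      by (rule has_bochner_integral_integral_eq[OF has_bochner_integral_root_generic[OF P x inj]])
    have "ratfun_value (Psi n P) x (root_integral n P x)"
      unfolding Psi int
    proof (rule ratfun_value_sum)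
      fix w assume "w \<in> ?L"
      then have "mpoly_eval x (linear_prod (steps w)) \<noteq> 0" using eval_nz[OF inj] steps_in perm by blast
      then show "ratfun_value (Fract 1 (linear_prod (steps w))) x (\<Prod>i\<in>{1..<n}. 1 / (x (w i) - x (w (i + 1))))"
        by (simp add: ratfun_value_Fract eval_hom) (simp add: linear_steps eval_hom prod_dividef)
    qed
    then show ?thesis
      using eval_nz[OF inj xs] unfolding Psi_p by (simp add: ratfun_value_Fract)
  qed
  have "\<exists>q ys. q \<in> polys_in n \<and> set ys \<subseteq> distinct_pairs n \<and> Psi n P = Fract q (linear_prod ys) \<and>
      (\<forall>(a, b)\<in>set ys. (a, b) \<in> P \<or> (b, a) \<in> P) \<and>
      (\<forall>y. compatible P y \<longrightarrow> mpoly_eval y q = mpoly_eval y (linear_prod ys) * root_integral n P y)"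
    by (rule cancel_incomparable_factors[OF P approximable_root_integral[OF P] p, of "[]" xs])
       (use xs Psi_p generic in auto)
  then obtain q ys where q: "q \<in> polys_in n" and ys: "set ys \<subseteq> distinct_pairs n"
    and Psi_q: "Psi n P = Fract q (linear_prod ys)"
    and comparable: "\<forall>(a, b)\<in>set ys. (a, b) \<in> P \<or> (b, a) \<in> P"
    and val: "\<And>y. compatible P y \<Longrightarrow> mpoly_eval y q = mpoly_eval y (linear_prod ys) * root_integral n P y"
    by blast

  obtain r :: "nat \<Rightarrow> nat" where r: "\<And>a b. (a, b) \<in> P - Id \<Longrightarrow> r b < r a"
    using ex_compatible_labelling[OF P] by blast
  have box: "compatible P x" if "x \<in> (\<Pi>\<^sub>E i\<in>?A. box_around r i)" for x
    by (rule box_compatible[OF PA r that])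

  show ?thesis
  proof (cases "lin_span n ?K = V_root n")
    case True
    show ?thesis
    proof (rule cone_s_eqI[where S = "box_around r"])
      show "\<not> contains_line n ?K" by (rule K_root_pointed[OF P])
      show "lin_span n ?K = space (root_measure n)" by (simp add: True space_root_measure)
      have "linear_prod ys \<in> polys_in n" using ys by (intro linear_prod_in) (auto simp: distinct_pairs_def)
      then show "Psi n P \<in> ratfuns_in n"
        unfolding Psi_q ratfuns_in_def using q linear_prod_nonzero[OF ys] by blast
      show "(\<Pi>\<^sub>E i\<in>?A. box_around r i) \<subseteq> dual_interior n ?K"
      proof (rule open_box_subset_dual_interior)
        show "(\<Pi>\<^sub>E i\<in>?A. box_around r i) \<subseteq> dual_cone n ?K"
        proof
          fix x assume x: "x \<in> (\<Pi>\<^sub>E i\<in>?A. box_around r i)"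
          have "0 \<le> pairing n x v" if "v \<in> ?K" for v
            by (rule pairing_K_root_nonneg[OF PA that]) (use compatibleD[OF box[OF x]] in \<open>auto intro: less_imp_le\<close>)
          then show "x \<in> dual_cone n ?K" using x by (auto simp: dual_cone_def PiE_def)
        qed
      qed simp
      show "infinite (box_around r i)" for i by (rule box_infinite)
    next
      fix x assume "x \<in> dual_interior n ?K"
      then have x: "compatible P x" by (rule dual_interior_K_root[OF P])
      have "has_bochner_integral (root_measure n) (\<lambda>v. indicator ?K v * exp (- pairing n x v)) (root_integral n P x)"
        using has_bochner_integral_integrable[OF integrable_root_integrand[OF P x]]
        by (simp add: root_integral_def root_integrand_def[abs_def])
      moreover have "x a \<noteq> x b" if "(a, b) \<in> set ys" for a b
      proof -
        have "a \<noteq> b" using that ys by (auto simp: distinct_pairs_def)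
        then show ?thesis
          using that comparable compatibleD[OF x, of a b] compatibleD[OF x, of b a] by auto
      qed
      then have "mpoly_eval x (linear_prod ys) \<noteq> 0" unfolding eval_linear_prod_eq_0_iff by blast
      then have "ratfun_value (Psi n P) x (root_integral n P x)"
        unfolding Psi_q using val[OF x] by (simp add: ratfun_value_Fract)
      ultimately show "\<exists>c. has_bochner_integral (root_measure n)
          (\<lambda>v. indicator ?K v * exp (- pairing n x v)) c \<and> ratfun_value (Psi n P) x c" by blast
    qed
  next
    case False
    then obtain B where B: "B \<noteq> {}" "B \<subset> ?A" "B \<in> ideals n P" "?A - B \<in> ideals n P"
      using K_root_spans_or_splits[OF P] by blast
    have "q = 0"
    proof (rule polynomial_vanishing_on_box[OF q, where S = "box_around r"])
      fix x assume "x \<in> (\<Pi>\<^sub>E i\<in>?A. box_around r i)"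
      then have "compatible P x" by (rule box)
      then show "mpoly_eval x q = 0" using val root_integral_eq_0[OF P _ B] by simp
    qed (rule box_infinite)
    then have "Psi n P = 0"
      using linear_prod_nonzero[OF ys] by (simp add: Psi_q Zero_fract_def eq_fract)
    then show ?thesis using False by (simp add: cone_s_def space_root_measure)
  qed
qed

theorem proposition3p1:
  fixes n :: nat and P :: "nat rel"
  assumes "partial_order_on {1..n} P"
  shows "Psi n P = cone_s n (root_measure n) (K_root n P) \<and>
         Phi n P = cone_s n (std_measure n) (K_wt n P)"
  using Psi_eq_cone_s[OF assms] Phi_eq_cone_s[OF assms] by simp

end
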